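(* Let $p \ge 1$ and let $\mathcal{G} = (\mathcal{V}, \mathcal{E})$, $\mathcal{V} = [n]$, be a lateration graph in dimension $p$. Then there are positive quantities $\sigma > 0$ and $A > 0$, which for the given $p$ and graph are continuous functions of the edge lengths $(\|x_i - x_j\| : (i,j) \in \mathcal{E})$ (as $x_1, \dots, x_n$ ranges over configurations in general position), such that the following holds for every configuration $x_1, \dots, x_n \in \mathbb{R}^p$ in general position, with $\sigma$ and $A$ evaluated at its edge lengths. Let $(d_{ij} : (i,j) \in \mathcal{E})$ be non-negative dissimilarities and write $$d_{ij}^2 = \|x_i - x_j\|^2 + \varepsilon_{ij}, \qquad (i,j) \in \mathcal{E}.$$ If $\sum_{(i,j) \in \mathcal{E}} \varepsilon_{ij}^2 \le \sigma^2$, then sequential lateration (in dimension $p$, applied to $\mathcal{G}$ and $(d_{ij})$) outputs an embedding $y_1, \dots, y_n \in \mathbb{R}^p$ satisfying $$\min_{g} \sum_{i \in [n]} \|y_i - g(x_i)\|^2 \le A \sum_{(i,j) \in \mathcal{E}} \varepsilon_{ij}^2,$$ where the minimization is over the group of rigid transformations of $\mathbb{R}^p$.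
   Context: Notation: $[n] = \{1, \dots, n\}$; $\|\cdot\|$ is the Euclidean norm on $\mathbb{R}^p$; the embedding dimension $p$ is given. Graphs are undirected. A rigid transformation is a Euclidean isometry of $\mathbb{R}^p$ (reflections allowed). The dissimilarities are symmetric: $d_{ij} = d_{ji}$. Lateration graph (in dimension $p$): a graph with $n \ge p+1$ vertices that admits an ordering $v_1, \dots, v_n$ of its vertices (a laterative ordering) such that the subgraph induced by $v_1, \dots, v_{p+1}$ is complete and, for each $j > p+1$, $v_j$ is connected to at least $p+1$ vertices among $v_1, \dots, v_{j-1}$. General position: a configuration in $\mathbb{R}^p$ is in general position if any $(p+1)$-tuple of (distinctly indexed) points of it spans the entire space (i.e., its affine span is $\mathbb{R}^p$). Stress of an embedding $y_1, \dots, y_n$: $\sum_{(i,j) \in \mathcal{E}} (\|y_i - y_j\|^2 - d_{ij}^2)^2$. Classical scaling (dimension $p$): given a complete set of dissimilarities $(d_{ij})_{1 \le i,j \le m}$ (symmetric, $d_{ii} = 0$), let $\Delta = (d_{ij}^2)$, $H = I - \frac1m \mathbf{1}\mathbf{1}^\top$, $B = -\frac12 H \Delta H$; let $\lambda_1 \ge \dots \ge \lambda_p$ be the $p$ largest eigenvalues of $B$ with orthonormal eigenvectors $u_1, \dots, u_p$; the output $y_1, \dots, y_m \in \mathbb{R}^p$ are the rows of the $m \times p$ matrix with columns $\sqrt{\max(\lambda_k, 0)}\, u_k$, $k = 1, \dots, p$. Classical lateration: given landmark points $y_1, \dots, y_m \in \mathbb{R}^p$ and dissimilarities $d_1, \dots,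 d_m \ge 0$, let $\bar y = \frac1m \sum_i y_i$, let $Y$ be the $m \times p$ matrix with rows $(y_i - \bar y)^\top$, $Y^\dagger$ its Moore–Penrose pseudo-inverse, $a = (d_1^2, \dots, d_m^2)^\top$, and $\bar a$ the vector with entries $\bar a_i = \frac1m \sum_j \|y_i - y_j\|^2$; the output is the point $y = \bar y + \frac12 Y^\dagger (\bar a - a)$. Sequential lateration: for each $(p+1)$-tuple of nodes in $\mathcal{V}$, if it forms a clique, embed it by classical scaling from the corresponding dissimilarities; then recursively embed, by classical lateration, any node that is neighbor to at least $p+1$ nodes that have already been embedded (the landmarks being at least $p+1$ already embedded neighbors, with the corresponding dissimilarities). In the "first" variant, stop at the first full embedding (of all $n$ nodes) achieved in this manner; in the "best" variant, go through all full embeddings obtained in this manner from the different $(p+1)$-cliques and output one with smallest stress. The result applies to either variant. *)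

theory Defs
  imports
    "HOL-Analysis.Analysis"
    "Jordan_Normal_Form.Char_Poly"
begin

text \<open>
  The Euclidean space of dimension p is the type \<open>real ^ 'p\<close> with \<open>p = CARD('p)\<close>.
  Matrices whose size depends on a number of points are those of Jordan_Normal_Form,
  with indices starting at 0; the nodes of a graph are \<open>1, \<dots>, n\<close>.
  Configurations are functions on \<open>nat\<close> of which only the values on \<open>{1..n}\<close> matter.
\<close>

subsection \<open>Graphs and configurations\<close>

definition simple_graph :: "nat \<Rightarrow> (nat \<times> nat) set \<Rightarrow> bool" where
  "simple_graph n E \<longleftrightarrow> E \<subseteq> {1..n} \<times> {1..n} \<and> sym E \<and> irrefl E"

text \<open>
  The adjacency relation \<open>E\<close> contains both orientations of an edge;
  sums over the edges run over one orientation of each.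
\<close>

definition edges :: "(nat \<times> nat) set \<Rightarrow> (nat \<times> nat) set" where
  "edges E = {(i, j) \<in> E. i < j}"

definition clique_list :: "(nat \<times> nat) set \<Rightarrow> nat list \<Rightarrow> bool" where
  "clique_list E c \<longleftrightarrow> (\<forall>i<length c. \<forall>j<length c. i \<noteq> j \<longrightarrow> (c ! i, c ! j) \<in> E)"

definition laterative_ordering :: "nat \<Rightarrow> nat \<Rightarrow> (nat \<times> nat) set \<Rightarrow> nat list \<Rightarrow> bool" where
  "laterative_ordering p n E vs \<longleftrightarrow>
     distinct vs \<and> set vs = {1..n} \<and> clique_list E (take (p + 1) vs) \<and>
     (\<forall>j. p + 1 \<le> j \<and> j < n \<longrightarrow> p + 1 \<le> card {i. i < j \<and> (vs ! j, vs ! i) \<in> E})"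

definition lateration_graph :: "nat \<Rightarrow> nat \<Rightarrow> (nat \<times> nat) set \<Rightarrow> bool" where
  "lateration_graph p n E \<longleftrightarrow>
     simple_graph n E \<and> p + 1 \<le> n \<and> (\<exists>vs. laterative_ordering p n E vs)"

definition general_position :: "nat \<Rightarrow> (nat \<Rightarrow> real ^ 'p) \<Rightarrow> bool" where
  "general_position n x \<longleftrightarrow>
     (\<forall>S\<subseteq>{1..n}. card S = CARD('p) + 1 \<longrightarrow> affine hull (x ` S) = UNIV)"

text \<open>
  The family of edge lengths, as a point of the product space \<open>nat \<times> nat \<Rightarrow> real\<close>;
  all coordinates outside \<open>edges E\<close> have the same fixed value.
\<close>

definition edge_lengths :: "(nat \<times> nat) set \<Rightarrow> (nat \<Rightarrow> real ^ 'p) \<Rightarrow> nat \<times> nat \<Rightarrow> real" where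
  "edge_lengths E x = restrict (\<lambda>(i, j). norm (x i - x j)) (edges E)"

definition rigid_transformation :: "(real ^ 'p \<Rightarrow> real ^ 'p) \<Rightarrow> bool" where
  "rigid_transformation g \<longleftrightarrow> (\<forall>a b. dist (g a) (g b) = dist a b)"

definition stress ::
  "(nat \<times> nat) set \<Rightarrow> (nat \<Rightarrow> nat \<Rightarrow> real) \<Rightarrow> (nat \<Rightarrow> real ^ 'p) \<Rightarrow> real" where
  "stress E d y = (\<Sum>(i, j)\<in>edges E. ((norm (y i - y j))\<^sup>2 - (d i j)\<^sup>2)\<^sup>2)"

subsection \<open>Classical scaling\<close>

definition centering_mat :: "nat \<Rightarrow> real mat" where
  "centering_mat m = 1\<^sub>m m - (1 / real m) \<cdot>\<^sub>m Matrix.mat m m (\<lambda>_. 1)"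

definition scaling_mat :: "nat \<Rightarrow> (nat \<Rightarrow> nat \<Rightarrow> real) \<Rightarrow> real mat" where
  "scaling_mat m d =
     (- 1 / 2) \<cdot>\<^sub>m (centering_mat m * Matrix.mat m m (\<lambda>(i, j). (d i j)\<^sup>2) * centering_mat m)"

text \<open>All eigenvalues, with algebraic multiplicity, in decreasing order.\<close>

definition eigenvalues_decreasing :: "real mat \<Rightarrow> real list \<Rightarrow> bool" where
  "eigenvalues_decreasing B es \<longleftrightarrow>
     char_poly B = (\<Prod>e\<leftarrow>es. [:- e, 1:]) \<and> sorted_wrt (\<ge>) es"

text \<open>
  A relation, since the eigenvectors are not unique. The library enumeration
  \<open>to_nat_on UNIV\<close> of the finite type \<open>'p\<close> numbers the coordinates of \<open>real ^ 'p\<close>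
  by \<open>0, \<dots>, p - 1\<close>; \<open>from_nat_into UNIV\<close> is its inverse.
\<close>

definition classical_scaling ::
  "nat \<Rightarrow> (nat \<Rightarrow> nat \<Rightarrow> real) \<Rightarrow> (nat \<Rightarrow> real ^ 'p) \<Rightarrow> bool" where
  "classical_scaling m d y \<longleftrightarrow>
     (\<exists>es u. eigenvalues_decreasing (scaling_mat m d) es \<and>
        (\<forall>k<CARD('p). eigenvector (scaling_mat m d) (u k) (es ! k)) \<and>
        (\<forall>k<CARD('p). \<forall>l<CARD('p). scalar_prod (u k) (u l) = (if k = l then 1 else 0)) \<and>
        (\<forall>i<m. y i = (\<chi> c. let k = to_nat_on (UNIV :: 'p set) c
                            in sqrt (max (es ! k) 0) * vec_index (u k) i)))"

subsection \<open>Classical lateration\<close>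

definition pseudo_inverse :: "real mat \<Rightarrow> real mat" where
  "pseudo_inverse Y =
     (THE X. X \<in> carrier_mat (dim_col Y) (dim_row Y) \<and>
        Y * X * Y = Y \<and> X * Y * X = X \<and>
        transpose_mat (Y * X) = Y * X \<and> transpose_mat (X * Y) = X * Y)"

definition classical_lateration :: "(real ^ 'p) list \<Rightarrow> real list \<Rightarrow> real ^ 'p" where
  "classical_lateration ys ds =
     (let m = length ys;
          ybar = (1 / real m) *\<^sub>R (\<Sum>i<m. ys ! i);
          Y = Matrix.mat m CARD('p)
                (\<lambda>(i, k). vec_nth (ys ! i - ybar) (from_nat_into (UNIV :: 'p set) k));
          a = Matrix.vec m (\<lambda>i. (ds ! i)\<^sup>2);
          abar = Matrix.vec m (\<lambda>i. (1 / real m) * (\<Sum>j<m. (norm (ys ! i - ys ! j))\<^sup>2));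
          w = pseudo_inverse Y *\<^sub>v (abar - a)
      in ybar + (1 / 2) *\<^sub>R (\<chi> c. vec_index w (to_nat_on (UNIV :: 'p set) c)))"

subsection \<open>Sequential lateration\<close>

text \<open>
  \<open>lateration_run n E d c S y\<close>: starting with the clique \<open>c\<close>, some sequence of steps of the
  algorithm embeds exactly the nodes in \<open>S\<close>, at the positions given by \<open>y\<close> on \<open>S\<close>.
  The node added and its landmarks are chosen arbitrarily among the admissible ones.
\<close>

inductive lateration_run ::
  "nat \<Rightarrow> (nat \<times> nat) set \<Rightarrow> (nat \<Rightarrow> nat \<Rightarrow> real) \<Rightarrow> nat list \<Rightarrow>
   nat set \<Rightarrow> (nat \<Rightarrow> real ^ 'p) \<Rightarrow> bool"
  for n E d c where
  start: "classical_scaling (length c) (\<lambda>i j. if i = j then 0 else d (c ! i) (c ! j))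
            (\<lambda>i. y (c ! i))
          \<Longrightarrow> lateration_run n E d c (set c) y"
| step: "lateration_run n E d c S y \<Longrightarrow> v \<in> {1..n} - S \<Longrightarrow>
         distinct ws \<Longrightarrow> set ws \<subseteq> {w \<in> S. (v, w) \<in> E} \<Longrightarrow> CARD('p) + 1 \<le> length ws \<Longrightarrow>
         lateration_run n E d c (insert v S)
           (y(v := classical_lateration (map y ws) (map (d v) ws)))"

definition complete_run ::
  "nat \<Rightarrow> (nat \<times> nat) set \<Rightarrow> (nat \<Rightarrow> nat \<Rightarrow> real) \<Rightarrow> nat list \<Rightarrow>
   nat set \<Rightarrow> (nat \<Rightarrow> real ^ 'p) \<Rightarrow> bool" where
  "complete_run n E d c S y \<longleftrightarrow> lateration_run n E d c S y \<and>
     (\<forall>v\<in>{1..n} - S. card {w \<in> S. (v, w) \<in> E} < CARD('p) + 1)"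

text \<open>
  The order in which the cliques with \<open>p + 1\<close> nodes are visited. Each of them must occur,
  in one or in several of its orderings.
\<close>

definition clique_enumeration :: "nat \<Rightarrow> nat \<Rightarrow> (nat \<times> nat) set \<Rightarrow> nat list list \<Rightarrow> bool" where
  "clique_enumeration p n E cs \<longleftrightarrow>
     (let C = {c. length c = p + 1 \<and> set c \<subseteq> {1..n} \<and> clique_list E c}
      in set cs \<subseteq> C \<and> (\<forall>c\<in>C. \<exists>c'\<in>set cs. set c' = set c))"

text \<open>
  An execution visits the cliques in the order \<open>cs\<close>; \<open>R c\<close> consists of the set of nodes
  finally reached from the clique \<open>c\<close> and their embedding.
\<close>

definition execution ::
  "nat \<Rightarrow> (nat \<times> nat) set \<Rightarrow> (nat \<Rightarrow> nat \<Rightarrow> real) \<Rightarrow> nat list list \<Rightarrow>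
   (nat list \<Rightarrow> nat set \<times> (nat \<Rightarrow> real ^ 'p)) \<Rightarrow> bool" where
  "execution n E d cs R \<longleftrightarrow>
     clique_enumeration CARD('p) n E cs \<and>
     (\<forall>c\<in>set cs. complete_run n E d c (fst (R c)) (snd (R c)))"

definition first_output ::
  "nat \<Rightarrow> nat list list \<Rightarrow> (nat list \<Rightarrow> nat set \<times> (nat \<Rightarrow> real ^ 'p)) \<Rightarrow>
   (nat \<Rightarrow> real ^ 'p) \<Rightarrow> bool" where
  "first_output n cs R y \<longleftrightarrow>
     (\<exists>c. find (\<lambda>c. fst (R c) = {1..n}) cs = Some c \<and> y = snd (R c))"

definition best_output ::
  "nat \<Rightarrow> (nat \<times> nat) set \<Rightarrow> (nat \<Rightarrow> nat \<Rightarrow> real) \<Rightarrow> nat list list \<Rightarrow>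
   (nat list \<Rightarrow> nat set \<times> (nat \<Rightarrow> real ^ 'p)) \<Rightarrow> (nat \<Rightarrow> real ^ 'p) \<Rightarrow> bool" where
  "best_output n E d cs R y \<longleftrightarrow>
     is_arg_min (stress E d) (\<lambda>z. z \<in> (snd \<circ> R) ` {c \<in> set cs. fst (R c) = {1..n}}) y"

datatype variant = First | Best

fun sequential_lateration_output ::
  "variant \<Rightarrow> nat \<Rightarrow> (nat \<times> nat) set \<Rightarrow> (nat \<Rightarrow> nat \<Rightarrow> real) \<Rightarrow> nat list list \<Rightarrow>
   (nat list \<Rightarrow> nat set \<times> (nat \<Rightarrow> real ^ 'p)) \<Rightarrow> (nat \<Rightarrow> real ^ 'p) \<Rightarrow> bool" where
  "sequential_lateration_output First n E d cs R y = first_output n cs R y"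
| "sequential_lateration_output Best n E d cs R y = best_output n E d cs R y"

end

theory Submission
  imports Defs
begin

text \<open>
  An execution embeds a clique of \<open>p + 1\<close> nodes by classical scaling and adds the other nodes one at a
  time by classical lateration. Each of these operations, applied near exact data, turns small errors
  into errors of the same order, and there are at most \<open>n\<close> operations. So the errors of a run stay
  bounded by a constant times the error of the data, up to a rigid transformation (\<open>run_error\<close>).

  Classical scaling of \<open>p + 1\<close> points is even exact for slightly perturbed data: the doubly centred
  matrix has the constant vector in its kernel and is positive definite on the complement, so its
  \<open>p\<close> largest eigenvalues carry all of it (\<open>classical_scaling_exact\<close>). It remains to compare two
  simplices with almost equal edge lengths. The linear map between them is almost isometric, and
  diagonalising \<open>L\<^sup>T L\<close> yields an orthogonal map nearby (\<open>simplex_procrustes\<close>).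

  The output \<open>z\<close> of classical lateration satisfies the normal equation
  \<open>\<Sum>\<^sub>i (|z - y\<^sub>i|\<^sup>2 - a\<^sub>i) (y\<^sub>i - c) = 0\<close>, where \<open>c\<close> is the centroid of the landmarks and
  \<open>a\<^sub>i\<close> are the squared dissimilarities. It is linear in \<open>z\<close>, because the landmarks are centred,
  and its matrix is the scatter matrix of the landmarks. A lower bound on the latter gives the error
  bound (\<open>classical_lateration_error\<close>).

  All constants depend only on \<open>n\<close>, \<open>p\<close>, a bound on the diameter of the configuration and a lower
  bound on the scatter matrices. These bounds are not visible in the edge lengths. However, an
  embedding with exact data recovers the configuration up to congruence, and the error estimate
  then shows that configurations with nearby edge lengths are nearly congruent. Hence the bounds, and
  with them the constants, are locally uniform in the edge lengths (\<open>stable_locally_uniform\<close>), and a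
  general argument replaces them by continuous functions
  (\<open>locally_uniform_imp_continuous_bound\<close>).

  The combinatorial part is that some clique always leads to a full embedding, namely the initial
  one of a laterative ordering; both variants therefore have an output, and every output comes from
  a run to which the estimates apply.
\<close>

section \<open>Spectral theorem for real symmetric matrices\<close>

text \<open>
  The characteristic polynomial splits over the complex numbers, and every complex root is real:
  for an eigenvector \<open>v\<close> the number \<open>v\<^sup>* A v\<close> equals its own conjugate by symmetry,
  and it is the eigenvalue times the positive number \<open>v\<^sup>* v\<close>.
\<close>

lemma symmetric_char_poly_splits:
  fixes A :: "real mat"
  assumes A: "A \<in> carrier_mat n n" and sym: "transpose_mat A = A"
  shows "\<exists>es. char_poly A = (\<Prod>e\<leftarrow>es. [:- e, 1:])"
proof -
  let ?C = "map_mat complex_of_real A"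
  have C: "?C \<in> carrier_mat n n" using A by simp
  obtain as where as: "char_poly ?C = (\<Prod>a\<leftarrow>as. [:- a, 1:])"
    using char_poly_factorized[OF C] by blast
  have symA: "A $$ (i, j) = A $$ (j, i)" if "i < n" "j < n" for i j
    using that A sym by (metis carrier_matD index_transpose_mat(1))
  have real: "a = complex_of_real (Re a)" if "a \<in> set as" for a
  proof -
    have "poly (char_poly ?C) a = 0"
      unfolding as using that by (induction as) auto
    then have "eigenvalue ?C a" using eigenvalue_root_char_poly[OF C] by blast
    then obtain v where v: "v \<in> carrier_vec n" "v \<noteq> 0\<^sub>v n" and ev: "?C *\<^sub>v v = a \<cdot>\<^sub>v v"
      using C unfolding eigenvalue_def eigenvector_def by auto
    have row: "(\<Sum>j<n. complex_of_real (A $$ (i, j)) * vec_index v j) = a * vec_index v i" if "i < n" for i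
    proof -
      have "vec_index (?C *\<^sub>v v) i = a * vec_index v i" using ev v that by simp
      then show ?thesis using that v A by (simp add: scalar_prod_def atLeast0LessThan)
    qed
    let ?N = "\<Sum>i<n. cnj (vec_index v i) * vec_index v i"
    let ?q = "\<Sum>i<n. \<Sum>j<n. cnj (vec_index v i) * (complex_of_real (A $$ (i, j)) * vec_index v j)"
    have q: "?q = a * ?N"
    proof -
      have "?q = (\<Sum>i<n. cnj (vec_index v i) * (a * vec_index v i))"
        unfolding sum_distrib_left[symmetric] by (intro sum.cong refl) (simp only: row lessThan_iff)
      then show ?thesis by (simp add: sum_distrib_left mult_ac)
    qed
    have "cnj ?q = (\<Sum>i<n. \<Sum>j<n. vec_index v i * (complex_of_real (A $$ (i, j)) * cnj (vec_index v j)))"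
      by (simp add: cnj_sum)
    also have "\<dots> = (\<Sum>j<n. \<Sum>i<n. vec_index v i * (complex_of_real (A $$ (i, j)) * cnj (vec_index v j)))"
      by (rule sum.swap)
    also have "\<dots> = ?q"
      by (intro sum.cong refl) (simp add: symA mult_ac)
    finally have "cnj ?q = ?q" .
    moreover have N: "?N = complex_of_real (\<Sum>i<n. (cmod (vec_index v i))\<^sup>2)"
      unfolding of_real_sum complex_norm_square by (simp add: mult.commute)
    ultimately have "cnj a * ?N = a * ?N" unfolding q by (simp add: N)
    moreover have "?N \<noteq> 0"
    proof
      assume "?N = 0"
      then have "(\<Sum>i<n. (cmod (vec_index v i))\<^sup>2) = 0" unfolding N by (simp only: of_real_eq_0_iff)
      then have "vec_index v i = 0" if "i < n" for i
        using that by (subst (asm) sum_nonneg_eq_0_iff) auto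
      then have "v = 0\<^sub>v n" using v by (intro eq_vecI) auto
      with v show False by simp
    qed
    ultimately have "cnj a = a" by simp
    then show ?thesis by (simp add: complex_eq_iff)
  qed
  interpret h: map_poly_inj_idom_hom complex_of_real ..
  have "map_poly complex_of_real (char_poly A) = (\<Prod>a\<leftarrow>as. [:- a, 1:])"
    unfolding as[symmetric] by (rule of_real_hom.char_poly_hom[OF A, symmetric])
  also have "\<dots> = map_poly complex_of_real (\<Prod>e\<leftarrow>map Re as. [:- e, 1:])"
    using real
  proof (induction as)
    case (Cons a as)
    have "[:- a, 1:] = map_poly complex_of_real [:- Re a, 1:]"
      using Cons.prems[of a] by (simp add: map_poly_pCons)
    with Cons show ?case by (simp add: hom_distribs)
  qed simp
  finally show ?thesis by (blast dest: h.injectivity)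
qed

text \<open>
  The Householder reflection \<open>1 - c w w\<^sup>T\<close> along \<open>w = e - v\<close>, where \<open>e\<close> is the first
  basis vector, exchanges \<open>e\<close> and \<open>v\<close>; it conjugates a matrix with eigenvector \<open>v\<close> into
  block form. The convention \<open>2 / 0 = 0\<close> turns it into the identity when \<open>v = e\<close>.
\<close>

lemma householder:
  fixes v :: "real vec"
  assumes v: "v \<in> carrier_vec n" and unit: "scalar_prod v v = 1" and n: "0 < n"
  obtains H where "H \<in> carrier_mat n n" "transpose_mat H = H" "H * H = 1\<^sub>m n"
    "H *\<^sub>v unit_vec n 0 = v"
proof -
  define w where "w i = (if i = 0 then 1 else 0) - vec_index v i" for i
  define c where "c = 2 / (\<Sum>i<n. w i * w i)"
  define H where "H = Matrix.mat n n (\<lambda>(i, j). (if i = j then 1 else 0) - c * (w i * w j))"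
  have vv: "(\<Sum>i<n. vec_index v i * vec_index v i) = 1"
    using unit v by (simp add: scalar_prod_def atLeast0LessThan)
  have "(\<Sum>i<n. w i * w i) = (\<Sum>i<n. (if i = 0 then 1 - 2 * vec_index v i else 0)
       + vec_index v i * vec_index v i)"
    by (intro sum.cong) (auto simp: w_def algebra_simps)
  also have "\<dots> = 2 * w 0" using n vv by (simp add: sum.distrib w_def)
  finally have ww: "(\<Sum>i<n. w i * w i) = 2 * w 0" .
  have w0: "w i = 0" if "w 0 = 0" "i < n" for i
    using ww that by (auto simp: sum_nonneg_eq_0_iff)
  have cc: "c * c * (\<Sum>i<n. w i * w i) = 2 * c" by (simp add: c_def)
  have "H \<in> carrier_mat n n" by (simp add: H_def)
  moreover have "transpose_mat H = H" by (rule eq_matI) (auto simp: H_def mult.commute)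
  moreover have "H * H = 1\<^sub>m n"
  proof (rule eq_matI; simp add: H_def)
    fix i j assume ij: "i < n" "j < n"
    have "(\<Sum>k<n. ((if i = k then 1 else 0) - c * (w i * w k)) * ((if k = j then 1 else 0) - c * (w k * w j)))
       = (\<Sum>k<n. (if k = i then (if i = j then 1 else 0) - c * (w i * w j) else 0)
            - (if k = j then c * (w i * w j) else 0) + c * c * (w i * w j) * (w k * w k))"
      by (intro sum.cong) (auto simp: algebra_simps)
    also have "\<dots> = (if i = j then 1 else 0) - 2 * c * (w i * w j) + (c * c * (\<Sum>k<n. w k * w k)) * (w i * w j)"
      using ij by (simp add: sum.distrib sum_subtractf sum_distrib_left sum_distrib_right mult_ac)
    also have "\<dots> = (if i = j then 1 else 0)" unfolding cc by simp
    finally show "(i = j \<longrightarrow> Matrix.vec n (\<lambda>ja. (if j = ja then 1 else 0) - c * (w j * w ja)) \<bullet>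
                   Matrix.vec n (\<lambda>i. (if i = j then 1 else 0) - c * (w i * w j)) = 1) \<and>
         (i \<noteq> j \<longrightarrow> Matrix.vec n (\<lambda>j. (if i = j then 1 else 0) - c * (w i * w j)) \<bullet>
                   Matrix.vec n (\<lambda>i. (if i = j then 1 else 0) - c * (w i * w j)) = 0)"
      using ij by (auto simp: scalar_prod_def atLeast0LessThan split: if_splits)
  qed
  moreover have "H *\<^sub>v unit_vec n 0 = v"
  proof (rule eq_vecI)
    fix i assume "i < dim_vec v"
    then have i: "i < n" using v by simp
    have "vec_index (H *\<^sub>v unit_vec n 0) i = (if i = 0 then 1 else 0) - c * (w i * w 0)"
      using i n by (simp add: H_def)
    also have "\<dots> = vec_index v i"
      using w0[of i] i by (cases "w 0 = 0") (simp_all add: c_def ww, simp_all add: w_def split: if_splits)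
    finally show "vec_index (H *\<^sub>v unit_vec n 0) i = vec_index v i" .
  qed (use v in \<open>simp add: H_def\<close>)
  ultimately show ?thesis by (rule that)
qed

definition diagonal_matrix :: "real list \<Rightarrow> real mat" where
  "diagonal_matrix es = Matrix.mat (length es) (length es) (\<lambda>(i, j). if i = j then es ! i else 0)"

lemma real_eigenvector_unit:
  fixes A :: "real mat"
  assumes A: "A \<in> carrier_mat n n" and "eigenvalue A e"
  obtains v where "v \<in> carrier_vec n" "scalar_prod v v = 1" "A *\<^sub>v v = e \<cdot>\<^sub>v v"
proof -
  obtain v where v: "v \<in> carrier_vec n" "v \<noteq> 0\<^sub>v n" and ev: "A *\<^sub>v v = e \<cdot>\<^sub>v v"
    using assms unfolding eigenvalue_def eigenvector_def by auto
  have pos: "scalar_prod v v > 0"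
  proof -
    have "scalar_prod v v = (\<Sum>i<n. (vec_index v i)\<^sup>2)"
      using v by (simp add: scalar_prod_def atLeast0LessThan power2_eq_square)
    moreover have "(\<Sum>i<n. (vec_index v i)\<^sup>2) \<noteq> 0"
    proof
      assume "(\<Sum>i<n. (vec_index v i)\<^sup>2) = 0"
      then have "v = 0\<^sub>v n" using v by (intro eq_vecI) (auto simp: sum_nonneg_eq_0_iff)
      with v show False by simp
    qed
    ultimately show ?thesis by (simp add: sum_nonneg less_le)
  qed
  let ?s = "1 / sqrt (scalar_prod v v)"
  show ?thesis
  proof (rule that[of "?s \<cdot>\<^sub>v v"])
    show "?s \<cdot>\<^sub>v v \<in> carrier_vec n" using v by simp
    show "scalar_prod (?s \<cdot>\<^sub>v v) (?s \<cdot>\<^sub>v v) = 1"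
      using v pos by simp
    show "A *\<^sub>v (?s \<cdot>\<^sub>v v) = e \<cdot>\<^sub>v (?s \<cdot>\<^sub>v v)"
      using v A ev by (simp add: mult_mat_vec smult_smult_assoc mult.commute)
  qed
qed

text \<open>
  The list \<open>es\<close> prescribes the order of the eigenvalues, with multiplicities. The induction
  splits off its head: conjugation by a Householder reflection makes the first column, and by
  symmetry the first row, vanish off the diagonal, and the remaining block is symmetric with the
  tail of \<open>es\<close> as its eigenvalues.
\<close>

proposition symmetric_diagonalization:
  fixes A :: "real mat"
  assumes A: "A \<in> carrier_mat n n" and sym: "transpose_mat A = A"
    and es: "char_poly A = (\<Prod>e\<leftarrow>es. [:- e, 1:])"
  shows "length es = n \<and> (\<exists>U \<in> carrier_mat n n. transpose_mat U * U = 1\<^sub>m n \<and> A * U = U * diagonal_matrix es)"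
  using assms
proof (induction es arbitrary: n A)
  case Nil
  then have "degree (char_poly A) = 0" by simp
  then have "n = 0" using degree_monic_char_poly[OF Nil.prems(1)] by simp
  then show ?case using Nil.prems by (auto simp: diagonal_matrix_def intro!: bexI[of _ "1\<^sub>m 0"])
next
  case (Cons e es)
  note A = Cons.prems(1)
  have n: "n = Suc (length es)"
    using degree_monic_char_poly[OF A] degree_linear_factors[of uminus "e # es"] Cons.prems(3) by simp
  define m where "m = length es"
  have nm: "n = Suc m" by (simp add: n m_def)
  have "eigenvalue A e" unfolding eigenvalue_root_char_poly[OF A] Cons.prems(3) by simp
  then obtain v where v: "v \<in> carrier_vec n" "scalar_prod v v = 1" "A *\<^sub>v v = e \<cdot>\<^sub>v v"
    using real_eigenvector_unit[OF A] by blast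
  obtain H where H: "H \<in> carrier_mat n n" "transpose_mat H = H" "H * H = 1\<^sub>m n"
    "H *\<^sub>v unit_vec n 0 = v"
    using householder[OF v(1,2)] nm by blast
  define B where "B = H * A * H"
  have B: "B \<in> carrier_mat n n" using A H by (simp add: B_def)
  have symB: "transpose_mat B = B"
  proof -
    have "transpose_mat B = transpose_mat H * transpose_mat (H * A)"
      unfolding B_def by (rule transpose_mult[of _ n n _ n]) (use A H in auto)
    also have "transpose_mat (H * A) = transpose_mat A * transpose_mat H"
      by (rule transpose_mult[of _ n n _ n]) (use A H in auto)
    finally show ?thesis
      using A H Cons.prems(2) by (simp add: B_def assoc_mult_mat[of _ n n _ n _ n])
  qed
  have HB: "A * H = H * B"
  proof -
    have "H * B = H * (H * (A * H))" using A H(1) by (simp add: B_def assoc_mult_mat[of _ n n _ n _ n])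
    also have "\<dots> = (H * H) * (A * H)"
      by (rule assoc_mult_mat[symmetric, of _ n n _ n _ n]) (use A H(1) in auto)
    also have "\<dots> = A * H" unfolding H(3) using A H(1) by simp
    finally show ?thesis by simp
  qed
  have Hv: "H *\<^sub>v v = unit_vec n 0"
  proof -
    have "H *\<^sub>v (H *\<^sub>v unit_vec n 0) = (H * H) *\<^sub>v unit_vec n 0"
      by (rule assoc_mult_mat_vec[symmetric, of _ n n _ n]) (use H(1) in auto)
    then show ?thesis unfolding H(3,4) by simp
  qed
  have Bcol: "B *\<^sub>v unit_vec n 0 = e \<cdot>\<^sub>v unit_vec n 0"
  proof -
    have "B *\<^sub>v unit_vec n 0 = H *\<^sub>v (A *\<^sub>v (H *\<^sub>v unit_vec n 0))"
      using A H unfolding B_def by (simp add: assoc_mult_mat_vec[of _ n n _ n])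
    also have "\<dots> = e \<cdot>\<^sub>v unit_vec n 0" using H v Hv by (simp add: mult_mat_vec[of _ n n])
    finally show ?thesis .
  qed
  have Bi0: "B $$ (i, 0) = (if i = 0 then e else 0)" if "i < n" for i
  proof -
    have "vec_index (B *\<^sub>v unit_vec n 0) i = B $$ (i, 0)"
      using that B nm by simp
    then show ?thesis using Bcol that nm by (auto split: if_splits)
  qed
  have B0j: "B $$ (0, j) = (if j = 0 then e else 0)" if "j < n" for j
    using Bi0[OF that] symB B that nm by (metis carrier_matD index_transpose_mat(1) zero_less_Suc)
  define A3 where "A3 = Matrix.mat m m (\<lambda>(i, j). B $$ (Suc i, Suc j))"
  have A3: "A3 \<in> carrier_mat m m" by (simp add: A3_def)
  have symA3: "transpose_mat A3 = A3"
  proof (rule eq_matI)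
    fix i j assume "i < dim_row A3" "j < dim_col A3"
    then have ij: "i < m" "j < m" using A3 by auto
    have "B $$ (Suc j, Suc i) = B $$ (Suc i, Suc j)"
      using ij nm B symB by (metis Suc_less_eq carrier_matD index_transpose_mat(1))
    then show "transpose_mat A3 $$ (i, j) = A3 $$ (i, j)" using ij by (simp add: A3_def)
  qed (auto simp: A3_def)
  let ?A1 = "Matrix.mat 1 1 (\<lambda>_. e)"
  have Bblock: "B = four_block_mat ?A1 (0\<^sub>m 1 m) (0\<^sub>m m 1) A3"
  proof (rule eq_matI)
    fix i j assume "i < dim_row (four_block_mat ?A1 (0\<^sub>m 1 m) (0\<^sub>m m 1) A3)"
      "j < dim_col (four_block_mat ?A1 (0\<^sub>m 1 m) (0\<^sub>m m 1) A3)"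
    then have "i < n" "j < n" using A3 nm by auto
    then show "B $$ (i, j) = four_block_mat ?A1 (0\<^sub>m 1 m) (0\<^sub>m m 1) A3 $$ (i, j)"
      using A3 nm Bi0[of i] B0j[of j] by (cases i; cases j) (auto simp: A3_def)
  qed (use A3 B nm in auto)
  have "similar_mat A B"
    unfolding similar_mat_def similar_mat_wit_def Let_def
    by (intro exI[of _ H]) (use A B H HB in \<open>auto simp: HB[symmetric] assoc_mult_mat[of _ n n _ n _ n]\<close>)
  then have "char_poly A = char_poly B" by (rule char_poly_similar)
  also have "\<dots> = char_poly ?A1 * char_poly A3"
    unfolding Bblock by (rule char_poly_four_block_zeros_col[OF _ _ A3]) auto
  also have "char_poly ?A1 = [:- e, 1:]"
    by (simp add: char_poly_defs det_def)
  finally have "char_poly A3 = (\<Prod>e\<leftarrow>es. [:- e, 1:])"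
    using Cons.prems(3) by (simp del: mult_pCons_left)
  from Cons.IH[OF A3 symA3 this] obtain U3 where U3: "U3 \<in> carrier_mat m m"
    "transpose_mat U3 * U3 = 1\<^sub>m m" "A3 * U3 = U3 * diagonal_matrix es" by blast
  let ?D = "diagonal_matrix es"
  have D: "?D \<in> carrier_mat m m" by (simp add: diagonal_matrix_def m_def)
  define P where "P = four_block_mat (1\<^sub>m 1) (0\<^sub>m 1 m) (0\<^sub>m m 1) U3"
  have P: "P \<in> carrier_mat n n" using U3 nm by (auto simp: P_def)
  have PT: "transpose_mat P = four_block_mat (1\<^sub>m 1) (0\<^sub>m 1 m) (0\<^sub>m m 1) (transpose_mat U3)"
    unfolding P_def by (subst transpose_four_block_mat[of _ 1 1 _ m _ m]) (use U3 in auto)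
  have PTP: "transpose_mat P * P = 1\<^sub>m n"
    unfolding PT unfolding P_def
    by (subst mult_four_block_mat[of _ 1 1 _ m _ m _ _ 1 _ m])
       (use U3 nm in \<open>auto simp: U3(2) intro!: eq_matI\<close>)
  have dl: "diagonal_matrix (e # es) = four_block_mat ?A1 (0\<^sub>m 1 m) (0\<^sub>m m 1) ?D"
    by (rule eq_matI) (auto simp: diagonal_matrix_def m_def nth_Cons split: nat.splits)
  have BP: "B * P = P * diagonal_matrix (e # es)"
    unfolding Bblock P_def dl
    by (subst (1 2) mult_four_block_mat[of _ 1 1 _ m _ m _ _ 1 _ m])
       (use U3 A3 D in \<open>auto simp: U3(3)\<close>)
  let ?U = "H * P"
  have D2: "diagonal_matrix (e # es) \<in> carrier_mat n n" using nm by (simp add: diagonal_matrix_def m_def)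
  have "transpose_mat ?U = transpose_mat P * transpose_mat H"
    by (rule transpose_mult[of _ n n _ n]) (use H P in auto)
  then have "transpose_mat ?U * ?U = transpose_mat P * (H * (H * P))"
    unfolding H(2) using H(1) P by (simp add: assoc_mult_mat[of _ n n _ n _ n])
  also have "H * (H * P) = (H * H) * P"
    by (rule assoc_mult_mat[symmetric, of _ n n _ n _ n]) (use H(1) P in auto)
  also have "transpose_mat P * ((H * H) * P) = 1\<^sub>m n" unfolding H(3) using P PTP by simp
  finally have "transpose_mat ?U * ?U = 1\<^sub>m n" .
  moreover have "A * ?U = ?U * diagonal_matrix (e # es)"
  proof -
    have "A * ?U = (A * H) * P" using A H P by (simp add: assoc_mult_mat[of _ n n _ n _ n])
    also have "\<dots> = H * (B * P)" unfolding HB using B H P by (simp add: assoc_mult_mat[of _ n n _ n _ n])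
    also have "\<dots> = ?U * diagonal_matrix (e # es)"
      unfolding BP using H P D2 by (simp add: assoc_mult_mat[of _ n n _ n _ n])
    finally show ?thesis .
  qed
  moreover have "?U \<in> carrier_mat n n" using H P by simp
  ultimately show ?case using n by auto
qed

corollary symmetric_orthonormal_eigenvectors:
  fixes A :: "real mat"
  assumes A: "A \<in> carrier_mat n n" and sym: "transpose_mat A = A"
    and es: "char_poly A = (\<Prod>e\<leftarrow>es. [:- e, 1:])"
  shows "length es = n" and
    "\<exists>u. (\<forall>k<n. eigenvector A (u k) (es ! k)) \<and>
         (\<forall>k<n. \<forall>l<n. scalar_prod (u k) (u l) = (if k = l then 1 else 0))"
proof -
  from symmetric_diagonalization[OF assms] obtain U where len: "length es = n"
    and U: "U \<in> carrier_mat n n" "transpose_mat U * U = 1\<^sub>m n" "A * U = U * diagonal_matrix es" by blast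
  show "length es = n" by fact
  have orth: "scalar_prod (col U k) (col U l) = (if k = l then 1 else 0)" if "k < n" "l < n" for k l
  proof -
    have "(transpose_mat U * U) $$ (k, l) = scalar_prod (col U k) (col U l)"
      using U(1) that by simp
    then show ?thesis unfolding U(2) using that by simp
  qed
  have "eigenvector A (col U k) (es ! k)" if k: "k < n" for k
    unfolding eigenvector_def
  proof (intro conjI)
    show "col U k \<in> carrier_vec (dim_row A)" using col_dim[of U k] U A by simp
    show "col U k \<noteq> 0\<^sub>v (dim_row A)"
    proof
      assume "col U k = 0\<^sub>v (dim_row A)"
      then have "scalar_prod (col U k) (col U k) = 0" by simp
      then show False using orth[OF k k] by simp
    qed
    have "A *\<^sub>v col U k = col (A * U) k" using U(1) A k by (intro eq_vecI) auto
    also have "\<dots> = es ! k \<cdot>\<^sub>v col U k"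
    proof (rule eq_vecI)
      fix i assume "i < dim_vec (es ! k \<cdot>\<^sub>v col U k)"
      then have i: "i < n" using U by simp
      have "vec_index (col (A * U) k) i = (\<Sum>j<n. U $$ (i, j) * (if j = k then es ! j else 0))"
        unfolding U(3) using U i k len by (simp add: diagonal_matrix_def scalar_prod_def atLeast0LessThan)
      also have "\<dots> = es ! k * U $$ (i, k)" using k by (simp add: if_distrib cong: if_cong)
      finally show "vec_index (col (A * U) k) i = vec_index (es ! k \<cdot>\<^sub>v col U k) i"
        using i k U by simp
    qed (use A U in auto)
    finally show "A *\<^sub>v col U k = es ! k \<cdot>\<^sub>v col U k" .
  qed
  with orth show "\<exists>u. (\<forall>k<n. eigenvector A (u k) (es ! k)) \<and>
         (\<forall>k<n. \<forall>l<n. scalar_prod (u k) (u l) = (if k = l then 1 else 0))" by blast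
qed

section \<open>Spread of a configuration about its centroid\<close>

definition centroid :: "'i set \<Rightarrow> ('i \<Rightarrow> 'a::real_vector) \<Rightarrow> 'a" where
  "centroid W x = (1 / real (card W)) *\<^sub>R (\<Sum>i\<in>W. x i)"

text \<open>
  A quantitative form of affine spanning: the scatter matrix
  \<open>\<Sum>\<^sub>i (x\<^sub>i - c) (x\<^sub>i - c)\<^sup>T\<close> about the centroid \<open>c\<close> is bounded below by \<open>k\<close>.
  Working with this bound instead of general position makes all later constants explicit in \<open>k\<close>.
\<close>

definition well_spread :: "real \<Rightarrow> 'i set \<Rightarrow> ('i \<Rightarrow> 'a::real_inner) \<Rightarrow> bool" where
  "well_spread k W x \<longleftrightarrow> (\<forall>z. k * (norm z)\<^sup>2 \<le> (\<Sum>i\<in>W. (inner (x i - centroid W x) z)\<^sup>2))"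

lemma sum_diff_centroid:
  assumes "finite W" "W \<noteq> {}"
  shows "(\<Sum>i\<in>W. x i - centroid W x) = 0"
  using assms by (simp add: sum_subtractf centroid_def sum_constant_scaleR)

lemma centroid_close:
  fixes x y :: "'i \<Rightarrow> 'a::real_normed_vector"
  assumes W: "finite W" "W \<noteq> {}" and close: "\<And>i. i \<in> W \<Longrightarrow> norm (y i - x i) \<le> \<delta>"
  shows "norm (centroid W y - centroid W x) \<le> \<delta>"
proof -
  have c: "real (card W) > 0" using W by (simp add: card_gt_0_iff)
  have "centroid W y - centroid W x = (1 / real (card W)) *\<^sub>R (\<Sum>i\<in>W. y i - x i)"
    by (simp add: centroid_def sum_subtractf scaleR_diff_right)
  also have "norm \<dots> \<le> (1 / real (card W)) * (real (card W) * \<delta>)"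
    using sum_norm_bound[of W "\<lambda>i. y i - x i" \<delta>] close c by (simp add: divide_simps mult.commute)
  finally show ?thesis using c by simp
qed

lemma norm_diff_centroid_le:
  fixes x :: "'i \<Rightarrow> 'a::real_normed_vector"
  assumes W: "finite W" "W \<noteq> {}" and D: "\<And>j. j \<in> W \<Longrightarrow> norm (q - x j) \<le> D"
  shows "norm (q - centroid W x) \<le> D"
proof -
  have "real (card W) \<noteq> 0" using W by simp
  then have "centroid W (\<lambda>_. q) = q" by (simp add: centroid_def sum_constant_scaleR)
  with centroid_close[OF W, of "\<lambda>_. q" x D] D show ?thesis by simp
qed

text \<open>
  The quadratic form of the scatter matrix cannot vanish at a direction \<open>z\<close>, since all points would
  lie in a hyperplane orthogonal to \<open>z\<close>; its minimum over the unit sphere is the constant.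
\<close>

lemma affinely_spanning_well_spread:
  fixes x :: "'i \<Rightarrow> 'a::euclidean_space"
  assumes W: "finite W" and span: "affine hull (x ` W) = UNIV"
  shows "\<exists>k>0. well_spread k W x"
proof -
  define f where "f z = (\<Sum>i\<in>W. (inner (x i - centroid W x) z)\<^sup>2)" for z
  have pos: "f z > 0" if "z \<noteq> 0" for z
  proof (rule ccontr)
    assume "\<not> f z > 0"
    then have "f z = 0" using sum_nonneg[of W "\<lambda>i. (inner (x i - centroid W x) z)\<^sup>2"]
      by (simp add: f_def)
    then have "inner (x i - centroid W x) z = 0" if "i \<in> W" for i
      using W that by (simp add: f_def sum_nonneg_eq_0_iff)
    then have "x ` W \<subseteq> {q. inner z q = inner z (centroid W x)}"
      by (auto simp: inner_diff_right inner_commute[of _ z])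
    then have "affine hull (x ` W) \<subseteq> {q. inner z q = inner z (centroid W x)}"
      by (rule hull_minimal) (rule affine_hyperplane)
    then have "inner z (centroid W x + z) = inner z (centroid W x)" using span by blast
    then show False using that by (simp add: inner_add_right)
  qed
  have cont: "continuous_on (sphere 0 1) f" unfolding f_def by (intro continuous_intros)
  have ne: "sphere 0 1 \<noteq> ({} :: 'a set)" by simp
  obtain z0 where z0: "z0 \<in> sphere 0 1" "\<And>z. z \<in> sphere 0 1 \<Longrightarrow> f z0 \<le> f z"
    using continuous_attains_inf[OF compact_sphere ne cont] by blast
  have "f z0 * (norm z)\<^sup>2 \<le> f z" for z
  proof (cases "z = 0")
    case False
    let ?u = "(1 / norm z) *\<^sub>R z"
    have "f z0 \<le> f ?u" using False by (intro z0(2)) simp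
    also have "f ?u = f z / (norm z)\<^sup>2"
      by (simp add: f_def power_divide sum_divide_distrib)
    finally show ?thesis using False by (simp add: field_simps)
  qed (simp add: f_def)
  moreover have "f z0 > 0" using z0(1) by (intro pos) auto
  ultimately show ?thesis unfolding well_spread_def f_def by blast
qed

lemma well_spread_mono: "well_spread k W x \<Longrightarrow> k' \<le> k \<Longrightarrow> well_spread k' W x"
  unfolding well_spread_def by (meson mult_right_mono order_trans zero_le_power2)

lemma well_spread_perturb:
  assumes W: "finite W" "W \<noteq> {}" and x: "well_spread k W x"
    and close: "\<And>i. i \<in> W \<Longrightarrow> norm (y i - x i) \<le> \<delta>"
    and small: "16 * real (card W) * \<delta>\<^sup>2 \<le> k"
  shows "well_spread (k / 4) W y"
  unfolding well_spread_def
proof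
  fix z
  let ?a = "\<lambda>i. inner (x i - centroid W x) z" and ?b = "\<lambda>i. inner (y i - centroid W y) z"
  have each: "(?a i)\<^sup>2 / 2 - 4 * \<delta>\<^sup>2 * (norm z)\<^sup>2 \<le> (?b i)\<^sup>2" if "i \<in> W" for i
  proof -
    have "norm ((y i - x i) - (centroid W y - centroid W x)) \<le> \<delta> + \<delta>"
      using norm_triangle_ineq4[of "y i - x i" "centroid W y - centroid W x"]
        close[OF that] centroid_close[of W y x \<delta>, OF W close] by linarith
    then have d: "norm ((y i - centroid W y) - (x i - centroid W x)) \<le> 2 * \<delta>"
      by (simp add: algebra_simps)
    have "\<bar>?b i - ?a i\<bar> \<le> 2 * \<delta> * norm z"
      using Cauchy_Schwarz_ineq2[of "(y i - centroid W y) - (x i - centroid W x)" z] d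
        mult_right_mono[OF d norm_ge_zero[of z]]
      by (simp add: inner_diff_left)
    then have "(?b i - ?a i)\<^sup>2 \<le> (2 * \<delta> * norm z)\<^sup>2"
      using power_mono[of "\<bar>?b i - ?a i\<bar>" "2 * \<delta> * norm z" 2] by simp
    moreover have "a\<^sup>2 / 2 \<le> b\<^sup>2 + (b - a)\<^sup>2" for a b :: real
      using zero_le_power2[of "2 * b - a"] by (simp add: power2_eq_square field_simps)
    then have "(?a i)\<^sup>2 / 2 \<le> (?b i)\<^sup>2 + (?b i - ?a i)\<^sup>2" .
    ultimately show ?thesis by (simp add: power_mult_distrib)
  qed
  have "k / 4 * (norm z)\<^sup>2 \<le> k / 2 * (norm z)\<^sup>2 - 4 * real (card W) * \<delta>\<^sup>2 * (norm z)\<^sup>2"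
    using mult_right_mono[OF small, of "(norm z)\<^sup>2"] by simp
  also have "\<dots> \<le> (\<Sum>i\<in>W. (?a i)\<^sup>2) / 2 - 4 * real (card W) * \<delta>\<^sup>2 * (norm z)\<^sup>2"
    using x by (simp add: well_spread_def)
  also have "\<dots> = (\<Sum>i\<in>W. (?a i)\<^sup>2 / 2 - 4 * \<delta>\<^sup>2 * (norm z)\<^sup>2)"
    by (simp add: sum_subtractf sum_divide_distrib)
  also have "\<dots> \<le> (\<Sum>i\<in>W. (?b i)\<^sup>2)" by (intro sum_mono each)
  finally show "k / 4 * (norm z)\<^sup>2 \<le> (\<Sum>i\<in>W. (?b i)\<^sup>2)" .
qed

text \<open>
  The scatter matrix \<open>M\<close> is invertible, and \<open>t\<^sub>i(z) = (x\<^sub>i - c) \<bullet> M\<^sup>-\<^sup>1 z\<close> are coefficients with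
  sum zero that represent \<open>z\<close>. Their sum of squares is \<open>z \<bullet> M\<^sup>-\<^sup>1 z\<close>, hence at most
  \<open>|z|\<^sup>2 / k\<close>.
\<close>

lemma barycentric_functionals:
  fixes x :: "'i \<Rightarrow> 'a::euclidean_space"
  assumes W: "finite W" "W \<noteq> {}" and x: "well_spread k W x" and k: "k > 0"
  obtains t where "\<And>i. linear (t i)" "\<And>z. (\<Sum>i\<in>W. t i z) = 0"
    "\<And>z. (\<Sum>i\<in>W. t i z *\<^sub>R x i) = z" "\<And>z. k * (\<Sum>i\<in>W. (t i z)\<^sup>2) \<le> (norm z)\<^sup>2"
proof -
  define c where "c = centroid W x"
  define M where "M w = (\<Sum>i\<in>W. inner (x i - c) w *\<^sub>R (x i - c))" for w
  have linM: "linear M"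
    unfolding M_def by (intro linear_compose_sum ballI linearI) (simp_all add: inner_add_right scaleR_add_left)
  have wM: "inner w (M w) = (\<Sum>i\<in>W. (inner (x i - c) w)\<^sup>2)" for w
    by (simp add: M_def inner_sum_right power2_eq_square inner_commute)
  have coer: "k * (norm w)\<^sup>2 \<le> inner w (M w)" for w
    using x unfolding wM well_spread_def c_def by blast
  have "inj M"
    unfolding linear_injective_0[OF linM]
  proof (intro allI impI)
    fix w assume "M w = 0"
    with coer[of w] have "k * (norm w)\<^sup>2 \<le> 0" by simp
    with k show "w = 0" by (simp add: mult_le_0_iff)
  qed
  then have "surj M" using linM by (simp add: linear_injective_imp_surjective)
  then obtain N where N: "linear N" "M \<circ> N = id"
    using linear_surjective_right_inverse[OF linM] by blast
  have MN: "M (N z) = z" for z using N(2) by (metis comp_apply id_apply)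
  define t where "t i z = inner (x i - c) (N z)" for i z
  have "linear (t i)" for i
    unfolding t_def by (rule linear_compose[OF N(1), unfolded o_def])
      (simp add: bounded_linear.linear bounded_linear_inner_right)
  moreover have t0: "(\<Sum>i\<in>W. t i z) = 0" for z
    unfolding t_def inner_sum_left[symmetric] c_def sum_diff_centroid[OF W] by simp
  moreover have "(\<Sum>i\<in>W. t i z *\<^sub>R x i) = z" for z
  proof -
    have "(\<Sum>i\<in>W. t i z *\<^sub>R x i) = M (N z) + (\<Sum>i\<in>W. t i z) *\<^sub>R c"
      by (simp add: M_def t_def scaleR_diff_right sum_subtractf scaleR_sum_left)
    then show ?thesis using t0 MN by simp
  qed
  moreover have "k * (\<Sum>i\<in>W. (t i z)\<^sup>2) \<le> (norm z)\<^sup>2" for z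
  proof -
    let ?w = "N z"
    have s: "(\<Sum>i\<in>W. (t i z)\<^sup>2) = inner ?w z" using wM[of ?w] by (simp add: t_def MN)
    have cs: "inner ?w z \<le> norm ?w * norm z" by (rule norm_cauchy_schwarz)
    have "k * norm ?w * norm ?w \<le> norm z * norm ?w"
      using coer[of ?w] cs by (simp add: MN power2_eq_square mult.commute mult.left_commute)
    then have kw: "k * norm ?w \<le> norm z"
      by (cases "?w = 0") simp_all
    have "k * inner ?w z \<le> k * (norm ?w * norm z)" using cs k by simp
    also have "\<dots> \<le> norm z * norm z" using mult_right_mono[OF kw norm_ge_zero[of z]] by simp
    finally show ?thesis unfolding s by (simp add: power2_eq_square)
  qed
  ultimately show ?thesis by (rule that)
qed

text \<open>
  As many points as the dimension plus one span the space only if they are affinely independent.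
\<close>

lemma simplex_affine_coefficients_unique:
  fixes x :: "'i \<Rightarrow> 'a::euclidean_space"
  assumes W: "finite W" "card W = DIM('a) + 1" and span: "affine hull (x ` W) = UNIV"
    and v: "(\<Sum>i\<in>W. v i) = 0" "(\<Sum>i\<in>W. v i *\<^sub>R x i) = 0" and i: "i \<in> W"
  shows "v i = (0::real)"
proof -
  have "aff_dim (x ` W) = int DIM('a)" using span aff_dim_affine_hull[of "x ` W"] by simp
  moreover have "aff_dim (x ` W) \<le> int (card (x ` W)) - 1" using W aff_dim_le_card[of "x ` W"] by simp
  moreover have "card (x ` W) \<le> card W" using card_image_le[OF W(1)] .
  ultimately have card: "card (x ` W) = card W" "aff_dim (x ` W) = int (card (x ` W)) - 1" using W by auto
  then have inj: "inj_on x W" using W by (simp add: eq_card_imp_inj_on)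
  have indep: "\<not> affine_dependent (x ` W)" using card W by (simp add: affine_independent_iff_card)
  let ?u = "\<lambda>q. v (the_inv_into W x q)"
  have "sum ?u (x ` W) = 0" "(\<Sum>q\<in>x ` W. ?u q *\<^sub>R q) = 0"
    using v inj by (simp_all add: sum.reindex the_inv_into_f_f)
  then have "?u (x i) = 0"
    using indep W i unfolding affine_dependent_explicit_finite[OF finite_imageI[OF W(1)]] by blast
  then show ?thesis using inj i by (simp add: the_inv_into_f_f)
qed

text \<open>
  For a simplex the coefficients of \<open>barycentric_functionals\<close> are the only ones, so that the lower
  bound on the scatter matrix passes to the Gram matrix of the centred points, restricted to
  coefficient vectors with sum zero.
\<close>

lemma simplex_coefficient_bound:
  fixes x :: "'i \<Rightarrow> 'a::euclidean_space"
  assumes W: "finite W" "card W = DIM('a) + 1" and span: "affine hull (x ` W) = UNIV"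
    and x: "well_spread k W x" and k: "k > 0" and v: "(\<Sum>i\<in>W. v i) = 0"
  shows "k * (\<Sum>i\<in>W. (v i)\<^sup>2) \<le> (norm (\<Sum>i\<in>W. v i *\<^sub>R x i))\<^sup>2"
proof -
  have ne: "W \<noteq> {}" using W by auto
  let ?z = "\<Sum>i\<in>W. v i *\<^sub>R x i"
  obtain t where t: "\<And>i. linear (t i)" "\<And>z. (\<Sum>i\<in>W. t i z) = 0"
    "\<And>z. (\<Sum>i\<in>W. t i z *\<^sub>R x i) = z" "\<And>z. k * (\<Sum>i\<in>W. (t i z)\<^sup>2) \<le> (norm z)\<^sup>2"
    using barycentric_functionals[OF W(1) ne x k] by blast
  have "v i - t i ?z = 0" if "i \<in> W" for i
    by (rule simplex_affine_coefficients_unique[OF W span _ _ that])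
      (simp_all add: sum_subtractf v t scaleR_diff_left)
  then have "(\<Sum>i\<in>W. (v i)\<^sup>2) = (\<Sum>i\<in>W. (t i ?z)\<^sup>2)" by (intro sum.cong) auto
  then show ?thesis using t(4) by simp
qed

text \<open>
  On coefficients with sum zero the Gram matrix and \<open>-1/2\<close> times the matrix of squared distances
  have the same quadratic form. This is how perturbations of distances enter the estimates linearly.
\<close>

lemma norm_sum_zero_coefficients:
  fixes y :: "'i \<Rightarrow> 'a::real_inner"
  assumes "(\<Sum>i\<in>W. t i) = 0"
  shows "(norm (\<Sum>i\<in>W. t i *\<^sub>R y i))\<^sup>2 = - (\<Sum>i\<in>W. \<Sum>j\<in>W. t i * t j * (norm (y i - y j))\<^sup>2) / 2"
proof -
  have "(\<Sum>i\<in>W. \<Sum>j\<in>W. t i * t j * (norm (y i - y j))\<^sup>2)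
     = (\<Sum>i\<in>W. \<Sum>j\<in>W. (t i * (norm (y i))\<^sup>2) * t j + t i * (t j * (norm (y j))\<^sup>2)
         - 2 * inner (t i *\<^sub>R y i) (t j *\<^sub>R y j))"
    by (intro sum.cong refl) (simp add: power2_norm_eq_inner inner_diff_left inner_diff_right inner_commute algebra_simps)
  also have "\<dots> = (\<Sum>i\<in>W. t i * (norm (y i))\<^sup>2) * (\<Sum>j\<in>W. t j)
      + (\<Sum>i\<in>W. t i) * (\<Sum>j\<in>W. t j * (norm (y j))\<^sup>2)
      - 2 * inner (\<Sum>i\<in>W. t i *\<^sub>R y i) (\<Sum>j\<in>W. t j *\<^sub>R y j)"
    unfolding sum_product inner_sum_left unfolding inner_sum_right
    by (simp only: sum.distrib sum_subtractf sum_distrib_left)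
  finally have "(\<Sum>i\<in>W. \<Sum>j\<in>W. t i * t j * (norm (y i - y j))\<^sup>2)
      = - 2 * inner (\<Sum>i\<in>W. t i *\<^sub>R y i) (\<Sum>j\<in>W. t j *\<^sub>R y j)"
    unfolding assms by simp
  then show ?thesis by (simp add: power2_norm_eq_inner)
qed

lemma quadratic_form_bound:
  fixes t :: "'i \<Rightarrow> real"
  assumes "\<And>i j. i \<in> W \<Longrightarrow> j \<in> W \<Longrightarrow> \<bar>b i j\<bar> \<le> \<eta>" and "0 \<le> \<eta>"
  shows "\<bar>\<Sum>i\<in>W. \<Sum>j\<in>W. t i * t j * b i j\<bar> \<le> \<eta> * real (card W) * (\<Sum>i\<in>W. (t i)\<^sup>2)"
proof -
  have "\<bar>\<Sum>i\<in>W. \<Sum>j\<in>W. t i * t j * b i j\<bar> \<le> (\<Sum>i\<in>W. \<Sum>j\<in>W. \<bar>t i * t j * b i j\<bar>)"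
    by (rule order_trans[OF sum_abs sum_mono]) (rule sum_abs)
  also have "\<dots> \<le> (\<Sum>i\<in>W. \<Sum>j\<in>W. (\<bar>t i\<bar> * \<bar>t j\<bar>) * \<eta>)"
    unfolding abs_mult by (intro sum_mono mult_left_mono assms mult_nonneg_nonneg abs_ge_zero)
  also have "\<dots> = \<eta> * (\<Sum>i\<in>W. \<bar>t i\<bar>)\<^sup>2"
    by (simp add: power2_eq_square sum_product sum_distrib_left mult_ac)
  also have "\<dots> \<le> \<eta> * (real (card W) * (\<Sum>i\<in>W. \<bar>t i\<bar>\<^sup>2))"
    using sum_squared_le_sum_of_squares[of "\<lambda>i. \<bar>t i\<bar>" W] assms(2) by (intro mult_left_mono) (simp_all add: mult.commute)
  finally show ?thesis by (simp add: mult.assoc)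
qed

section \<open>Rigid transformations and near-isometries\<close>

lemma rigid_transformation_orthogonal:
  fixes g :: "real ^ 'p \<Rightarrow> real ^ 'p"
  assumes "rigid_transformation g"
  obtains f where "orthogonal_transformation f" "\<And>q. g q = g 0 + f q"
proof -
  have "orthogonal_transformation (\<lambda>q. g q - g 0)"
    using assms unfolding orthogonal_transformation_isometry rigid_transformation_def by (simp add: dist_norm)
  then show ?thesis by (intro that[of "\<lambda>q. g q - g 0"]) auto
qed

lemma rigid_transformationI:
  fixes f :: "real ^ 'p \<Rightarrow> real ^ 'p"
  assumes "orthogonal_transformation f"
  shows "rigid_transformation (\<lambda>q. b + f q)"
  using assms by (simp add: rigid_transformation_def orthogonal_transformation_isometry)

lemma rigid_norm_diff:
  fixes g :: "real ^ 'p \<Rightarrow> real ^ 'p"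
  shows "rigid_transformation g \<Longrightarrow> norm (g a - g b) = norm (a - b)"
  by (simp add: rigid_transformation_def dist_norm)

lemma rigid_compose: "rigid_transformation g \<Longrightarrow> rigid_transformation h \<Longrightarrow> rigid_transformation (\<lambda>q. g (h q))"
  by (simp add: rigid_transformation_def)

lemma rigid_inverse:
  fixes g :: "real ^ 'p \<Rightarrow> real ^ 'p"
  assumes "rigid_transformation g"
  obtains h where "rigid_transformation h" "\<forall>q. h (g q) = q"
proof -
  obtain f where f: "orthogonal_transformation f" "\<And>q. g q = g 0 + f q"
    using rigid_transformation_orthogonal[OF assms] by blast
  have "surj g"
  proof (rule surjI)
    fix q
    have "f (inv_into UNIV f (q - g 0)) = q - g 0" using f(1) orthogonal_transformation_surj surj_f_inv_f by metis
    then show "g (inv_into UNIV f (q - g 0)) = q" by (subst f(2)) simp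
  qed
  then have gi: "g (inv_into UNIV g q) = q" for q by (rule surj_f_inv_f)
  have "inj g" using assms by (intro injI) (metis rigid_transformation_def dist_eq_0_iff)
  then have "inv_into UNIV g (g q) = q" for q by (rule inv_f_f)
  moreover have "rigid_transformation (inv_into UNIV g)"
    using assms gi unfolding rigid_transformation_def by metis
  ultimately show ?thesis using gi that by blast
qed

lemma well_spread_rigid:
  fixes g :: "real ^ 'p \<Rightarrow> real ^ 'p"
  assumes W: "finite W" "W \<noteq> {}" and g: "rigid_transformation g" and x: "well_spread k W x"
  shows "well_spread k W (\<lambda>i. g (x i))"
  unfolding well_spread_def
proof
  fix z
  obtain f where f: "orthogonal_transformation f" "\<And>q. g q = g 0 + f q"
    using rigid_transformation_orthogonal[OF g] by blast
  have lin: "linear f" using f(1) by (rule orthogonal_transformation_linear)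
  have W0: "real (card W) \<noteq> 0" using W by simp
  have cen: "centroid W (\<lambda>i. g (x i)) = g 0 + f (centroid W x)"
    using W0 by (subst f(2)) (simp add: centroid_def sum.distrib linear_sum[OF lin] linear_scale[OF lin]
      scaleR_add_right sum_constant_scaleR del: sum_constant)
  obtain z' where z: "z = f z'" using orthogonal_transformation_surj[OF f(1)] by (metis surjD)
  have each: "inner (g (x i) - centroid W (\<lambda>i. g (x i))) z = inner (x i - centroid W x) z'" for i
  proof -
    have "g (x i) - centroid W (\<lambda>i. g (x i)) = f (x i - centroid W x)"
      unfolding cen by (subst f(2)) (simp add: linear_diff[OF lin])
    then show ?thesis using f(1) by (simp add: z orthogonal_transformation_def)
  qed
  have "norm z = norm z'" using f(1) by (simp add: z orthogonal_transformation_norm)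
  then show "k * (norm z)\<^sup>2 \<le> (\<Sum>i\<in>W. (inner (g (x i) - centroid W (\<lambda>i. g (x i))) z)\<^sup>2)"
    using x unfolding each well_spread_def by simp
qed

lemma sum_dist_centroid_minimal:
  fixes r :: "'i \<Rightarrow> 'a::real_inner"
  assumes W: "finite W" "W \<noteq> {}"
  shows "(\<Sum>i\<in>W. (norm (r i - centroid W r))\<^sup>2) \<le> (\<Sum>i\<in>W. (norm (r i - b))\<^sup>2)"
proof -
  let ?c = "centroid W r"
  have "(\<Sum>i\<in>W. (norm (r i - b))\<^sup>2)
      = (\<Sum>i\<in>W. (norm (r i - ?c))\<^sup>2 + 2 * inner (r i - ?c) (?c - b) + (norm (?c - b))\<^sup>2)"
    by (intro sum.cong refl) (simp add: power2_norm_eq_inner inner_diff_left inner_diff_right inner_commute algebra_simps)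
  also have "\<dots> = (\<Sum>i\<in>W. (norm (r i - ?c))\<^sup>2) + 2 * inner (\<Sum>i\<in>W. r i - ?c) (?c - b)
      + (\<Sum>i\<in>W. (norm (?c - b))\<^sup>2)"
    unfolding inner_sum_left by (simp only: sum.distrib sum_distrib_left)
  also have "\<dots> = (\<Sum>i\<in>W. (norm (r i - ?c))\<^sup>2) + (\<Sum>i\<in>W. (norm (?c - b))\<^sup>2)"
    unfolding sum_diff_centroid[OF W] by simp
  finally show ?thesis by (simp add: sum_nonneg)
qed

lemma compact_orthogonal_matrices: "compact {Q :: real ^ 'p ^ 'p. orthogonal_matrix Q}"
  unfolding compact_eq_bounded_closed
proof
  have "norm Q \<le> real CARD('p)" if "orthogonal_matrix Q" for Q :: "real ^ 'p ^ 'p"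
  proof -
    have "norm (vec_nth Q i) = 1" for i
      using that unfolding orthogonal_matrix_orthonormal_rows Finite_Cartesian_Product.row_def by simp
    moreover have "norm Q \<le> (\<Sum>i\<in>UNIV. norm (vec_nth Q i))"
      unfolding norm_vec_def by (rule L2_set_le_sum) simp
    ultimately show ?thesis by simp
  qed
  then show "bounded {Q :: real ^ 'p ^ 'p. orthogonal_matrix Q}" unfolding bounded_iff by blast
  have "closed {Q :: real ^ 'p ^ 'p. \<forall>i j. (\<Sum>k\<in>UNIV. vec_nth (vec_nth Q k) i * vec_nth (vec_nth Q k) j)
      = vec_nth (vec_nth (Finite_Cartesian_Product.mat 1 :: real ^ 'p ^ 'p) i) j}"
    by (intro closed_Collect_all closed_Collect_eq continuous_intros)
  then show "closed {Q :: real ^ 'p ^ 'p. orthogonal_matrix Q}"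
    unfolding orthogonal_matrix Finite_Cartesian_Product.vec_eq_iff by (simp add: matrix_matrix_mult_def transpose_def)
qed

text \<open>
  For a fixed orthogonal part the best translation matches the centroids, which leaves a
  continuous function on the compact orthogonal group.
\<close>

lemma rigid_argmin_exists:
  fixes x y :: "'i \<Rightarrow> real ^ 'p"
  assumes I: "finite I" "I \<noteq> {}"
  shows "\<exists>g. is_arg_min (\<lambda>g. \<Sum>i\<in>I. (norm (y i - g (x i)))\<^sup>2) rigid_transformation g"
proof -
  define r where "r Q i = y i - Q *v x i" for Q :: "real ^ 'p ^ 'p" and i
  define F where "F Q = (\<Sum>i\<in>I. (norm (r Q i - centroid I (r Q)))\<^sup>2)" for Q
  let ?O = "{Q :: real ^ 'p ^ 'p. orthogonal_matrix Q}"
  have contr: "continuous_on UNIV (\<lambda>Q. r Q i)" for i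
    unfolding r_def matrix_vector_mult_def
    by (intro continuous_intros continuous_on_vec_lambda)
  have "continuous_on UNIV F"
    unfolding F_def centroid_def by (intro continuous_intros contr)
  then have "continuous_on ?O F" by (rule continuous_on_subset) simp
  moreover have "?O \<noteq> {}" using orthogonal_matrix_id by blast
  ultimately obtain Q where Q: "orthogonal_matrix Q" "\<And>Q'. orthogonal_matrix Q' \<Longrightarrow> F Q \<le> F Q'"
    using continuous_attains_inf[OF compact_orthogonal_matrices] by blast
  let ?g = "\<lambda>q. centroid I (r Q) + Q *v q"
  have ot: "orthogonal_transformation (\<lambda>q. Q *v q)"
    using Q(1) by (simp add: orthogonal_transformation_matrix)
  have "(\<Sum>i\<in>I. (norm (y i - ?g (x i)))\<^sup>2) \<le> (\<Sum>i\<in>I. (norm (y i - h (x i)))\<^sup>2)"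
    if h: "rigid_transformation h" for h
  proof -
    obtain f where f: "orthogonal_transformation f" "\<And>q. h q = h 0 + f q"
      using rigid_transformation_orthogonal[OF h] by blast
    have om: "orthogonal_matrix (matrix f)" using f(1) by (simp add: orthogonal_transformation_matrix)
    have mf: "matrix f *v q = f q" for q
      using orthogonal_transformation_linear[OF f(1)] by (metis matrix_vector_mul(2))
    have "(\<Sum>i\<in>I. (norm (y i - ?g (x i)))\<^sup>2) = F Q"
      unfolding F_def r_def by (intro sum.cong refl) (simp add: algebra_simps)
    also have "\<dots> \<le> F (matrix f)" by (rule Q(2)[OF om])
    also have "\<dots> \<le> (\<Sum>i\<in>I. (norm (r (matrix f) i - h 0))\<^sup>2)"
      unfolding F_def by (rule sum_dist_centroid_minimal[OF I])
    also have "\<dots> = (\<Sum>i\<in>I. (norm (y i - h (x i)))\<^sup>2)"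
      by (intro sum.cong refl, subst f(2)) (simp add: r_def mf algebra_simps)
    finally show ?thesis .
  qed
  then have "is_arg_min (\<lambda>g. \<Sum>i\<in>I. (norm (y i - g (x i)))\<^sup>2) rigid_transformation ?g"
    using rigid_transformationI[OF ot, of "centroid I (r Q)"] unfolding is_arg_min_def by (meson not_less)
  then show ?thesis by blast
qed

lemma bij_betw_to_nat_on_UNIV: "bij_betw (to_nat_on (UNIV :: 'p::finite set)) UNIV {..<CARD('p)}"
  using to_nat_on_finite[of "UNIV :: 'p set"] by simp

lemma sum_to_nat_on_UNIV:
  "(\<Sum>c\<in>(UNIV :: 'p::finite set). f (to_nat_on (UNIV :: 'p set) c)) = (\<Sum>k<CARD('p). f k)"
  by (rule sum.reindex_bij_betw[OF bij_betw_to_nat_on_UNIV])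

lemma to_nat_on_UNIV_less: "to_nat_on (UNIV :: 'p::finite set) c < CARD('p)"
  using bij_betw_to_nat_on_UNIV[where 'p='p] unfolding bij_betw_def by auto

lemma from_nat_into_to_nat_on_UNIV: "from_nat_into (UNIV :: 'p::finite set) (to_nat_on (UNIV :: 'p set) c) = c"
  by (simp add: countable_finite)

lemma to_nat_on_eq_iff_UNIV: "to_nat_on (UNIV :: 'p::finite set) a = to_nat_on UNIV b \<longleftrightarrow> a = b"
  by (metis from_nat_into_to_nat_on_UNIV)

text \<open>
  The basis consists of eigenvectors of \<open>L\<^sup>T L\<close>, as in the singular value decomposition.
\<close>

lemma orthonormal_basis_with_orthogonal_images:
  fixes L :: "real ^ 'p \<Rightarrow> real ^ 'q"
  assumes L: "linear L"
  obtains v :: "'p \<Rightarrow> real ^ 'p" where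
    "\<And>a b. inner (v a) (v b) = (if a = b then 1 else 0)"
    "\<And>a b. a \<noteq> b \<Longrightarrow> inner (L (v a)) (L (v b)) = 0"
proof -
  let ?p = "CARD('p)"
  let ?tn = "to_nat_on (UNIV :: 'p set)"
  define e where "e i = L (axis (from_nat_into (UNIV :: 'p set) i) 1)" for i
  define A where "A = Matrix.mat ?p ?p (\<lambda>(i, j). inner (e i) (e j))"
  have A: "A \<in> carrier_mat ?p ?p" by (simp add: A_def)
  have sym: "transpose_mat A = A" by (rule eq_matI) (auto simp: A_def inner_commute)
  obtain es where es: "char_poly A = (\<Prod>e\<leftarrow>es. [:- e, 1:])"
    using symmetric_char_poly_splits[OF A sym] by blast
  obtain u where ev: "\<And>k. k < ?p \<Longrightarrow> eigenvector A (u k) (es ! k)"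
    and on: "\<And>k l. k < ?p \<Longrightarrow> l < ?p \<Longrightarrow> scalar_prod (u k) (u l) = (if k = l then 1 else 0)"
    using symmetric_orthonormal_eigenvectors(2)[OF A sym es] by blast
  have uc: "u k \<in> carrier_vec ?p" if "k < ?p" for k
    using ev[OF that] A unfolding eigenvector_def by simp
  define v :: "'p \<Rightarrow> real ^ 'p" where "v a = (\<chi> c. vec_index (u (?tn a)) (?tn c))" for a
  have "inner (v a) (v b) = (if a = b then 1 else 0)" for a b
  proof -
    have "inner (v a) (v b) = (\<Sum>k<?p. vec_index (u (?tn a)) k * vec_index (u (?tn b)) k)"
      unfolding inner_vec_def v_def
      using sum_to_nat_on_UNIV[of "\<lambda>k. vec_index (u (?tn a)) k * vec_index (u (?tn b)) k", where 'p='p] by simp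
    also have "\<dots> = scalar_prod (u (?tn a)) (u (?tn b))"
      using uc[of "?tn b"] by (simp add: scalar_prod_def atLeast0LessThan to_nat_on_UNIV_less)
    finally show ?thesis by (simp add: on to_nat_on_UNIV_less to_nat_on_eq_iff_UNIV)
  qed
  moreover have "inner (L (v a)) (L (v b)) = 0" if "a \<noteq> b" for a b
  proof -
    let ?a = "?tn a" and ?b = "?tn b"
    have Lv: "L (v c) = (\<Sum>i<?p. vec_index (u (?tn c)) i *\<^sub>R e i)" for c
    proof -
      have "v c = (\<Sum>d\<in>UNIV. vec_index (u (?tn c)) (?tn d) *\<^sub>R axis d 1)"
        using basis_expansion[of "v c"] by (simp add: v_def scalar_mult_eq_scaleR)
      then have "L (v c) = (\<Sum>d\<in>UNIV. vec_index (u (?tn c)) (?tn d) *\<^sub>R e (?tn d))"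
        by (simp add: linear_sum[OF L] linear_scale[OF L] e_def from_nat_into_to_nat_on_UNIV)
      then show ?thesis
        using sum_to_nat_on_UNIV[of "\<lambda>i. vec_index (u (?tn c)) i *\<^sub>R e i", where 'p='p] by simp
    qed
    have "inner (L (v a)) (L (v b)) = (\<Sum>i<?p. vec_index (u ?a) i * (\<Sum>j<?p. A $$ (i, j) * vec_index (u ?b) j))"
      unfolding Lv inner_sum_left unfolding inner_sum_right sum_distrib_left
      by (intro sum.cong refl) (simp add: A_def mult_ac)
    also have "\<dots> = (\<Sum>i<?p. vec_index (u ?a) i * (es ! ?b * vec_index (u ?b) i))"
    proof (intro sum.cong refl arg_cong2[of _ _ _ _ "(*)"])
      fix i assume i: "i \<in> {..<?p}"
      have "vec_index (A *\<^sub>v u ?b) i = vec_index (es ! ?b \<cdot>\<^sub>v u ?b) i"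
        using ev[of ?b] by (simp add: eigenvector_def to_nat_on_UNIV_less)
      then show "(\<Sum>j<?p. A $$ (i, j) * vec_index (u ?b) j) = es ! ?b * vec_index (u ?b) i"
        using i A uc[of ?b] by (simp add: scalar_prod_def atLeast0LessThan to_nat_on_UNIV_less)
    qed
    also have "\<dots> = es ! ?b * scalar_prod (u ?a) (u ?b)"
      using uc[of ?b] by (simp add: scalar_prod_def atLeast0LessThan to_nat_on_UNIV_less sum_distrib_left mult_ac)
    finally show ?thesis using that by (simp add: on to_nat_on_UNIV_less to_nat_on_eq_iff_UNIV)
  qed
  ultimately show ?thesis by (rule that)
qed

text \<open>
  The orthogonal factor of the polar decomposition of \<open>L\<close>: it sends the basis vector \<open>v\<close> to
  \<open>L v / |L v|\<close>, and \<open>| |L v| - 1 | \<le> | |L v|\<^sup>2 - 1 |\<close>, so passing from squared lengths to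
  lengths loses no order of magnitude.
\<close>

lemma near_isometry_close_to_orthogonal:
  fixes L :: "real ^ 'p \<Rightarrow> real ^ 'p"
  assumes L: "linear L" and near: "\<And>z. \<bar>(norm (L z))\<^sup>2 - (norm z)\<^sup>2\<bar> \<le> \<theta> * (norm z)\<^sup>2" and \<theta>: "\<theta> < 1"
  obtains f where "orthogonal_transformation f" "\<And>z. norm (L z - f z) \<le> real CARD('p) * \<theta> * norm z"
proof -
  obtain v :: "'p \<Rightarrow> real ^ 'p" where
    v: "\<And>a b. inner (v a) (v b) = (if a = b then 1 else 0)" and
    Lv: "\<And>a b. a \<noteq> b \<Longrightarrow> inner (L (v a)) (L (v b)) = 0"
    using orthonormal_basis_with_orthogonal_images[OF L] by blast
  have nv: "norm (v a) = 1" for a using v[of a a] by (simp add: norm_eq_sqrt_inner)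
  have pos: "norm (L (v a)) > 0" for a
    using near[of "v a"] \<theta> by (auto simp: nv)
  define q where "q a = (1 / norm (L (v a))) *\<^sub>R L (v a)" for a
  have q: "inner (q a) (q b) = (if a = b then 1 else 0)" for a b
    using Lv[of a b] pos[of a] by (auto simp: q_def power2_norm_eq_inner[symmetric] power2_eq_square)
  have close: "norm (L (v a) - q a) \<le> \<theta>" for a
  proof -
    let ?s = "norm (L (v a))"
    have "L (v a) - q a = (?s - 1) *\<^sub>R q a" using pos[of a] by (simp add: q_def scaleR_diff_left diff_divide_distrib)
    moreover have "norm (q a) = 1" using q[of a a] by (simp add: norm_eq_sqrt_inner)
    ultimately have eq: "norm (L (v a) - q a) = \<bar>?s - 1\<bar>" by simp
    have "?s\<^sup>2 - 1 = (?s - 1) * (?s + 1)" by (simp add: power2_eq_square algebra_simps)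
    then have "\<bar>?s - 1\<bar> * (?s + 1) \<le> \<theta>" using near[of "v a"] pos[of a] by (simp add: nv abs_mult)
    moreover have "\<bar>?s - 1\<bar> * 1 \<le> \<bar>?s - 1\<bar> * (?s + 1)" by (rule mult_left_mono) auto
    ultimately have "\<bar>?s - 1\<bar> * 1 \<le> \<theta>" by (rule order_trans[rotated])
    then show ?thesis unfolding eq by simp
  qed
  define P :: "real ^ 'p ^ 'p" where "P = (\<chi> a. v a)"
  define B :: "real ^ 'p ^ 'p" where "B = (\<chi> a. q a)"
  have oP: "orthogonal_matrix P" and oB: "orthogonal_matrix B"
    unfolding orthogonal_matrix_orthonormal_rows by (auto simp: P_def B_def Finite_Cartesian_Product.row_def real_inner_class.orthogonal_def v q norm_eq_sqrt_inner)
  let ?Q = "transpose B ** P"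
  have "orthogonal_matrix ?Q" using oP oB by (intro orthogonal_matrix_mul) simp_all
  then have ot: "orthogonal_transformation (\<lambda>z. ?Q *v z)"
    by (simp add: orthogonal_transformation_matrix)
  have expand: "transpose M *v w = (\<Sum>a\<in>UNIV. vec_nth w a *\<^sub>R vec_nth M a)" for M :: "real ^ 'p ^ 'p" and w
    by (simp add: Finite_Cartesian_Product.vec_eq_iff matrix_vector_mult_def transpose_def mult.commute)
  have Pz: "vec_nth (P *v z) a = inner (v a) z" for a z
    by (simp add: matrix_vector_mul_component P_def)
  have Qz: "?Q *v z = (\<Sum>a\<in>UNIV. inner (v a) z *\<^sub>R q a)" for z
    unfolding matrix_vector_mul_assoc[symmetric] expand Pz by (simp add: B_def)
  have zexp: "z = (\<Sum>a\<in>UNIV. inner (v a) z *\<^sub>R v a)" for z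
  proof -
    have "z = (transpose P ** P) *v z" using oP by (simp add: orthogonal_matrix)
    also have "\<dots> = (\<Sum>a\<in>UNIV. inner (v a) z *\<^sub>R v a)"
      unfolding matrix_vector_mul_assoc[symmetric] expand Pz by (simp add: P_def)
    finally show ?thesis .
  qed
  have "norm (L z - ?Q *v z) \<le> real CARD('p) * \<theta> * norm z" for z
  proof -
    have "L z = (\<Sum>a\<in>UNIV. inner (v a) z *\<^sub>R L (v a))"
      by (subst zexp[of z]) (simp add: linear_sum[OF L] linear_scale[OF L])
    then have "L z - ?Q *v z = (\<Sum>a\<in>UNIV. inner (v a) z *\<^sub>R (L (v a) - q a))"
      by (simp add: Qz sum_subtractf scaleR_diff_right)
    also have "norm \<dots> \<le> (\<Sum>a\<in>(UNIV::'p set). norm z * \<theta>)"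
    proof (rule sum_norm_le)
      fix a
      have "\<bar>inner (v a) z\<bar> \<le> norm z" using Cauchy_Schwarz_ineq2[of "v a" z] by (simp add: nv)
      then show "norm (inner (v a) z *\<^sub>R (L (v a) - q a)) \<le> norm z * \<theta>"
        using close[of a] by (simp add: mult_mono)
    qed
    finally show ?thesis by (simp add: mult_ac)
  qed
  with ot show ?thesis by (rule that)
qed

text \<open>
  Two simplices with nearly equal edge lengths are nearly congruent, with a linear bound. The affine
  map \<open>L\<close> that takes one to the other is a near-isometry, because it preserves barycentric
  coefficients and the distances determine the Gram matrix on coefficients with sum zero; it is then
  replaced by a nearby orthogonal map.
\<close>

lemma simplex_procrustes:
  fixes x y :: "'i \<Rightarrow> real ^ 'p"
  assumes W: "finite W" "card W = CARD('p) + 1" and span: "affine hull (x ` W) = UNIV"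
    and x: "well_spread k W x" and k: "k > 0"
    and D: "\<And>i j. i \<in> W \<Longrightarrow> j \<in> W \<Longrightarrow> norm (x i - x j) \<le> D"
    and close: "\<And>i j. i \<in> W \<Longrightarrow> j \<in> W \<Longrightarrow> \<bar>(norm (y i - y j))\<^sup>2 - (norm (x i - x j))\<^sup>2\<bar> \<le> \<eta>"
    and small: "real (CARD('p) + 1) * \<eta> / (2 * k) < 1"
  obtains g where "rigid_transformation g"
    "\<And>i. i \<in> W \<Longrightarrow> norm (y i - g (x i)) \<le> real CARD('p) * (real (CARD('p) + 1) * \<eta> / (2 * k)) * D"
proof -
  have ne: "W \<noteq> {}" using W by auto
  let ?m = "real (CARD('p) + 1)"
  define \<theta> where "\<theta> = ?m * \<eta> / (2 * k)"
  have \<eta>0: "0 \<le> \<eta>" using ne close abs_ge_zero by (meson all_not_in_conv order_trans)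
  have \<theta>0: "0 \<le> \<theta>" using \<eta>0 k by (simp add: \<theta>_def)
  obtain t where t: "\<And>i. linear (t i)" "\<And>z. (\<Sum>i\<in>W. t i z) = 0"
    "\<And>z. (\<Sum>i\<in>W. t i z *\<^sub>R x i) = z" "\<And>z. k * (\<Sum>i\<in>W. (t i z)\<^sup>2) \<le> (norm z)\<^sup>2"
    using barycentric_functionals[OF W(1) ne x k] by blast
  define L where "L z = (\<Sum>i\<in>W. t i z *\<^sub>R y i)" for z
  have L: "linear L" unfolding L_def
    by (intro linear_compose_sum ballI linearI)
       (simp_all add: linear_add[OF t(1)] linear_scale[OF t(1)] scaleR_add_left)
  have "\<bar>(norm (L z))\<^sup>2 - (norm z)\<^sup>2\<bar> \<le> \<theta> * (norm z)\<^sup>2" for z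
  proof -
    have "(norm (L z))\<^sup>2 - (norm z)\<^sup>2 = - (\<Sum>i\<in>W. \<Sum>j\<in>W. t i z * t j z * (norm (y i - y j))\<^sup>2) / 2
       + (\<Sum>i\<in>W. \<Sum>j\<in>W. t i z * t j z * (norm (x i - x j))\<^sup>2) / 2"
      using norm_sum_zero_coefficients[OF t(2)[of z], of y] norm_sum_zero_coefficients[OF t(2)[of z], of x]
      unfolding L_def t(3) by simp
    also have "\<dots> = - (\<Sum>i\<in>W. \<Sum>j\<in>W. t i z * t j z * ((norm (y i - y j))\<^sup>2 - (norm (x i - x j))\<^sup>2)) / 2"
      by (simp add: right_diff_distrib sum_subtractf diff_divide_distrib)
    finally have "\<bar>(norm (L z))\<^sup>2 - (norm z)\<^sup>2\<bar> = \<bar>\<Sum>i\<in>W. \<Sum>j\<in>W. t i z * t j z * ((norm (y i - y j))\<^sup>2 - (norm (x i - x j))\<^sup>2)\<bar> / 2"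
      by simp
    also have "\<dots> \<le> \<eta> * real (card W) * (\<Sum>i\<in>W. (t i z)\<^sup>2) / 2"
      by (intro divide_right_mono quadratic_form_bound close \<eta>0) auto
    also have "\<dots> = \<theta> * (k * (\<Sum>i\<in>W. (t i z)\<^sup>2))" using k W by (simp add: \<theta>_def)
    also have "\<dots> \<le> \<theta> * (norm z)\<^sup>2" using t(4) \<theta>0 by (intro mult_left_mono)
    finally show ?thesis .
  qed
  then obtain f where f: "orthogonal_transformation f" "\<And>z. norm (L z - f z) \<le> real CARD('p) * \<theta> * norm z"
    using near_isometry_close_to_orthogonal[OF L _ small[folded \<theta>_def]] by blast
  let ?cx = "centroid W x" and ?cy = "centroid W y"
  let ?g = "\<lambda>q. (?cy - f ?cx) + f q"
  have "rigid_transformation ?g" by (rule rigid_transformationI[OF f(1)])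
  moreover have "norm (y i - ?g (x i)) \<le> real CARD('p) * \<theta> * D" if i: "i \<in> W" for i
  proof -
    let ?z = "x i - ?cx"
    \<comment> \<open>The obvious sum-zero coefficients of \<open>x i\<close> minus the centroid; uniqueness shows that \<open>t\<close> produces the same ones, so \<open>L\<close> maps centred points to centred points.\<close>
    let ?s = "\<lambda>j. (if j = i then 1 else 0) - 1 / real (card W)"
    have s: "(\<Sum>j\<in>W. ?s j *\<^sub>R w j) = w i - centroid W w" for w :: "'i \<Rightarrow> real ^ 'p"
      using W(1) i by (simp add: scaleR_diff_left sum_subtractf centroid_def scaleR_sum_right if_distrib[of "\<lambda>c. c *\<^sub>R _"] cong: if_cong)
    have s0: "(\<Sum>j\<in>W. ?s j) = 0" using W(1) i ne by (simp add: sum_subtractf)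
    have "(\<Sum>j\<in>W. t j ?z - ?s j) = 0"
      using s0 t(2)[of ?z] by (simp only: sum_subtractf)
    moreover have "(\<Sum>j\<in>W. (t j ?z - ?s j) *\<^sub>R x j) = 0"
      using s[of x] t(3)[of ?z] by (simp only: scaleR_diff_left[of "t _ _"] sum_subtractf diff_self)
    ultimately have "t j ?z - ?s j = 0" if "j \<in> W" for j
      by (rule simplex_affine_coefficients_unique[OF W(1) _ span _ _ that, rotated]) (simp add: W(2))
    then have "L ?z = (\<Sum>j\<in>W. ?s j *\<^sub>R y j)" unfolding L_def by (intro sum.cong) auto
    also have "\<dots> = y i - ?cy" by (rule s)
    finally have "y i - ?g (x i) = L ?z - f ?z"
      using linear_diff[OF orthogonal_transformation_linear[OF f(1)]] by simp
    also have "norm \<dots> \<le> real CARD('p) * \<theta> * norm ?z" by (rule f(2))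
    also have "\<dots> \<le> real CARD('p) * \<theta> * D"
      using norm_diff_centroid_le[OF W(1) ne, of "x i" x D] D[OF i] \<theta>0 by (intro mult_left_mono) auto
    finally show ?thesis .
  qed
  ultimately show ?thesis unfolding \<theta>_def by (rule that)
qed

section \<open>Classical scaling of a simplex\<close>

definition row_mean :: "nat \<Rightarrow> (nat \<Rightarrow> nat \<Rightarrow> real) \<Rightarrow> nat \<Rightarrow> real" where
  "row_mean m d i = (\<Sum>j<m. (d i j)\<^sup>2) / real m"

text \<open>
  The entries of \<open>- H \<Delta> H / 2\<close>; if \<open>d\<close> consists of the distances of a configuration, this is the
  Gram matrix of the configuration centred at its centroid.
\<close>

definition centered_gram :: "nat \<Rightarrow> (nat \<Rightarrow> nat \<Rightarrow> real) \<Rightarrow> nat \<Rightarrow> nat \<Rightarrow> real" where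
  "centered_gram m d i j =
     - (1 / 2) * ((d i j)\<^sup>2 - row_mean m d j - row_mean m d i + (\<Sum>l<m. row_mean m d l) / real m)"

lemma scaling_mat_eq:
  assumes sym: "\<And>i j. i < m \<Longrightarrow> j < m \<Longrightarrow> d i j = d j i"
  shows "scaling_mat m d = Matrix.mat m m (\<lambda>(i, j). centered_gram m d i j)"
proof (rule eq_matI)
  fix i j assume "i < dim_row (Matrix.mat m m (\<lambda>(i, j). centered_gram m d i j))"
    "j < dim_col (Matrix.mat m m (\<lambda>(i, j). centered_gram m d i j))"
  then have ij: "i < m" "j < m" by auto
  let ?H = "\<lambda>i j. (if i = j then 1 else 0) - 1 / real m"
  let ?D = "Matrix.mat m m (\<lambda>(i, j). (d i j)\<^sup>2)"
  have C: "centering_mat m = Matrix.mat m m (\<lambda>(i, j). ?H i j)"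
    by (rule eq_matI) (auto simp: centering_mat_def)
  have CD: "centering_mat m * ?D = Matrix.mat m m (\<lambda>(i, l). (d i l)\<^sup>2 - row_mean m d l)"
  proof (rule eq_matI)
    fix i l assume "i < dim_row (Matrix.mat m m (\<lambda>(i, l). (d i l)\<^sup>2 - row_mean m d l))"
      "l < dim_col (Matrix.mat m m (\<lambda>(i, l). (d i l)\<^sup>2 - row_mean m d l))"
    then have il: "i < m" "l < m" by auto
    have "(centering_mat m * ?D) $$ (i, l) = (\<Sum>k<m. ?H i k * (d k l)\<^sup>2)"
      using il by (simp add: C scalar_prod_def atLeast0LessThan)
    also have "\<dots> = (\<Sum>k<m. (if k = i then (d k l)\<^sup>2 else 0) - (d l k)\<^sup>2 / real m)"
      by (intro sum.cong refl) (auto simp: left_diff_distrib sym[OF il(2)])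
    also have "\<dots> = (d i l)\<^sup>2 - row_mean m d l"
      using il by (simp add: sum_subtractf row_mean_def sum_divide_distrib)
    finally show "(centering_mat m * ?D) $$ (i, l) = Matrix.mat m m (\<lambda>(i, l). (d i l)\<^sup>2 - row_mean m d l) $$ (i, l)"
      using il by simp
  qed (auto simp: C)
  have "(centering_mat m * ?D * centering_mat m) $$ (i, j) = (\<Sum>l<m. ((d i l)\<^sup>2 - row_mean m d l) * ?H l j)"
    unfolding CD using ij by (simp add: C scalar_prod_def atLeast0LessThan)
  also have "\<dots> = (\<Sum>l<m. (if l = j then (d i l)\<^sup>2 - row_mean m d l else 0) - (d i l)\<^sup>2 / real m + row_mean m d l / real m)"
    by (intro sum.cong refl) (auto simp: right_diff_distrib diff_divide_distrib)
  also have "\<dots> = (d i j)\<^sup>2 - row_mean m d j - row_mean m d i + (\<Sum>l<m. row_mean m d l) / real m"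
    using ij by (simp add: sum_subtractf sum.distrib sum_divide_distrib) (simp add: row_mean_def sum_divide_distrib)
  finally have "(centering_mat m * ?D * centering_mat m) $$ (i, j)
      = (d i j)\<^sup>2 - row_mean m d j - row_mean m d i + (\<Sum>l<m. row_mean m d l) / real m" .
  moreover have "scaling_mat m d $$ (i, j) = - (1 / 2) * (centering_mat m * ?D * centering_mat m) $$ (i, j)"
    using ij by (simp add: scaling_mat_def C)
  ultimately show "scaling_mat m d $$ (i, j) = Matrix.mat m m (\<lambda>(i, j). centered_gram m d i j) $$ (i, j)"
    using ij by (simp only: index_mat prod.case centered_gram_def)
qed (auto simp: scaling_mat_def centering_mat_def)

lemma centered_gram_sym:
  "(\<And>i j. i < m \<Longrightarrow> j < m \<Longrightarrow> d i j = d j i) \<Longrightarrow> i < m \<Longrightarrow> j < m \<Longrightarrow> centered_gram m d i j = centered_gram m d j i"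
  by (simp add: centered_gram_def)

lemma transpose_scaling_mat:
  assumes sym: "\<And>i j. i < m \<Longrightarrow> j < m \<Longrightarrow> d i j = d j i"
  shows "transpose_mat (scaling_mat m d) = scaling_mat m d"
proof -
  have eqB: "scaling_mat m d = Matrix.mat m m (\<lambda>(i, j). centered_gram m d i j)"
    by (rule scaling_mat_eq) (rule sym)
  show ?thesis unfolding eqB
    by (rule eq_matI) (auto intro: centered_gram_sym sym)
qed

lemma sum_centered_gram:
  assumes "m > 0"
  shows "(\<Sum>j<m. centered_gram m d i j) = 0"
proof -
  have "(\<Sum>j<m. centered_gram m d i j)
    = - (1/2) * ((\<Sum>j<m. (d i j)\<^sup>2) - real m * row_mean m d i - (\<Sum>j<m. row_mean m d j) + (\<Sum>l<m. row_mean m d l))"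
    using assms unfolding centered_gram_def sum_distrib_left[symmetric]
    by (simp add: sum.distrib sum_subtractf)
  then show ?thesis using assms by (simp add: row_mean_def)
qed

lemma centered_gram_polarization:
  assumes "d i i = 0" "d j j = 0"
  shows "centered_gram m d i i + centered_gram m d j j - 2 * centered_gram m d i j = (d i j)\<^sup>2"
  using assms by (simp add: centered_gram_def field_simps)

lemma centered_gram_quadratic_form:
  assumes "(\<Sum>i<m. v i) = 0"
  shows "(\<Sum>i<m. \<Sum>j<m. v i * v j * centered_gram m d i j) = - (\<Sum>i<m. \<Sum>j<m. v i * v j * (d i j)\<^sup>2) / 2"
proof -
  let ?s = "(\<Sum>l<m. row_mean m d l) / real m"
  have "(\<Sum>i<m. \<Sum>j<m. v i * v j * centered_gram m d i j)
    = (\<Sum>i<m. \<Sum>j<m. (v i * (row_mean m d i - ?s) / 2) * v j + v i * (v j * row_mean m d j / 2) - v i * v j * (d i j)\<^sup>2 / 2)"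
    by (intro sum.cong refl) (simp add: centered_gram_def field_simps)
  also have "\<dots> = (\<Sum>i<m. v i * (row_mean m d i - ?s) / 2) * (\<Sum>j<m. v j)
     + (\<Sum>i<m. v i) * (\<Sum>j<m. v j * row_mean m d j / 2) - (\<Sum>i<m. \<Sum>j<m. v i * v j * (d i j)\<^sup>2 / 2)"
    unfolding sum_product by (simp only: sum.distrib sum_subtractf)
  finally show ?thesis using assms by (simp add: sum_divide_distrib)
qed

lemma classical_scaling_exists:
  assumes m: "CARD('p) \<le> m" and sym: "\<And>i j. i < m \<Longrightarrow> j < m \<Longrightarrow> d i j = d j i"
  shows "\<exists>y :: nat \<Rightarrow> real ^ 'p. classical_scaling m d y"
proof -
  let ?B = "scaling_mat m d"
  have eqB: "scaling_mat m d = Matrix.mat m m (\<lambda>(i, j). centered_gram m d i j)"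
    by (rule scaling_mat_eq) (rule sym)
  have B: "?B \<in> carrier_mat m m" unfolding eqB by simp
  have symB: "transpose_mat ?B = ?B" by (rule transpose_scaling_mat) (rule sym)
  obtain es0 where es0: "char_poly ?B = (\<Prod>e\<leftarrow>es0. [:- e, 1:])"
    using symmetric_char_poly_splits[OF B symB] by blast
  define es where "es = rev (sort es0)"
  have "mset (map (\<lambda>e. [:- e, 1:]) es0) = mset (map (\<lambda>e. [:- e, 1:]) es)" by (simp add: es_def)
  then have es: "char_poly ?B = (\<Prod>e\<leftarrow>es. [:- e, 1:])"
    unfolding es0 by (metis prod_mset_prod_list)
  have "sorted_wrt (\<ge>) es" by (simp add: es_def sorted_wrt_rev)
  with es have "eigenvalues_decreasing ?B es" by (simp add: eigenvalues_decreasing_def)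
  moreover obtain u where "\<And>k. k < m \<Longrightarrow> eigenvector ?B (u k) (es ! k)"
    "\<And>k l. k < m \<Longrightarrow> l < m \<Longrightarrow> scalar_prod (u k) (u l) = (if k = l then 1 else 0)"
    using symmetric_orthonormal_eigenvectors(2)[OF B symB es] by blast
  ultimately show ?thesis
    using m unfolding classical_scaling_def
    by (intro exI[of _ "\<lambda>i. \<chi> c. let k = to_nat_on (UNIV :: 'p set) c
                            in sqrt (max (es ! k) 0) * vec_index (u k) i"] exI[of _ es] exI[of _ u]) auto
qed

text \<open>
  With one point more than the dimension, classical scaling discards nothing as long as the data are
  close to those of a nondegenerate simplex. The matrix \<open>B\<close> annihilates constant vectors, and by
  \<open>simplex_coefficient_bound\<close> it is positive definite on their orthogonal complement, which has
  dimension \<open>p\<close>. Hence the \<open>p\<close> largest eigenvalues are positive, their eigenvectors span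
  this complement, \<open>B\<close> is the Gram matrix of the output, and the output has precisely the
  prescribed distances.
\<close>

proposition classical_scaling_exact:
  fixes x y :: "nat \<Rightarrow> real ^ 'p"
  assumes cs: "classical_scaling m d y" and m: "m = CARD('p) + 1"
    and sym: "\<And>i j. i < m \<Longrightarrow> j < m \<Longrightarrow> d i j = d j i" and d0: "\<And>i. i < m \<Longrightarrow> d i i = 0"
    and span: "affine hull (x ` {..<m}) = UNIV" and x: "well_spread k {..<m} x" and k: "k > 0"
    and close: "\<And>i j. i < m \<Longrightarrow> j < m \<Longrightarrow> \<bar>(d i j)\<^sup>2 - (norm (x i - x j))\<^sup>2\<bar> \<le> \<eta>"
    and small: "real m * \<eta> / 2 < k"
    and ij: "i < m" "j < m"
  shows "(norm (y i - y j))\<^sup>2 = (d i j)\<^sup>2"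
proof -
  let ?p = "CARD('p)"
  let ?B = "scaling_mat m d"
  let ?b = "centered_gram m d"
  have m0: "m > 0" using m by simp
  have \<eta>0: "0 \<le> \<eta>" using close[OF m0 m0] by (meson abs_ge_zero order_trans)
  have eqB: "scaling_mat m d = Matrix.mat m m (\<lambda>(i, j). centered_gram m d i j)"
    by (rule scaling_mat_eq) (rule sym)
  have B: "?B \<in> carrier_mat m m" unfolding eqB by simp
  have symB: "transpose_mat ?B = ?B" by (rule transpose_scaling_mat) (rule sym)
  have Bij: "?B $$ (i, j) = ?b i j" if "i < m" "j < m" for i j
    unfolding eqB using that by simp
  obtain es u where es: "char_poly ?B = (\<Prod>e\<leftarrow>es. [:- e, 1:])" and sorted: "sorted_wrt (\<ge>) es"
    and ev: "\<And>k. k < ?p \<Longrightarrow> eigenvector ?B (u k) (es ! k)"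
    and on: "\<And>k l. k < ?p \<Longrightarrow> l < ?p \<Longrightarrow> scalar_prod (u k) (u l) = (if k = l then 1 else 0)"
    and y: "\<And>i. i < m \<Longrightarrow> y i = (\<chi> c. let k = to_nat_on (UNIV :: 'p set) c
                            in sqrt (max (es ! k) 0) * vec_index (u k) i)"
    using cs unfolding classical_scaling_def eigenvalues_decreasing_def by blast
  have pd: "(k - real m * \<eta> / 2) * (\<Sum>i<m. (v i)\<^sup>2) \<le> (\<Sum>i<m. \<Sum>j<m. v i * v j * ?b i j)"
    if v: "(\<Sum>i<m. v i) = 0" for v
  proof -
    have "k * (\<Sum>i<m. (v i)\<^sup>2) \<le> (norm (\<Sum>i<m. v i *\<^sub>R x i))\<^sup>2"
      by (rule simplex_coefficient_bound) (use span x k v m in auto)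
    also have "\<dots> = - (\<Sum>i<m. \<Sum>j<m. v i * v j * (norm (x i - x j))\<^sup>2) / 2"
      by (rule norm_sum_zero_coefficients[OF v])
    also have "\<dots> = (\<Sum>i<m. \<Sum>j<m. v i * v j * ((d i j)\<^sup>2 - (norm (x i - x j))\<^sup>2)) / 2
        - (\<Sum>i<m. \<Sum>j<m. v i * v j * (d i j)\<^sup>2) / 2"
      by (simp add: right_diff_distrib sum_subtractf diff_divide_distrib)
    also have "(\<Sum>i<m. \<Sum>j<m. v i * v j * ((d i j)\<^sup>2 - (norm (x i - x j))\<^sup>2)) / 2
        \<le> (\<eta> * real m * (\<Sum>i<m. (v i)\<^sup>2)) / 2"
      using quadratic_form_bound[of "{..<m}" "\<lambda>i j. (d i j)\<^sup>2 - (norm (x i - x j))\<^sup>2" \<eta> v] close \<eta>0 by simp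
    finally show ?thesis unfolding centered_gram_quadratic_form[OF v] by (simp add: algebra_simps)
  qed
  have ev_rows: "(\<Sum>j<m. ?b i j * vec_index w j) = e * vec_index w i"
    if w: "eigenvector ?B w e" and i: "i < m" for w e i
  proof -
    have wc: "w \<in> carrier_vec m" using w B unfolding eigenvector_def by simp
    have "vec_index (?B *\<^sub>v w) i = vec_index (e \<cdot>\<^sub>v w) i" using w unfolding eigenvector_def by simp
    then show ?thesis using i B wc Bij by (simp add: scalar_prod_def atLeast0LessThan)
  qed
  have unit: "(\<Sum>i<m. (vec_index w i)\<^sup>2) = 1" if "eigenvector ?B w e" "scalar_prod w w = 1" for w e
  proof -
    have "w \<in> carrier_vec m" using that B unfolding eigenvector_def by simp
    with that show ?thesis by (simp add: scalar_prod_def atLeast0LessThan power2_eq_square)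
  qed
  have sum_swap: "(\<Sum>i<m. \<Sum>j<m. ?b i j * w j) = 0" for w
  proof -
    have "(\<Sum>i<m. \<Sum>j<m. ?b i j * w j) = (\<Sum>j<m. (\<Sum>i<m. ?b j i) * w j)"
      by (subst sum.swap) (simp add: sum_distrib_right centered_gram_sym[of m d, OF sym])
    then show ?thesis by (simp add: sum_centered_gram[OF m0])
  qed
  have nonzero: "(\<Sum>i<m. vec_index w i) = 0 \<and> e > 0" if w: "eigenvector ?B w e" "scalar_prod w w = 1" and e: "e \<noteq> 0" for w e
  proof -
    have "e * (\<Sum>i<m. vec_index w i) = (\<Sum>i<m. \<Sum>j<m. ?b i j * vec_index w j)"
      by (simp add: sum_distrib_left ev_rows[OF w(1)])
    with e have s: "(\<Sum>i<m. vec_index w i) = 0" by (simp add: sum_swap)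
    have "(\<Sum>i<m. \<Sum>j<m. vec_index w i * vec_index w j * ?b i j) = (\<Sum>i<m. vec_index w i * (\<Sum>j<m. ?b i j * vec_index w j))"
      by (simp add: sum_distrib_left mult_ac)
    also have "\<dots> = (\<Sum>i<m. e * (vec_index w i)\<^sup>2)"
      by (intro sum.cong refl) (simp add: ev_rows[OF w(1)] power2_eq_square)
    also have "\<dots> = e" using unit[OF w] by (simp flip: sum_distrib_left)
    finally have "k - real m * \<eta> / 2 \<le> e" using pd[OF s] unit[OF w] by simp
    with small s show ?thesis by simp
  qed
  have zero: "\<exists>c. \<forall>i<m. vec_index w i = c" if w: "eigenvector ?B w 0" for w
  proof -
    define c where "c = (\<Sum>i<m. vec_index w i) / real m"
    define v where "v i = vec_index w i - c" for i
    have sv: "(\<Sum>i<m. v i) = 0" using m0 by (simp add: v_def c_def sum_subtractf)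
    have bv: "(\<Sum>j<m. ?b i j * v j) = 0" if "i < m" for i
    proof -
      have "(\<Sum>j<m. ?b i j * v j) = (\<Sum>j<m. ?b i j * vec_index w j) - (\<Sum>j<m. ?b i j) * c"
        by (simp add: v_def right_diff_distrib sum_subtractf sum_distrib_right)
      then show ?thesis by (simp add: ev_rows[OF w that] sum_centered_gram[OF m0])
    qed
    have "(\<Sum>i<m. \<Sum>j<m. v i * v j * ?b i j) = (\<Sum>i<m. v i * (\<Sum>j<m. ?b i j * v j))"
      by (simp add: sum_distrib_left mult_ac)
    then have "(k - real m * \<eta> / 2) * (\<Sum>i<m. (v i)\<^sup>2) \<le> 0" using pd[OF sv] bv by simp
    then have "(\<Sum>i<m. (v i)\<^sup>2) = 0" using small sum_nonneg[of "{..<m}" "\<lambda>i. (v i)\<^sup>2"]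
      by (simp add: mult_le_0_iff)
    then have "\<forall>i<m. v i = 0" by (simp add: sum_nonneg_eq_0_iff)
    then show ?thesis by (intro exI[of _ c]) (simp add: v_def)
  qed
  have len: "length es = m" by (rule symmetric_orthonormal_eigenvectors(1)[OF B symB es])
  obtain u' where ev': "\<And>k. k < m \<Longrightarrow> eigenvector ?B (u' k) (es ! k)"
    and on': "\<And>k l. k < m \<Longrightarrow> l < m \<Longrightarrow> scalar_prod (u' k) (u' l) = (if k = l then 1 else 0)"
    using symmetric_orthonormal_eigenvectors(2)[OF B symB es] by blast
  \<comment> \<open>Two eigenvalues that are not positive would both vanish, and two orthonormal vectors would both be constant. The count uses a full eigenbasis \<open>u'\<close>, because \<open>u\<close> covers only the first \<open>p\<close> eigenvalues.\<close>
  have pos: "es ! l > 0" if l: "l < ?p" for l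
  proof (rule ccontr)
    assume n: "\<not> es ! l > 0"
    have nn: "es ! i \<ge> 0" if "i < m" for i
      using nonzero[OF ev'[OF that]] on'[OF that that] by fastforce
    have "es ! ?p \<le> es ! l" using sorted l len m by (simp add: sorted_wrt_iff_nth_less)
    then have "es ! l = 0" "es ! ?p = 0" using n nn[of l] nn[of ?p] l m by auto
    then obtain c c' where c: "\<forall>i<m. vec_index (u' l) i = c" "\<forall>i<m. vec_index (u' ?p) i = c'"
      using zero[of "u' l"] zero[of "u' ?p"] ev'[of l] ev'[of ?p] l m by auto
    have u'c: "u' i \<in> carrier_vec m" if "i < m" for i using ev'[OF that] B unfolding eigenvector_def by simp
    have "scalar_prod (u' l) (u' l) = real m * (c * c)" "scalar_prod (u' ?p) (u' ?p) = real m * (c' * c')"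
      "scalar_prod (u' l) (u' ?p) = real m * (c * c')"
      using c u'c[of l] u'c[of ?p] l m by (simp_all add: scalar_prod_def)
    then show False using on'[of l l] on'[of ?p ?p] on'[of l ?p] l m by auto
  qed
  have uc: "u l \<in> carrier_vec m" if "l < ?p" for l using ev[OF that] B unfolding eigenvector_def by simp
  have us: "(\<Sum>i<m. vec_index (u l) i) = 0" if "l < ?p" for l
    using nonzero[OF ev[OF that]] on[OF that that] pos[OF that] by simp
  \<comment> \<open>The eigenvectors and the normalised constant vector form an orthogonal matrix; its rows are orthonormal too, which is the resolution of the identity.\<close>
  define U where "U = Matrix.mat m m (\<lambda>(i, l). if l < ?p then vec_index (u l) i else 1 / sqrt (real m))"
  have U: "U \<in> carrier_mat m m" by (simp add: U_def)
  have "transpose_mat U * U = 1\<^sub>m m"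
  proof (rule eq_matI)
    fix a b assume "a < dim_row (1\<^sub>m m :: real mat)" "b < dim_col (1\<^sub>m m :: real mat)"
    then have ab: "a < m" "b < m" by auto
    have e: "(transpose_mat U * U) $$ (a, b) = (\<Sum>i<m. U $$ (i, a) * U $$ (i, b))"
      using U ab by (simp add: scalar_prod_def atLeast0LessThan)
    consider "a < ?p" "b < ?p" | "a < ?p" "b = ?p" | "a = ?p" "b < ?p" | "a = ?p" "b = ?p"
      using ab m by linarith
    then have "(\<Sum>i<m. U $$ (i, a) * U $$ (i, b)) = (if a = b then 1 else 0)"
    proof cases
      case 1
      then have "(\<Sum>i<m. U $$ (i, a) * U $$ (i, b)) = scalar_prod (u a) (u b)"
        using ab uc[of b] by (simp add: U_def scalar_prod_def atLeast0LessThan)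
      then show ?thesis using on 1 by simp
    next
      case 2
      then show ?thesis using ab us[of a] by (simp add: U_def flip: sum_divide_distrib)
    next
      case 3
      then show ?thesis using ab us[of b] by (simp add: U_def flip: sum_divide_distrib)
    next
      case 4
      then show ?thesis using ab m0 by (simp add: U_def)
    qed
    then show "(transpose_mat U * U) $$ (a, b) = 1\<^sub>m m $$ (a, b)" using e ab by simp
  qed (use U in auto)
  then have UU: "U * transpose_mat U = 1\<^sub>m m"
    by (rule mat_mult_left_right_inverse[OF _ U, rotated]) (use U in simp)
  have res: "(\<Sum>l<?p. vec_index (u l) a * vec_index (u l) c) + 1 / real m = (if a = c then 1 else 0)"
    if "a < m" "c < m" for a c
  proof -
    have "(U * transpose_mat U) $$ (a, c) = (\<Sum>l<m. U $$ (a, l) * U $$ (c, l))"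
      using U that by (simp add: scalar_prod_def atLeast0LessThan)
    also have "\<dots> = (\<Sum>l<?p. U $$ (a, l) * U $$ (c, l)) + U $$ (a, ?p) * U $$ (c, ?p)"
      by (simp add: m)
    also have "\<dots> = (\<Sum>l<?p. vec_index (u l) a * vec_index (u l) c) + 1 / real m"
      using that m by (simp add: U_def)
    finally show ?thesis using UU that by simp
  qed
  have b: "?b a c = (\<Sum>l<?p. es ! l * (vec_index (u l) a * vec_index (u l) c))" if "a < m" "c < m" for a c
  proof -
    have "?b a c = (\<Sum>i<m. ?b a i * (if i = c then 1 else 0))"
      using that by (simp add: mult_delta_right)
    also have "\<dots> = (\<Sum>i<m. ?b a i * ((\<Sum>l<?p. vec_index (u l) i * vec_index (u l) c) + 1 / real m))"
      using that by (intro sum.cong refl) (simp add: res)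
    also have "\<dots> = (\<Sum>i<m. \<Sum>l<?p. ?b a i * vec_index (u l) i * vec_index (u l) c) + (\<Sum>i<m. ?b a i) / real m"
      by (simp add: distrib_left sum.distrib sum_distrib_left mult.assoc sum_divide_distrib)
    also have "(\<Sum>i<m. \<Sum>l<?p. ?b a i * vec_index (u l) i * vec_index (u l) c)
       = (\<Sum>l<?p. (\<Sum>i<m. ?b a i * vec_index (u l) i) * vec_index (u l) c)"
      unfolding sum_distrib_right by (rule sum.swap)
    also have "\<dots> = (\<Sum>l<?p. es ! l * (vec_index (u l) a * vec_index (u l) c))"
      using that by (intro sum.cong refl) (simp add: ev_rows[OF ev])
    finally show ?thesis by (simp add: sum_centered_gram[OF m0])
  qed
  have gram: "inner (y a) (y c) = ?b a c" if "a < m" "c < m" for a c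
  proof -
    let ?f = "\<lambda>l. (sqrt (max (es ! l) 0) * vec_index (u l) a) * (sqrt (max (es ! l) 0) * vec_index (u l) c)"
    have "inner (y a) (y c) = (\<Sum>l<?p. ?f l)"
      unfolding inner_vec_def y[OF that(1)] y[OF that(2)] Let_def
      using sum_to_nat_on_UNIV[of ?f, where 'p='p] by simp
    also have "\<dots> = (\<Sum>l<?p. es ! l * (vec_index (u l) a * vec_index (u l) c))"
    proof (intro sum.cong refl)
      fix l assume "l \<in> {..<?p}"
      then have "es ! l > 0" using pos by simp
      moreover have "?f l = (sqrt (max (es ! l) 0) * sqrt (max (es ! l) 0)) * (vec_index (u l) a * vec_index (u l) c)"
        by (simp only: mult_ac)
      ultimately show "?f l = es ! l * (vec_index (u l) a * vec_index (u l) c)"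
        by (simp del: mult.assoc)
    qed
    finally show ?thesis using b that by simp
  qed
  have "(norm (y i - y j))\<^sup>2 = inner (y i) (y i) + inner (y j) (y j) - 2 * inner (y i) (y j)"
    by (simp add: power2_norm_eq_inner inner_diff_left inner_diff_right inner_commute)
  also have "\<dots> = ?b i i + ?b j j - 2 * ?b i j"
    using ij by (simp only: gram)
  also have "\<dots> = (d i j)\<^sup>2" using ij d0 by (intro centered_gram_polarization) auto
  finally show ?thesis .
qed

section \<open>Classical lateration\<close>

text \<open>
  For full column rank the Moore-Penrose inverse is \<open>(Y\<^sup>T Y)\<^sup>-\<^sup>1 Y\<^sup>T\<close>. Any solution \<open>X'\<close>
  of the Penrose equations satisfies \<open>Y\<^sup>T Y X' = Y\<^sup>T\<close>, which makes it unique.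
\<close>

lemma full_column_rank_pseudo_inverse:
  fixes Y :: "real mat"
  assumes Y: "Y \<in> carrier_mat m p"
    and inj: "\<And>v. v \<in> carrier_vec p \<Longrightarrow> Y *\<^sub>v v = 0\<^sub>v m \<Longrightarrow> v = 0\<^sub>v p"
  shows "pseudo_inverse Y \<in> carrier_mat p m"
    "transpose_mat Y * Y * pseudo_inverse Y = transpose_mat Y"
proof -
  let ?T = "transpose_mat Y"
  let ?G = "?T * Y"
  have T: "?T \<in> carrier_mat p m" and G: "?G \<in> carrier_mat p p" using Y by auto
  have "det ?G \<noteq> 0"
  proof
    assume "det ?G = 0"
    then obtain v where v: "v \<in> carrier_vec p" "v \<noteq> 0\<^sub>v p" "?G *\<^sub>v v = 0\<^sub>v p"
      using det_0_iff_vec_prod_zero_field[OF G] by blast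
    have Yv: "Y *\<^sub>v v \<in> carrier_vec m" using Y v by auto
    have "scalar_prod (Y *\<^sub>v v) (Y *\<^sub>v v) = scalar_prod (?T *\<^sub>v (Y *\<^sub>v v)) v"
      using transpose_vec_mult_scalar[OF Y v(1) Yv] by simp
    also have "?T *\<^sub>v (Y *\<^sub>v v) = 0\<^sub>v p" using assoc_mult_mat_vec[OF T Y v(1)] v(3) by simp
    also have "scalar_prod (0\<^sub>v p) v = 0" using v(1) by simp
    finally have "(\<Sum>i<m. (vec_index (Y *\<^sub>v v) i)\<^sup>2) = 0"
      using Yv Y by (simp add: scalar_prod_def atLeast0LessThan power2_eq_square)
    then have "Y *\<^sub>v v = 0\<^sub>v m"
      using Y by (intro eq_vecI) (auto simp: sum_nonneg_eq_0_iff)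
    with inj v show False by blast
  qed
  from det_non_zero_imp_unit[OF G this, of "()"]
  obtain Gi where Gi: "Gi \<in> carrier_mat p p" "Gi * ?G = 1\<^sub>m p" "?G * Gi = 1\<^sub>m p"
    unfolding Units_def ring_mat_def by auto
  let ?P = "\<lambda>X. X \<in> carrier_mat (dim_col Y) (dim_row Y) \<and> Y * X * Y = Y \<and> X * Y * X = X \<and>
        transpose_mat (Y * X) = Y * X \<and> transpose_mat (X * Y) = X * Y"
  define X where "X = Gi * ?T"
  have X: "X \<in> carrier_mat p m" using Gi T by (simp add: X_def)
  have XY: "X * Y = 1\<^sub>m p"
    unfolding X_def using assoc_mult_mat[OF Gi(1) T Y] Gi(2) by simp
  have symG: "transpose_mat ?G = ?G"
    using transpose_mult[OF T Y] by simp
  have symGi: "transpose_mat Gi = Gi"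
  proof -
    have TGi: "transpose_mat Gi \<in> carrier_mat p p" using Gi by simp
    have "transpose_mat Gi * ?G = transpose_mat (?G * Gi)"
      using transpose_mult[OF G Gi(1)] symG by simp
    then have l: "transpose_mat Gi * ?G = 1\<^sub>m p" using Gi(3) by simp
    have "transpose_mat Gi = transpose_mat Gi * (?G * Gi)" unfolding Gi(3) using TGi by simp
    also have "\<dots> = Gi" using assoc_mult_mat[OF TGi G Gi(1)] l Gi(1) by simp
    finally show ?thesis .
  qed
  have YXdef: "Y * X = Y * Gi * ?T" unfolding X_def by (rule assoc_mult_mat[OF Y Gi(1) T, symmetric])
  have "transpose_mat (Y * X) = Y * X"
  proof -
    have YGi: "Y * Gi \<in> carrier_mat m p" using Y Gi by simp
    have "transpose_mat (Y * X) = Y * transpose_mat (Y * Gi)"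
      unfolding YXdef using transpose_mult[OF YGi T] by simp
    also have "transpose_mat (Y * Gi) = Gi * ?T" using transpose_mult[OF Y Gi(1)] symGi by simp
    finally show ?thesis by (simp add: X_def)
  qed
  moreover have "Y * X * Y = Y" using assoc_mult_mat[OF Y X Y] XY Y by simp
  moreover have "X * Y * X = X" unfolding XY using X by simp
  ultimately have PX: "?P X" using X XY Y by auto
  have uniq: "X' = X" if P: "?P X'" for X'
  proof -
    have X': "X' \<in> carrier_mat p m" using P Y by auto
    have YX': "Y * X' \<in> carrier_mat m m" using Y X' by simp
    have "?T * (Y * X') = ?T * transpose_mat (Y * X')" using P by simp
    also have "\<dots> = transpose_mat (Y * X' * Y)" using transpose_mult[OF YX' Y] by simp
    also have "\<dots> = ?T" using P by simp
    finally have "?G * X' = ?T" using assoc_mult_mat[OF T Y X'] by simp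
    then have "Gi * (?G * X') = X" by (simp add: X_def)
    then show ?thesis using assoc_mult_mat[OF Gi(1) G X'] Gi(2) X' by simp
  qed
  have "pseudo_inverse Y = X" unfolding pseudo_inverse_def
    by (rule the_equality) (rule PX, rule uniq)
  moreover have "?G * X = ?T"
    unfolding X_def using assoc_mult_mat[OF G Gi(1) T] Gi(3) T by simp
  ultimately show "pseudo_inverse Y \<in> carrier_mat p m" "?G * pseudo_inverse Y = ?T" using X by auto
qed

lemma mean_square_distance:
  fixes y :: "'i \<Rightarrow> 'a::real_inner"
  assumes W: "finite W" "W \<noteq> {}"
  shows "(1 / real (card W)) * (\<Sum>j\<in>W. (norm (b - y j))\<^sup>2)
     = (norm (b - centroid W y))\<^sup>2 + (1 / real (card W)) * (\<Sum>j\<in>W. (norm (y j - centroid W y))\<^sup>2)"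
proof -
  let ?c = "centroid W y"
  have "(\<Sum>j\<in>W. (norm (b - y j))\<^sup>2)
     = (\<Sum>j\<in>W. (norm (b - ?c))\<^sup>2 - 2 * inner (b - ?c) (y j - ?c) + (norm (y j - ?c))\<^sup>2)"
    by (intro sum.cong refl) (simp add: power2_norm_eq_inner inner_diff_left inner_diff_right inner_commute algebra_simps)
  also have "\<dots> = (\<Sum>j\<in>W. (norm (b - ?c))\<^sup>2) - 2 * inner (b - ?c) (\<Sum>j\<in>W. y j - ?c)
     + (\<Sum>j\<in>W. (norm (y j - ?c))\<^sup>2)"
    unfolding inner_sum_right by (simp only: sum.distrib sum_subtractf sum_distrib_left)
  also have "\<dots> = real (card W) * (norm (b - ?c))\<^sup>2 + (\<Sum>j\<in>W. (norm (y j - ?c))\<^sup>2)"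
    unfolding sum_diff_centroid[OF W] by simp
  finally show ?thesis using W by (simp add: distrib_left)
qed

text \<open>
  The pseudo-inverse solves the least squares problem for the linearised distance equations. Since
  the centred landmarks sum to zero, the terms that do not depend on \<open>i\<close> drop out, and the normal
  equation takes a form that mentions only the squared distances to the output and is therefore
  invariant under rigid transformations.
\<close>

proposition classical_lateration_normal_equation:
  fixes ys :: "(real ^ 'p) list"
  assumes m: "length ys = m" "length ds = m" "m > 0"
    and spread: "well_spread k {..<m} ((!) ys)" and k: "k > 0"
  shows "(\<Sum>i<m. ((norm (classical_lateration ys ds - ys ! i))\<^sup>2 - (ds ! i)\<^sup>2)
            *\<^sub>R (ys ! i - centroid {..<m} ((!) ys))) = 0"
proof -
  let ?p = "CARD('p)"
  let ?tn = "to_nat_on (UNIV :: 'p set)" and ?fn = "from_nat_into (UNIV :: 'p set)"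
  define c where "c = centroid {..<m} ((!) ys)"
  have W: "finite {..<m}" "{..<m} \<noteq> {}" using m by auto
  have ybar: "(1 / real m) *\<^sub>R (\<Sum>i<m. ys ! i) = c" by (simp add: c_def centroid_def)
  define Y where "Y = Matrix.mat m ?p (\<lambda>(i, l). vec_nth (ys ! i - c) (?fn l))"
  have Y: "Y \<in> carrier_mat m ?p" by (simp add: Y_def)
  define ab where "ab i = (1 / real m) * (\<Sum>j<m. (norm (ys ! i - ys ! j))\<^sup>2)" for i
  define b where "b = Matrix.vec m ab - Matrix.vec m (\<lambda>i. (ds ! i)\<^sup>2)"
  have b: "b \<in> carrier_vec m" by (simp add: b_def)
  define w where "w = pseudo_inverse Y *\<^sub>v b"
  define z :: "real ^ 'p" where "z = (\<chi> a. vec_index w (?tn a))"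
  have out: "classical_lateration ys ds = c + (1 / 2) *\<^sub>R z"
    unfolding classical_lateration_def Let_def m(1) ybar z_def w_def b_def Y_def ab_def ..
  have Yrow: "inner (ys ! i - c) (\<chi> a. vec_index v (?tn a)) = vec_index (Y *\<^sub>v v) i"
    if i: "i < m" and v: "v \<in> carrier_vec ?p" for i v
  proof -
    have "inner (ys ! i - c) (\<chi> a. vec_index v (?tn a)) = (\<Sum>a\<in>UNIV. Y $$ (i, ?tn a) * vec_index v (?tn a))"
      using i by (simp add: inner_vec_def Y_def to_nat_on_UNIV_less from_nat_into_to_nat_on_UNIV)
    also have "\<dots> = (\<Sum>l<?p. Y $$ (i, l) * vec_index v l)"
      by (rule sum_to_nat_on_UNIV[of "\<lambda>l. Y $$ (i, l) * vec_index v l", where 'p='p])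
    also have "\<dots> = vec_index (Y *\<^sub>v v) i"
      using i Y v by (simp add: scalar_prod_def atLeast0LessThan)
    finally show ?thesis .
  qed
  have inj: "v = 0\<^sub>v ?p" if v: "v \<in> carrier_vec ?p" and Yv: "Y *\<^sub>v v = 0\<^sub>v m" for v
  proof -
    let ?z = "(\<chi> a. vec_index v (?tn a)) :: real ^ 'p"
    have "(\<Sum>i<m. (inner (ys ! i - c) ?z)\<^sup>2) = 0" using Yv by (simp add: Yrow[OF _ v])
    then have "k * (norm ?z)\<^sup>2 \<le> 0" using spread unfolding well_spread_def c_def by metis
    then have z0: "?z = 0" using k by (simp add: mult_le_0_iff)
    show ?thesis
    proof (rule eq_vecI)
      fix l assume "l < dim_vec (0\<^sub>v ?p :: real vec)"
      then have "l \<in> {..<?p}" by simp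
      then have "l \<in> range ?tn" using bij_betw_to_nat_on_UNIV[where 'p='p] unfolding bij_betw_def by simp
      then obtain a where "?tn a = l" by (metis imageE)
      moreover have "vec_nth ?z a = 0" unfolding z0 by simp
      ultimately show "vec_index v l = vec_index (0\<^sub>v ?p) l" using \<open>l \<in> {..<?p}\<close> by simp
    qed (use v in simp)
  qed
  have pinv: "pseudo_inverse Y \<in> carrier_mat ?p m"
    "transpose_mat Y * Y * pseudo_inverse Y = transpose_mat Y"
    by (rule full_column_rank_pseudo_inverse[OF Y], rule inj, assumption+)+
  have T: "transpose_mat Y \<in> carrier_mat ?p m" using Y by simp
  have wc: "w \<in> carrier_vec ?p" using pinv(1) b by (simp add: w_def)
  have "transpose_mat Y *\<^sub>v (Y *\<^sub>v w) = (transpose_mat Y * Y) *\<^sub>v w"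
    by (rule assoc_mult_mat_vec[OF T Y wc, symmetric])
  also have "\<dots> = (transpose_mat Y * Y * pseudo_inverse Y) *\<^sub>v b"
    unfolding w_def by (rule assoc_mult_mat_vec[symmetric]) (use pinv(1) T Y b in auto)
  finally have ne: "transpose_mat Y *\<^sub>v (Y *\<^sub>v w) = transpose_mat Y *\<^sub>v b" unfolding pinv(2) .
  have comp: "vec_index (transpose_mat Y *\<^sub>v v) (?tn a) = vec_nth (\<Sum>i<m. vec_index v i *\<^sub>R (ys ! i - c)) a"
    if v: "v \<in> carrier_vec m" for v a
  proof -
    have "vec_index (transpose_mat Y *\<^sub>v v) (?tn a) = (\<Sum>i<m. Y $$ (i, ?tn a) * vec_index v i)"
      using Y v by (simp add: scalar_prod_def atLeast0LessThan to_nat_on_UNIV_less)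
    also have "\<dots> = (\<Sum>i<m. vec_index v i * vec_nth (ys ! i - c) a)"
      by (intro sum.cong refl) (simp add: Y_def to_nat_on_UNIV_less from_nat_into_to_nat_on_UNIV mult.commute)
    finally show ?thesis by simp
  qed
  have Yw: "Y *\<^sub>v w \<in> carrier_vec m" using Y wc by simp
  have eq: "(\<Sum>i<m. vec_index (Y *\<^sub>v w) i *\<^sub>R (ys ! i - c)) = (\<Sum>i<m. vec_index b i *\<^sub>R (ys ! i - c))"
    unfolding Finite_Cartesian_Product.vec_eq_iff comp[OF Yw, symmetric] comp[OF b, symmetric] ne by simp
  have eq': "(\<Sum>i<m. (vec_index b i - inner (ys ! i - c) z) *\<^sub>R (ys ! i - c)) = 0"
    using eq by (simp add: scaleR_diff_left sum_subtractf z_def Yrow[OF _ wc])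
  define S where "S = (1 / real m) * (\<Sum>j<m. (norm (ys ! j - c))\<^sup>2)"
  have ab: "ab i = (norm (ys ! i - c))\<^sup>2 + S" for i
    using mean_square_distance[OF W, of "ys ! i" "(!) ys"] by (simp add: ab_def S_def c_def)
  have "(norm (classical_lateration ys ds - ys ! i))\<^sup>2 - (ds ! i)\<^sup>2
     = ((norm ((1 / 2) *\<^sub>R z))\<^sup>2 - S) + (vec_index b i - inner (ys ! i - c) z)" if "i < m" for i
  proof -
    have "(norm (classical_lateration ys ds - ys ! i))\<^sup>2 = (norm ((1 / 2) *\<^sub>R z - (ys ! i - c)))\<^sup>2"
      by (simp add: out algebra_simps)
    also have "\<dots> = (norm ((1 / 2) *\<^sub>R z))\<^sup>2 - inner (ys ! i - c) z + (norm (ys ! i - c))\<^sup>2"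
      unfolding power2_norm_eq_inner by (simp add: inner_diff_left inner_diff_right inner_commute)
    finally show ?thesis using that by (simp add: b_def ab)
  qed
  then have "(\<Sum>i<m. ((norm (classical_lateration ys ds - ys ! i))\<^sup>2 - (ds ! i)\<^sup>2) *\<^sub>R (ys ! i - c))
     = (\<Sum>i<m. ((norm ((1 / 2) *\<^sub>R z))\<^sup>2 - S) *\<^sub>R (ys ! i - c)
           + (vec_index b i - inner (ys ! i - c) z) *\<^sub>R (ys ! i - c))"
    by (intro sum.cong refl) (simp add: scaleR_add_left)
  also have "\<dots> = ((norm ((1 / 2) *\<^sub>R z))\<^sup>2 - S) *\<^sub>R (\<Sum>i<m. ys ! i - c)"
    unfolding sum.distrib eq' by (simp only: scaleR_sum_right add_0_right)
  also have "\<dots> = 0" unfolding c_def sum_diff_centroid[OF W] by simp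
  finally show ?thesis unfolding c_def .
qed

text \<open>
  The difference \<open>|z - y\<^sub>i|\<^sup>2 - |q - y\<^sub>i|\<^sup>2\<close> is affine in \<open>y\<^sub>i\<close> with slope
  \<open>-2 (z - q)\<close>. Subtracting the residual of an arbitrary point \<open>q\<close> thus turns the normal
  equation into a linear equation for \<open>z - q\<close> whose matrix is twice the scatter matrix.
\<close>

lemma normal_equation_error:
  fixes y :: "'i \<Rightarrow> 'a::real_inner"
  assumes W: "finite W" "W \<noteq> {}" and spread: "well_spread k W y"
    and ne: "(\<Sum>i\<in>W. ((norm (z - y i))\<^sup>2 - a i) *\<^sub>R (y i - centroid W y)) = 0"
  shows "2 * k * norm (z - q) \<le> (\<Sum>i\<in>W. \<bar>(norm (q - y i))\<^sup>2 - a i\<bar> * norm (y i - centroid W y))"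
proof (cases "z = q")
  case True
  then show ?thesis by (simp add: sum_nonneg)
next
  case False
  let ?c = "centroid W y"
  let ?u = "z - q"
  let ?r = "\<lambda>i. inner (y i - ?c) ?u"
  let ?K = "(norm (z - ?c))\<^sup>2 - (norm (q - ?c))\<^sup>2"
  have expand: "(norm (z - y i))\<^sup>2 - a i = ?K - 2 * ?r i + ((norm (q - y i))\<^sup>2 - a i)" for i
    by (simp add: power2_norm_eq_inner inner_diff_left inner_diff_right inner_commute algebra_simps)
  have "0 = (\<Sum>i\<in>W. ((norm (z - y i))\<^sup>2 - a i) * ?r i)"
    using arg_cong[OF ne, of "\<lambda>v. inner v ?u"] by (simp add: inner_sum_left)
  also have "\<dots> = (\<Sum>i\<in>W. (?K - 2 * ?r i + ((norm (q - y i))\<^sup>2 - a i)) * ?r i)"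
    unfolding expand ..
  also have "\<dots> = ?K * (\<Sum>i\<in>W. ?r i) - 2 * (\<Sum>i\<in>W. (?r i)\<^sup>2) + (\<Sum>i\<in>W. ((norm (q - y i))\<^sup>2 - a i) * ?r i)"
    by (simp only: distrib_right left_diff_distrib sum.distrib sum_subtractf sum_distrib_left power2_eq_square mult.assoc)
  also have "(\<Sum>i\<in>W. ?r i) = 0"
    unfolding inner_sum_left[symmetric] sum_diff_centroid[OF W] by simp
  finally have "2 * (\<Sum>i\<in>W. (?r i)\<^sup>2) = (\<Sum>i\<in>W. ((norm (q - y i))\<^sup>2 - a i) * ?r i)" by simp
  moreover have "k * (norm ?u)\<^sup>2 \<le> (\<Sum>i\<in>W. (?r i)\<^sup>2)" using spread unfolding well_spread_def by blast
  ultimately have "2 * k * norm ?u * norm ?u \<le> (\<Sum>i\<in>W. ((norm (q - y i))\<^sup>2 - a i) * ?r i)"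
    by (simp add: power2_eq_square)
  also have "\<dots> \<le> (\<Sum>i\<in>W. \<bar>(norm (q - y i))\<^sup>2 - a i\<bar> * norm (y i - ?c) * norm ?u)"
  proof (rule sum_mono)
    fix i
    have "((norm (q - y i))\<^sup>2 - a i) * ?r i \<le> \<bar>(norm (q - y i))\<^sup>2 - a i\<bar> * \<bar>?r i\<bar>"
      by (metis abs_ge_self abs_mult)
    also have "\<dots> \<le> \<bar>(norm (q - y i))\<^sup>2 - a i\<bar> * (norm (y i - ?c) * norm ?u)"
      by (intro mult_left_mono Cauchy_Schwarz_ineq2) simp
    finally show "((norm (q - y i))\<^sup>2 - a i) * ?r i \<le> \<bar>(norm (q - y i))\<^sup>2 - a i\<bar> * norm (y i - ?c) * norm ?u"
      by (simp add: mult.assoc)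
  qed
  also have "\<dots> = (\<Sum>i\<in>W. \<bar>(norm (q - y i))\<^sup>2 - a i\<bar> * norm (y i - ?c)) * norm ?u"
    by (simp add: sum_distrib_right)
  finally show ?thesis using False by simp
qed

lemma centroid_reindex: "bij_betw h A B \<Longrightarrow> centroid A (\<lambda>i. x (h i)) = centroid B x"
  by (simp add: centroid_def bij_betw_same_card sum.reindex_bij_betw)

lemma well_spread_reindex:
  assumes h: "bij_betw h A B"
  shows "well_spread k A (\<lambda>i. x (h i)) \<longleftrightarrow> well_spread k B x"
proof -
  have "(\<Sum>i\<in>A. (inner (x (h i) - centroid B x) z)\<^sup>2) = (\<Sum>i\<in>B. (inner (x i - centroid B x) z)\<^sup>2)" for z
    by (rule sum.reindex_bij_betw[OF h])
  then show ?thesis unfolding well_spread_def centroid_reindex[OF h] by simp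
qed

text \<open>
  Here \<open>q\<close> is the true position of the new node and \<open>x\<close> the true landmarks. Replacing \<open>x\<close>
  by the computed landmarks \<open>y\<close> costs a factor 4 in the spread and changes the squared
  distances to \<open>q\<close> by at most \<open>\<delta> (2 D + 1)\<close>.
\<close>

proposition classical_lateration_error:
  fixes x y :: "'i \<Rightarrow> real ^ 'p"
  assumes ws: "distinct ws" "ws \<noteq> []" and x: "well_spread k (set ws) x" and k: "k > 0"
    and close: "\<And>i. i \<in> set ws \<Longrightarrow> norm (y i - x i) \<le> \<delta>"
    and small: "16 * real (length ws) * \<delta>\<^sup>2 \<le> k" "\<delta> \<le> 1"
    and D: "\<And>i j. i \<in> set ws \<Longrightarrow> j \<in> set ws \<Longrightarrow> norm (x i - x j) \<le> D"
      "\<And>i. i \<in> set ws \<Longrightarrow> norm (q - x i) \<le> D"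
    and a: "\<And>i. i \<in> set ws \<Longrightarrow> \<bar>(d i)\<^sup>2 - (norm (q - x i))\<^sup>2\<bar> \<le> \<eta>"
  shows "norm (classical_lateration (map y ws) (map d ws) - q)
     \<le> 2 * real (length ws) * (\<delta> * (2 * D + 1) + \<eta>) * (D + 2) / k"
proof -
  let ?m = "length ws" and ?W = "set ws"
  define z where "z = classical_lateration (map y ws) (map d ws)"
  have W: "finite ?W" "?W \<noteq> {}" and card: "card ?W = ?m" using ws by (auto simp: distinct_card)
  have bij: "bij_betw ((!) ws) {..<?m} ?W" using ws(1) by (rule bij_betw_nth) auto
  obtain i0 where i0: "i0 \<in> ?W" using ws(2) hd_in_set by blast
  have \<delta>0: "0 \<le> \<delta>" using close[OF i0] norm_ge_zero order_trans by blast
  have D0: "0 \<le> D" using D(2)[OF i0] norm_ge_zero order_trans by blast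
  have spread: "well_spread (k / 4) ?W y"
    by (rule well_spread_perturb[OF W x close]) (use small(1) card in auto)
  have nth: "well_spread (k / 4) {..<?m} ((!) (map y ws)) \<longleftrightarrow> well_spread (k / 4) {..<?m} (\<lambda>i. y (ws ! i))"
    "centroid {..<?m} ((!) (map y ws)) = centroid {..<?m} (\<lambda>i. y (ws ! i))"
    by (simp_all add: well_spread_def centroid_def)
  have "(\<Sum>i<?m. ((norm (z - map y ws ! i))\<^sup>2 - (map d ws ! i)\<^sup>2)
            *\<^sub>R (map y ws ! i - centroid {..<?m} ((!) (map y ws)))) = 0"
    unfolding z_def
    by (rule classical_lateration_normal_equation[of _ _ _ "k / 4"])
       (use ws k spread nth well_spread_reindex[OF bij] in auto)
  then have "(\<Sum>i<?m. ((norm (z - y (ws ! i)))\<^sup>2 - (d (ws ! i))\<^sup>2) *\<^sub>R (y (ws ! i) - centroid ?W y)) = 0"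
    unfolding nth centroid_reindex[OF bij] by simp
  then have ne: "(\<Sum>i\<in>?W. ((norm (z - y i))\<^sup>2 - (d i)\<^sup>2) *\<^sub>R (y i - centroid ?W y)) = 0"
    using sum.reindex_bij_betw[OF bij, of "\<lambda>i. ((norm (z - y i))\<^sup>2 - (d i)\<^sup>2) *\<^sub>R (y i - centroid ?W y)"] by simp
  have "2 * (k / 4) * norm (z - q) \<le> (\<Sum>i\<in>?W. \<bar>(norm (q - y i))\<^sup>2 - (d i)\<^sup>2\<bar> * norm (y i - centroid ?W y))"
    by (rule normal_equation_error[OF W spread ne])
  also have "\<dots> \<le> (\<Sum>i\<in>?W. (\<delta> * (2 * D + 1) + \<eta>) * (D + 2))"
  proof (intro sum_mono mult_mono)
    fix i assume i: "i \<in> ?W"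
    have "norm (q - y i) \<le> norm (q - x i) + \<delta>" "norm (q - x i) \<le> norm (q - y i) + \<delta>"
      using norm_triangle_ineq[of "q - x i" "x i - y i"] norm_triangle_ineq[of "q - y i" "y i - x i"]
        close[OF i] by (simp_all add: norm_minus_commute)
    then have "\<bar>norm (q - y i) - norm (q - x i)\<bar> \<le> \<delta>" "norm (q - y i) + norm (q - x i) \<le> 2 * D + 1"
      using D(2)[OF i] small(2) by auto
    then have "\<bar>norm (q - y i) - norm (q - x i)\<bar> * \<bar>norm (q - y i) + norm (q - x i)\<bar> \<le> \<delta> * (2 * D + 1)"
      using \<delta>0 by (intro mult_mono) auto
    then have "\<bar>(norm (q - y i))\<^sup>2 - (norm (q - x i))\<^sup>2\<bar> \<le> \<delta> * (2 * D + 1)"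
      by (simp add: power2_eq_square square_diff_square_factored abs_mult mult.commute)
    then show "\<bar>(norm (q - y i))\<^sup>2 - (d i)\<^sup>2\<bar> \<le> \<delta> * (2 * D + 1) + \<eta>" using a[OF i] by linarith
    show "norm (y i - centroid ?W y) \<le> D + 2"
    proof (rule norm_diff_centroid_le[OF W])
      fix j assume j: "j \<in> ?W"
      have eq: "((y i - x i) + (x i - x j)) - (y j - x j) = y i - y j" by simp
      have "norm (y i - y j) \<le> norm (y i - x i) + norm (x i - x j) + norm (y j - x j)"
        using norm_triangle_ineq4[of "(y i - x i) + (x i - x j)" "y j - x j"]
          norm_triangle_ineq[of "y i - x i" "x i - x j"] unfolding eq by linarith
      then show "norm (y i - y j) \<le> D + 2" using close[OF i] close[OF j] D(1)[OF i j] small(2) by linarith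
    qed
    show "0 \<le> \<delta> * (2 * D + 1) + \<eta>"
      using \<delta>0 D0 a[OF i] by (intro add_nonneg_nonneg mult_nonneg_nonneg) auto
  qed simp
  also have "\<dots> = real ?m * ((\<delta> * (2 * D + 1) + \<eta>) * (D + 2))" by (simp add: card)
  finally show ?thesis using k unfolding z_def[symmetric] by (simp add: field_simps)
qed

section \<open>Error propagation along a run\<close>

text \<open>
  The class of configurations over which the estimates are uniform. Both bounds are invariant under
  rigid transformations and survive small perturbations.
\<close>

definition nondegenerate :: "nat \<Rightarrow> real \<Rightarrow> real \<Rightarrow> (nat \<Rightarrow> real ^ 'p) \<Rightarrow> bool" where
  "nondegenerate n D k x \<longleftrightarrow> general_position n x \<and>
     (\<forall>i\<in>{1..n}. \<forall>j\<in>{1..n}. norm (x i - x j) \<le> D) \<and>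
     (\<forall>W\<subseteq>{1..n}. CARD('p) + 1 \<le> card W \<longrightarrow> well_spread k W x)"

definition data_close :: "(nat \<times> nat) set \<Rightarrow> (nat \<Rightarrow> real ^ 'p) \<Rightarrow> (nat \<Rightarrow> nat \<Rightarrow> real) \<Rightarrow> real \<Rightarrow> bool" where
  "data_close E x d \<eta> \<longleftrightarrow> 0 \<le> \<eta> \<and>
     (\<forall>(i, j)\<in>E. d i j = d j i \<and> \<bar>(d i j)\<^sup>2 - (norm (x i - x j))\<^sup>2\<bar> \<le> \<eta>)"

definition start_clique :: "nat \<Rightarrow> nat \<Rightarrow> (nat \<times> nat) set \<Rightarrow> nat list \<Rightarrow> bool" where
  "start_clique p n E c \<longleftrightarrow> length c = p + 1 \<and> set c \<subseteq> {1..n} \<and> clique_list E c"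

text \<open>
  The conclusion of the error analysis for the configurations in \<open>X\<close>: data with error \<open>\<eta>\<close> below the
  threshold \<open>\<delta>\<close> lead, on all runs that have embedded at most \<open>N\<close> nodes, to positions within
  \<open>C \<eta>\<close> of a congruent copy of the configuration.
\<close>

definition runs_within ::
  "nat \<Rightarrow> (nat \<times> nat) set \<Rightarrow> (nat \<Rightarrow> real ^ 'p) set \<Rightarrow> nat \<Rightarrow> real \<Rightarrow> real \<Rightarrow> bool" where
  "runs_within n E X N \<delta> C \<longleftrightarrow>
     (\<forall>x\<in>X. \<forall>d \<eta> c S y.
        data_close E x d \<eta> \<and> \<eta> \<le> \<delta> \<and> start_clique CARD('p) n E c \<and>
        lateration_run n E d c S y \<and> card S \<le> N \<longrightarrow>
        (\<exists>g. rigid_transformation g \<and> (\<forall>i\<in>S. norm (y i - g (x i)) \<le> C * \<eta>)))"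

lemma runs_withinD:
  fixes x :: "nat \<Rightarrow> real ^ 'p"
  assumes "runs_within n E X N \<delta> C" "x \<in> X" "data_close E x d \<eta>" "\<eta> \<le> \<delta>"
    "start_clique CARD('p) n E c" "lateration_run n E d c S y" "card S \<le> N"
  obtains g where "rigid_transformation g" "\<forall>i\<in>S. norm (y i - g (x i)) \<le> C * \<eta>"
proof -
  have "\<exists>g. rigid_transformation g \<and> (\<forall>i\<in>S. norm (y i - g (x i)) \<le> C * \<eta>)"
    using assms(2-7)
    by (intro assms(1)[unfolded runs_within_def, rule_format, of x d \<eta> c S y] conjI)
  then show ?thesis using that by blast
qed

lemma start_clique_distinct: "simple_graph n E \<Longrightarrow> start_clique p n E c \<Longrightarrow> distinct c"
  unfolding start_clique_def simple_graph_def clique_list_def distinct_conv_nth irrefl_def by metis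

lemma run_nodes:
  assumes "lateration_run n E d c S y" "set c \<subseteq> {1..n}"
  shows "set c \<subseteq> S \<and> S \<subseteq> {1..n}"
  using assms by (induction rule: lateration_run.induct) auto

lemma start_error:
  fixes x y :: "nat \<Rightarrow> real ^ 'p"
  assumes E: "simple_graph n E" and c: "start_clique CARD('p) n E c"
    and x: "nondegenerate n D k x" and k: "k > 0" and d: "data_close E x d \<eta>"
    and small: "real (CARD('p) + 1) * \<eta> / (2 * k) < 1"
    and cs: "classical_scaling (length c) (\<lambda>i j. if i = j then 0 else d (c ! i) (c ! j)) (\<lambda>i. y (c ! i))"
  shows "\<exists>g. rigid_transformation g \<and>
    (\<forall>i\<in>set c. norm (y i - g (x i)) \<le> real CARD('p) * (real (CARD('p) + 1) * \<eta> / (2 * k)) * D)"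
proof -
  let ?m = "length c"
  have dist: "distinct c" by (rule start_clique_distinct[OF E c])
  have m: "?m = CARD('p) + 1" and sub: "set c \<subseteq> {1..n}" and cl: "clique_list E c"
    using c by (auto simp: start_clique_def)
  have card: "card (set c) = CARD('p) + 1" using dist m by (simp add: distinct_card)
  have span: "affine hull (x ` set c) = UNIV" and spread: "well_spread k (set c) x"
    and D: "\<And>i j. i \<in> set c \<Longrightarrow> j \<in> set c \<Longrightarrow> norm (x i - x j) \<le> D"
    using x sub card unfolding nondegenerate_def general_position_def by (blast, simp, blast)
  have bij: "bij_betw ((!) c) {..<?m} (set c)" using dist by (rule bij_betw_nth) auto
  have inE: "(c ! i, c ! j) \<in> E" if "i < ?m" "j < ?m" "i \<noteq> j" for i j
    using cl that unfolding clique_list_def by blast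
  have dd: "d (c ! i) (c ! j) = d (c ! j) (c ! i)"
    "\<bar>(d (c ! i) (c ! j))\<^sup>2 - (norm (x (c ! i) - x (c ! j)))\<^sup>2\<bar> \<le> \<eta>" if "i < ?m" "j < ?m" "i \<noteq> j" for i j
    using d inE[OF that] unfolding data_close_def by auto
  have \<eta>0: "0 \<le> \<eta>" using d by (simp add: data_close_def)
  have im: "(\<lambda>i. x (c ! i)) ` {..<?m} = x ` set c"
    using bij unfolding bij_betw_def by (metis image_image)
  have exact: "(norm (y (c ! i) - y (c ! j)))\<^sup>2 = (if i = j then 0 else d (c ! i) (c ! j))\<^sup>2"
    if "i < ?m" "j < ?m" for i j
  proof (rule classical_scaling_exact[OF cs m, where x = "\<lambda>i. x (c ! i)" and k = k and \<eta> = \<eta>])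
    show "affine hull ((\<lambda>i. x (c ! i)) ` {..<?m}) = UNIV" unfolding im by (rule span)
    show "well_spread k {..<?m} (\<lambda>i. x (c ! i))" unfolding well_spread_reindex[OF bij] by (rule spread)
    show "real ?m * \<eta> / 2 < k" using small k m by (simp add: field_simps)
  qed (use dd \<eta>0 k that in auto)
  have close: "\<bar>(norm (y a - y b))\<^sup>2 - (norm (x a - x b))\<^sup>2\<bar> \<le> \<eta>" if ab: "a \<in> set c" "b \<in> set c" for a b
  proof -
    obtain i where i: "i < ?m" "a = c ! i" using ab(1) by (auto simp: in_set_conv_nth)
    obtain j where j: "j < ?m" "b = c ! j" using ab(2) by (auto simp: in_set_conv_nth)
    show ?thesis using exact[of i j] dd(2)[of i j] i j \<eta>0 by (cases "i = j") auto
  qed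
  show ?thesis
  proof (rule simplex_procrustes[OF finite_set card span spread k _ _ small])
    fix g :: "real ^ 'p \<Rightarrow> real ^ 'p"
    assume "rigid_transformation g"
      "\<And>i. i \<in> set c \<Longrightarrow> norm (y i - g (x i)) \<le> real CARD('p) * (real (CARD('p) + 1) * \<eta> / (2 * k)) * D"
    then show ?thesis by blast
  qed (fact D, fact close)
qed

lemma step_error:
  fixes x y :: "nat \<Rightarrow> real ^ 'p"
  assumes E: "simple_graph n E" and x: "nondegenerate n D k x" and k: "k > 0" and D: "0 \<le> D"
    and d: "data_close E x d \<eta>" and g: "rigid_transformation g"
    and S: "S \<subseteq> {1..n}" and close: "\<And>i. i \<in> S \<Longrightarrow> norm (y i - g (x i)) \<le> \<delta>"
    and small: "16 * real n * \<delta>\<^sup>2 \<le> k" "\<delta> \<le> 1" "0 \<le> \<delta>"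
    and v: "v \<in> {1..n}" and ws: "distinct ws" "set ws \<subseteq> {w \<in> S. (v, w) \<in> E}" "CARD('p) + 1 \<le> length ws"
  shows "norm (classical_lateration (map y ws) (map (d v) ws) - g (x v))
    \<le> 2 * real n * (\<delta> * (2 * D + 1) + \<eta>) * (D + 2) / k"
proof -
  have sub: "set ws \<subseteq> {1..n}" using ws S by auto
  have card: "card (set ws) = length ws" using ws(1) by (rule distinct_card)
  have len: "length ws \<le> n" using card_mono[OF _ sub] card by simp
  have ne: "ws \<noteq> []" "set ws \<noteq> {}" using ws(3) by auto
  have \<eta>0: "0 \<le> \<eta>" using d by (simp add: data_close_def)
  have Db: "norm (x i - x j) \<le> D" if "i \<in> {1..n}" "j \<in> {1..n}" for i j
    using x that unfolding nondegenerate_def by blast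
  have wx: "well_spread k (set ws) x" using x sub ws(3) card unfolding nondegenerate_def by simp
  have spread: "well_spread k (set ws) (\<lambda>i. g (x i))"
    by (rule well_spread_rigid[OF finite_set ne(2) g wx])
  have "norm (classical_lateration (map y ws) (map (d v) ws) - g (x v))
      \<le> 2 * real (length ws) * (\<delta> * (2 * D + 1) + \<eta>) * (D + 2) / k"
  proof (rule classical_lateration_error[OF ws(1) ne(1) spread k])
    show "norm (y i - g (x i)) \<le> \<delta>" if "i \<in> set ws" for i using close ws(2) that by blast
    show "16 * real (length ws) * \<delta>\<^sup>2 \<le> k"
      using small(1) mult_right_mono[of "16 * real (length ws)" "16 * real n" "\<delta>\<^sup>2"] len by simp
    show "\<delta> \<le> 1" by fact
    show "norm (g (x i) - g (x j)) \<le> D" if "i \<in> set ws" "j \<in> set ws" for i j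
      unfolding rigid_norm_diff[OF g] using Db that sub by blast
    show "norm (g (x v) - g (x i)) \<le> D" if "i \<in> set ws" for i
      unfolding rigid_norm_diff[OF g] using Db v that sub by blast
    show "\<bar>(d v i)\<^sup>2 - (norm (g (x v) - g (x i)))\<^sup>2\<bar> \<le> \<eta>" if "i \<in> set ws" for i
      using d ws(2) that unfolding data_close_def rigid_norm_diff[OF g] by auto
  qed
  also have "\<dots> \<le> 2 * real n * (\<delta> * (2 * D + 1) + \<eta>) * (D + 2) / k"
    using len k D small(3) \<eta>0 by (intro divide_right_mono mult_right_mono) auto
  finally show ?thesis .
qed

text \<open>
  Induction on the number of embedded nodes. A single constant has to cover the initial clique,
  the nodes embedded earlier and the new node, so it is the sum of the constants for the three; the
  threshold shrinks so that the earlier error \<open>C \<eta>\<close> is small enough for one more lateration.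
\<close>

proposition run_error:
  fixes n :: nat and E :: "(nat \<times> nat) set" and D k :: real
  assumes E: "simple_graph n E" and k: "k > 0" and D: "0 \<le> D"
  shows "\<exists>\<delta>>0. \<exists>C\<ge>0. runs_within n E {x :: nat \<Rightarrow> real ^ 'p. nondegenerate n D k x} N \<delta> C"
proof (induction N)
  case 0
  have F: False if c: "start_clique CARD('p) n E c" and run: "lateration_run n E d c S y" and "card S \<le> 0"
    for d c S and y :: "nat \<Rightarrow> real ^ 'p"
  proof -
    have "set c \<subseteq> S" "S \<subseteq> {1..n}" "c \<noteq> []"
      using run_nodes[OF run] c by (auto simp: start_clique_def)
    moreover from this have "finite S" using finite_subset by blast
    ultimately show False using \<open>card S \<le> 0\<close> by auto
  qed
  show ?case
    unfolding runs_within_def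
    by (rule exI[of _ 1], rule conjI, simp, rule exI[of _ 0], rule conjI, simp, use F in blast)
next
  case (Suc N)
  obtain \<delta> C where \<delta>: "\<delta> > 0" and C: "C \<ge> 0" and IH: "runs_within n E {x :: nat \<Rightarrow> real ^ 'p. nondegenerate n D k x} N \<delta> C"
    using Suc by (elim exE conjE) (rule that)
  let ?p = "real CARD('p)"
  define C0 where "C0 = ?p * ((?p + 1) / (2 * k)) * D"
  define C1 where "C1 = 2 * real n * (C * (2 * D + 1) + 1) * (D + 2) / k"
  define C' where "C' = C0 + C + C1"
  \<comment> \<open>The bound \<open>C \<eta> \<le> s\<close> is what a lateration step needs, since \<open>s\<^sup>2 \<le> s\<close>.\<close>
  define s where "s = min 1 (k / (16 * real n + 1))"
  define \<delta>' where "\<delta>' = min \<delta> (min (k / (?p + 1)) (s / (C + 1)))"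
  have C0: "C0 \<ge> 0" and C1: "C1 \<ge> 0" using k D C by (simp_all add: C0_def C1_def)
  then have C': "C' \<ge> 0" "C0 \<le> C'" "C \<le> C'" "C1 \<le> C'" using C by (auto simp: C'_def)
  have s: "s > 0" "s \<le> 1" using k by (auto simp: s_def)
  have "\<delta>' > 0" using \<delta> k s C by (simp add: \<delta>'_def)
  moreover have "\<exists>g. rigid_transformation g \<and> (\<forall>i\<in>S. norm (y i - g (x i)) \<le> C' * \<eta>)"
    if x: "nondegenerate n D k x" and d: "data_close E x d \<eta>" and \<eta>: "\<eta> \<le> \<delta>'"
      and c: "start_clique CARD('p) n E c" and run: "lateration_run n E d c S y" and S: "card S \<le> Suc N"
    for x y :: "nat \<Rightarrow> real ^ 'p" and d \<eta> c S
  proof -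
    have \<eta>0: "0 \<le> \<eta>" using d by (simp add: data_close_def)
    have \<eta>1: "\<eta> \<le> \<delta>" "\<eta> \<le> k / (?p + 1)" "\<eta> \<le> s / (C + 1)" using \<eta> by (simp_all add: \<delta>'_def)
    have C\<eta>: "C * \<eta> \<le> s"
    proof -
      have "C * \<eta> \<le> (C + 1) * \<eta>" using \<eta>0 by (simp add: distrib_right)
      also have "\<dots> \<le> s" using \<eta>1(3) C by (simp add: field_simps)
      finally show ?thesis .
    qed
    from run show ?thesis
    proof cases
      case start
      have "real (CARD('p) + 1) * \<eta> \<le> k" using \<eta>1(2) by (simp add: field_simps add_pos_pos)
      then have "real (CARD('p) + 1) * \<eta> / (2 * k) < 1" using k by simp
      from start_error[OF E c x k d this start(2)] start(1)
      obtain g where g: "rigid_transformation g"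
        "\<And>i. i \<in> S \<Longrightarrow> norm (y i - g (x i)) \<le> ?p * (real (CARD('p) + 1) * \<eta> / (2 * k)) * D" by blast
      have "?p * (real (CARD('p) + 1) * \<eta> / (2 * k)) * D = C0 * \<eta>" by (simp add: C0_def)
      also have "\<dots> \<le> C' * \<eta>" using C'(2) \<eta>0 by (rule mult_right_mono)
      finally show ?thesis using g by force
    next
      case (step S' y' v ws)
      have sub: "S' \<subseteq> {1..n}" using run_nodes[OF step(3)] c by (auto simp: start_clique_def)
      then have "finite S'" using finite_subset by blast
      then have "card S' \<le> N" using S step by simp
      then obtain g where g: "rigid_transformation g" and
        gy: "\<forall>i\<in>S'. norm (y' i - g (x i)) \<le> C * \<eta>"
        using x by (auto intro: runs_withinD[OF IH _ d \<eta>1(1) c step(3)])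
      have sm: "16 * real n * (C * \<eta>)\<^sup>2 \<le> k" "C * \<eta> \<le> 1" "0 \<le> C * \<eta>"
      proof -
        show "0 \<le> C * \<eta>" using C \<eta>0 by simp
        show "C * \<eta> \<le> 1" using C\<eta> s by simp
        have "(C * \<eta>)\<^sup>2 \<le> s\<^sup>2" using C\<eta> C \<eta>0 by (intro power_mono) auto
        also have "\<dots> \<le> s" using s by (simp add: power2_eq_square mult_left_le)
        also have "\<dots> \<le> k / (16 * real n + 1)" by (simp add: s_def)
        finally have "16 * real n * (C * \<eta>)\<^sup>2 \<le> 16 * real n * (k / (16 * real n + 1))"
          by (rule mult_left_mono) simp
        also have "\<dots> \<le> k" using k by (simp add: field_simps)
        finally show "16 * real n * (C * \<eta>)\<^sup>2 \<le> k" .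
      qed
      have v: "v \<in> {1..n}" "v \<notin> S'" using step by auto
      have "norm (classical_lateration (map y' ws) (map (d v) ws) - g (x v))
        \<le> 2 * real n * (C * \<eta> * (2 * D + 1) + \<eta>) * (D + 2) / k"
        by (rule step_error[OF E x k D d g sub bspec[OF gy] sm v(1)]) (use step in auto)
      also have "\<dots> = C1 * \<eta>" by (simp add: C1_def algebra_simps add_divide_distrib)
      also have "\<dots> \<le> C' * \<eta>" using C'(4) \<eta>0 by (rule mult_right_mono)
      finally have nv: "norm (classical_lateration (map y' ws) (map (d v) ws) - g (x v)) \<le> C' * \<eta>" .
      have "norm (y i - g (x i)) \<le> C' * \<eta>" if i: "i \<in> S" for i
      proof (cases "i = v")
        case True
        then show ?thesis using nv step by simp
      next
        case False
        then have "norm (y i - g (x i)) \<le> C * \<eta>" using gy i step by simp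
        also have "\<dots> \<le> C' * \<eta>" using C'(3) \<eta>0 by (rule mult_right_mono)
        finally show ?thesis .
      qed
      with g show ?thesis by blast
    qed
  qed
  then have "runs_within n E {x :: nat \<Rightarrow> real ^ 'p. nondegenerate n D k x} (Suc N) \<delta>' C'"
    unfolding runs_within_def by blast
  ultimately show ?case using C'(1) by blast
qed

section \<open>Existence of executions and outputs\<close>

lemma complete_run_exists:
  fixes y :: "nat \<Rightarrow> real ^ 'p"
  assumes "lateration_run n E d c S y" "set c \<subseteq> {1..n}"
  shows "\<exists>S' (y' :: nat \<Rightarrow> real ^ 'p). complete_run n E d c S' y'"
  using assms
proof (induction "n - card S" arbitrary: S y rule: less_induct)
  case less
  show ?case
  proof (cases "complete_run n E d c S y")
    case False
    have sub: "S \<subseteq> {1..n}" using run_nodes[OF less.prems] by simp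
    then have fin: "finite S" using finite_subset by blast
    obtain v where v: "v \<in> {1..n} - S" and cv: "CARD('p) + 1 \<le> card {w \<in> S. (v, w) \<in> E}"
      using False less.prems(1) unfolding complete_run_def by (auto simp: not_less)
    obtain ws where ws: "set ws = {w \<in> S. (v, w) \<in> E}" "distinct ws"
      using finite_distinct_list[of "{w \<in> S. (v, w) \<in> E}"] fin by auto
    have len: "CARD('p) + 1 \<le> length ws" using cv ws distinct_card[OF ws(2)] by simp
    let ?y = "y(v := classical_lateration (map y ws) (map (d v) ws))"
    have run: "lateration_run n E d c (insert v S) ?y"
      by (rule lateration_run.step[OF less.prems(1) v ws(2) _ len]) (use ws in auto)
    have "insert v S \<subseteq> {1..n}" using sub v by auto
    then have "card (insert v S) \<le> n" using card_mono[of "{1..n}" "insert v S"] by simp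
    then have "n - card (insert v S) < n - card S" using fin v by simp
    then show ?thesis using less.hyps run less.prems(2) by blast
  qed blast
qed

lemma complete_run_from_clique_exists:
  assumes E: "simple_graph n E" and c: "start_clique CARD('p) n E c"
    and sym: "\<And>i j. (i, j) \<in> E \<Longrightarrow> d i j = d j i"
  shows "\<exists>S (y :: nat \<Rightarrow> real ^ 'p). complete_run n E d c S y"
proof -
  have dist: "distinct c" by (rule start_clique_distinct[OF E c])
  let ?d = "\<lambda>i j. if i = j then 0 else d (c ! i) (c ! j)"
  have "\<exists>z :: nat \<Rightarrow> real ^ 'p. classical_scaling (length c) ?d z"
    by (rule classical_scaling_exists)
      (use c sym in \<open>auto simp: start_clique_def clique_list_def\<close>)
  then obtain z :: "nat \<Rightarrow> real ^ 'p" where z: "classical_scaling (length c) ?d z" by blast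
  define y where "y a = z (the_inv_into {..<length c} ((!) c) a)" for a
  have inj: "inj_on ((!) c) {..<length c}" using dist by (auto simp: inj_on_def nth_eq_iff_index_eq)
  have yz: "y (c ! i) = z i" if "i < length c" for i
    using that by (simp add: y_def the_inv_into_f_f[OF inj])
  have "classical_scaling (length c) ?d (\<lambda>i. y (c ! i))"
    using z unfolding classical_scaling_def by (simp add: yz)
  then have "lateration_run n E d c (set c) y" by (rule lateration_run.start)
  then show ?thesis using c by (intro complete_run_exists) (auto simp: start_clique_def)
qed

text \<open>
  The first node of the laterative ordering that is not embedded would have enough embedded
  neighbours, contrary to completeness. Thus the set of embedded nodes is everything, whatever choices
  the run makes.
\<close>

lemma laterative_clique_run_full:
  fixes y :: "nat \<Rightarrow> real ^ 'p"
  assumes E: "simple_graph n E" and vs: "laterative_ordering CARD('p) n E vs"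
    and c: "set c = set (take (CARD('p) + 1) vs)" and run: "complete_run n E d c S y"
  shows "S = {1..n}"
proof -
  have dist: "distinct vs" and set: "set vs = {1..n}" using vs by (auto simp: laterative_ordering_def)
  have len: "length vs = n" using distinct_card[OF dist] set by simp
  have sub: "set c \<subseteq> S" "S \<subseteq> {1..n}"
    using run run_nodes[of n E d c S y] c set set_take_subset[of "CARD('p) + 1" vs]
    by (auto simp: complete_run_def)
  have "vs ! j \<in> S" if "j < n" for j
    using that
  proof (induction j rule: less_induct)
    case (less j)
    show ?case
    proof (cases "j < CARD('p) + 1")
      case True
      then have "vs ! j \<in> set (take (CARD('p) + 1) vs)" using less.prems len
        by (auto simp: in_set_conv_nth intro!: exI[of _ j])
      then show ?thesis using c sub by auto
    next
      case False
      let ?I = "{i. i < j \<and> (vs ! j, vs ! i) \<in> E}"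
      have I: "CARD('p) + 1 \<le> card ?I"
        using vs False less.prems unfolding laterative_ordering_def by auto
      have "(!) vs ` ?I \<subseteq> {w \<in> S. (vs ! j, w) \<in> E}" using less by auto
      moreover have "finite {w \<in> S. (vs ! j, w) \<in> E}" using finite_subset[OF sub(2)] by simp
      ultimately have "card ((!) vs ` ?I) \<le> card {w \<in> S. (vs ! j, w) \<in> E}" by (rule card_mono[rotated])
      moreover have "card ((!) vs ` ?I) = card ?I"
        using dist less.prems len by (intro card_image) (auto simp: inj_on_def nth_eq_iff_index_eq)
      ultimately have "card ?I \<le> card {w \<in> S. (vs ! j, w) \<in> E}" by (simp only:)
      with I have cd: "CARD('p) + 1 \<le> card {w \<in> S. (vs ! j, w) \<in> E}" by (rule le_trans)
      have "vs ! j \<in> {1..n}" using set less.prems len nth_mem by metis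
      then show ?thesis using run cd unfolding complete_run_def by (metis DiffI not_less)
    qed
  qed
  then have "set vs \<subseteq> S" using len by (auto simp: in_set_conv_nth)
  then have "{1..n} \<subseteq> S" unfolding set .
  with sub show ?thesis by auto
qed

lemma execution_exists:
  assumes E: "simple_graph n E" and sym: "\<And>i j. (i, j) \<in> E \<Longrightarrow> d i j = d j i"
  shows "\<exists>cs (R :: nat list \<Rightarrow> nat set \<times> (nat \<Rightarrow> real ^ 'p)). execution n E d cs R"
proof -
  let ?C = "{c. length c = CARD('p) + 1 \<and> set c \<subseteq> {1..n} \<and> clique_list E c}"
  have fin: "finite ?C"
    by (rule finite_subset[OF _ finite_lists_length_eq[of "{1..n}" "CARD('p) + 1"]]) auto
  obtain cs where cs: "set cs = ?C" using finite_list[OF fin] by (rule exE)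
  have "\<forall>c\<in>set cs. \<exists>r :: nat set \<times> (nat \<Rightarrow> real ^ 'p). complete_run n E d c (fst r) (snd r)"
    using complete_run_from_clique_exists[OF E _ sym, where 'p='p] cs
    by (auto simp: start_clique_def)
  then obtain R :: "nat list \<Rightarrow> nat set \<times> (nat \<Rightarrow> real ^ 'p)" where
    "\<forall>c\<in>set cs. complete_run n E d c (fst (R c)) (snd (R c))" by metis
  moreover have "clique_enumeration CARD('p) n E cs"
    unfolding clique_enumeration_def Let_def using cs by auto
  ultimately show ?thesis unfolding execution_def by blast
qed

section \<open>Uniformity in the edge lengths\<close>

text \<open>
  A threshold that is locally uniform can be chosen continuously: the supremum of the radii \<open>s \<le> 1\<close>
  such that \<open>s\<close> is a valid threshold on the ball of radius \<open>s\<close> is a 1-Lipschitz function of the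
  centre. Half of it is valid.
\<close>

lemma locally_uniform_imp_continuous_bound:
  fixes Z :: "'a::metric_space set" and P :: "'a \<Rightarrow> real \<Rightarrow> bool"
  assumes mono: "\<And>z s s'. P z s \<Longrightarrow> 0 < s' \<Longrightarrow> s' \<le> s \<Longrightarrow> P z s'"
    and loc: "\<And>z. z \<in> Z \<Longrightarrow> \<exists>s>0. \<forall>z'\<in>Z. dist z' z < s \<longrightarrow> P z' s"
  obtains f where "continuous_on Z f" "\<forall>z\<in>Z. f z > 0 \<and> P z (f z)"
proof -
  define A where "A z = {s. 0 < s \<and> s \<le> 1 \<and> (\<forall>z'\<in>Z. dist z' z < s \<longrightarrow> P z' s)}" for z
  define F where "F z = Sup (A z)" for z
  have bdd: "bdd_above (A z)" for z by (rule bdd_aboveI[of _ 1]) (simp add: A_def)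
  have ne: "\<exists>s. s \<in> A z" if z: "z \<in> Z" for z
  proof -
    obtain s where s: "s > 0" "\<And>z'. z' \<in> Z \<Longrightarrow> dist z' z < s \<Longrightarrow> P z' s" using loc[OF z] by blast
    have "min s 1 \<in> A z" using s mono[of _ s "min s 1"] by (auto simp: A_def)
    then show ?thesis by blast
  qed
  have up: "s \<le> F z" if "s \<in> A z" for s z unfolding F_def using that bdd by (rule cSup_upper)
  have pos: "F z > 0" if z: "z \<in> Z" for z
  proof -
    obtain s where "s \<in> A z" using ne[OF z] by blast
    with up[OF this] show ?thesis by (auto simp: A_def)
  qed
  have lip: "F z \<le> F w + dist z w" if z: "z \<in> Z" and w: "w \<in> Z" for z w
    unfolding F_def[of z]
  proof (rule cSup_least)
    show "A z \<noteq> {}" using ne[OF z] by blast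
    fix s assume s: "s \<in> A z"
    show "s \<le> F w + dist z w"
    proof (cases "s \<le> dist z w")
      case True
      with pos[OF w] show ?thesis by linarith
    next
      case False
      have "P z' (s - dist z w)" if z': "z' \<in> Z" "dist z' w < s - dist z w" for z'
      proof -
        have "dist z' z < s" using dist_triangle[of z' z w] z'(2) by (simp add: dist_commute)
        then have "P z' s" using s z'(1) by (simp add: A_def)
        then show ?thesis using False mono[of z' s "s - dist z w"] by simp
      qed
      moreover have "s \<le> 1" using s by (simp add: A_def)
      then have "s - dist z w \<le> 1" using zero_le_dist[of z w] by linarith
      ultimately have "s - dist z w \<in> A w" using False by (simp add: A_def)
      from up[OF this] show ?thesis by simp
    qed
  qed
  have "continuous_on Z F"
    unfolding continuous_on_iff
  proof (intro ballI allI impI)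
    fix z and e :: real assume z: "z \<in> Z" and e: "0 < e"
    have "dist (F z') (F z) < e" if "z' \<in> Z" "dist z' z < e" for z'
      using lip[OF z that(1)] lip[OF that(1) z] that(2) by (simp add: dist_real_def dist_commute abs_less_iff)
    then show "\<exists>d>0. \<forall>x'\<in>Z. dist x' z < d \<longrightarrow> dist (F x') (F z) < e" using e by blast
  qed
  then have "continuous_on Z (\<lambda>z. F z / 2)" by (intro continuous_intros) auto
  moreover have "F z / 2 > 0 \<and> P z (F z / 2)" if z: "z \<in> Z" for z
  proof -
    have "F z / 2 < Sup (A z)" using pos[OF z] by (simp add: F_def)
    moreover have "A z \<noteq> {}" using ne[OF z] by blast
    ultimately obtain s where s: "s \<in> A z" "F z / 2 < s" by (rule less_cSupE)
    then have "P z s" using z by (simp add: A_def)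
    then show ?thesis using mono[of z s "F z / 2"] s(2) pos[OF z] by simp
  qed
  ultimately show ?thesis by (intro that) auto
qed

lemma general_position_nondegenerate:
  fixes x :: "nat \<Rightarrow> real ^ 'p"
  assumes x: "general_position n x"
  obtains D k where "0 \<le> D" "k > 0" "nondegenerate n D k x"
proof -
  let ?D = "\<Sum>i\<in>{1..n}. \<Sum>j\<in>{1..n}. norm (x i - x j)"
  have Dle: "norm (x i - x j) \<le> ?D" if ij: "i \<in> {1..n}" "j \<in> {1..n}" for i j
  proof -
    have "norm (x i - x j) \<le> (\<Sum>j\<in>{1..n}. norm (x i - x j))"
      by (rule member_le_sum[OF ij(2)]) auto
    also have "\<dots> \<le> ?D"
      by (rule member_le_sum[OF ij(1), of "\<lambda>i. \<Sum>j\<in>{1..n}. norm (x i - x j)"]) (auto intro: sum_nonneg)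
    finally show ?thesis .
  qed
  let ?\<W> = "{W. W \<subseteq> {1..n} \<and> CARD('p) + 1 \<le> card W}"
  have "\<forall>W\<in>?\<W>. \<exists>k>0. well_spread k W x"
  proof
    fix W assume "W \<in> ?\<W>"
    then have W: "W \<subseteq> {1..n}" "CARD('p) + 1 \<le> card W" by auto
    then obtain V where V: "V \<subseteq> W" "card V = CARD('p) + 1" using obtain_subset_with_card_n by metis
    then have "affine hull (x ` V) = UNIV" using x W unfolding general_position_def by blast
    then have "affine hull (x ` W) = UNIV" using hull_mono[of "x ` V" "x ` W" affine] V by blast
    then show "\<exists>k>0. well_spread k W x"
      using finite_subset[OF W(1)] by (intro affinely_spanning_well_spread) auto
  qed
  then obtain \<kappa> where \<kappa>: "\<And>W. W \<in> ?\<W> \<Longrightarrow> \<kappa> W > 0 \<and> well_spread (\<kappa> W) W x" by metis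
  let ?k = "Min (insert 1 (\<kappa> ` ?\<W>))"
  have fin: "finite (insert 1 (\<kappa> ` ?\<W>))" by simp
  have "?k > 0" using fin \<kappa> by (subst Min_gr_iff) auto
  moreover have "well_spread ?k W x" if "W \<in> ?\<W>" for W
    using \<kappa>[OF that] Min_le[OF fin, of "\<kappa> W"] that by (blast intro: well_spread_mono)
  moreover have "0 \<le> ?D" by (intro sum_nonneg) auto
  ultimately show ?thesis using x Dle by (intro that[of ?D ?k]) (auto simp: nondegenerate_def)
qed

lemma nondegenerate_perturb:
  fixes x x' :: "nat \<Rightarrow> real ^ 'p"
  assumes x: "nondegenerate n D k x" and x': "general_position n x'"
    and g: "rigid_transformation g" and close: "\<And>i. i \<in> {1..n} \<Longrightarrow> norm (x' i - g (x i)) \<le> \<delta>"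
    and \<delta>: "\<delta> \<le> 1" "0 \<le> \<delta>" "16 * real n * \<delta>\<^sup>2 \<le> k"
  shows "nondegenerate n (D + 2) (k / 4) x'"
  unfolding nondegenerate_def
proof (intro conjI ballI allI impI x')
  fix i j assume ij: "i \<in> {1..n}" "j \<in> {1..n}"
  have eq: "((x' i - g (x i)) + (g (x i) - g (x j))) - (x' j - g (x j)) = x' i - x' j" by simp
  have "norm (x' i - x' j) \<le> norm (x' i - g (x i)) + norm (g (x i) - g (x j)) + norm (x' j - g (x j))"
    using norm_triangle_ineq4[of "(x' i - g (x i)) + (g (x i) - g (x j))" "x' j - g (x j)"]
      norm_triangle_ineq[of "x' i - g (x i)" "g (x i) - g (x j)"] unfolding eq by linarith
  moreover have "norm (g (x i) - g (x j)) \<le> D"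
    unfolding rigid_norm_diff[OF g] using x ij unfolding nondegenerate_def by blast
  ultimately show "norm (x' i - x' j) \<le> D + 2" using close[OF ij(1)] close[OF ij(2)] \<delta> by linarith
next
  fix W assume W: "W \<subseteq> {1..n}" "CARD('p) + 1 \<le> card W"
  have fin: "finite W" using finite_subset[OF W(1)] by simp
  have ne: "W \<noteq> {}" using W(2) by auto
  have "card W \<le> n" using card_mono[OF _ W(1)] by simp
  then have sm: "16 * real (card W) * \<delta>\<^sup>2 \<le> k"
    using \<delta>(3) mult_right_mono[of "16 * real (card W)" "16 * real n" "\<delta>\<^sup>2"] by simp
  have "well_spread k W x" using x W unfolding nondegenerate_def by blast
  then have "well_spread k W (\<lambda>i. g (x i))" by (rule well_spread_rigid[OF fin ne g])
  then show "well_spread (k / 4) W x'"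
    by (rule well_spread_perturb[OF fin ne _ _ sm]) (use close W in blast)
qed

text \<open>
  The assertion of the theorem for a single configuration and a single run, with threshold \<open>s\<close> and
  constant \<open>1 / s\<close>. One parameter serves for both, so that \<open>s\<close> may be decreased freely.
\<close>

definition stable_at :: "nat \<Rightarrow> (nat \<times> nat) set \<Rightarrow> (nat \<Rightarrow> real ^ 'p) \<Rightarrow> real \<Rightarrow> bool" where
  "stable_at n E x s \<longleftrightarrow>
     (\<forall>d \<epsilon> c y.
        (\<forall>(i, j)\<in>E. d i j = d j i \<and> (d i j)\<^sup>2 = (norm (x i - x j))\<^sup>2 + \<epsilon> i j) \<and>
        (\<Sum>(i, j)\<in>edges E. (\<epsilon> i j)\<^sup>2) \<le> s\<^sup>2 \<and>
        start_clique CARD('p) n E c \<and> lateration_run n E d c {1..n} y \<longrightarrow>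
        (\<exists>g. rigid_transformation g \<and>
          (\<Sum>i\<in>{1..n}. (norm (y i - g (x i)))\<^sup>2) \<le> 1 / s * (\<Sum>(i, j)\<in>edges E. (\<epsilon> i j)\<^sup>2)))"

lemma stable_at_mono:
  fixes x :: "nat \<Rightarrow> real ^ 'p"
  assumes st: "stable_at n E x s" and s: "0 < s'" "s' \<le> s"
  shows "stable_at n E x s'"
  unfolding stable_at_def
proof (intro allI impI, elim conjE)
  fix d \<epsilon> :: "nat \<Rightarrow> nat \<Rightarrow> real" and c and y :: "nat \<Rightarrow> real ^ 'p"
  let ?S = "\<Sum>(i, j)\<in>edges E. (\<epsilon> i j)\<^sup>2"
  assume *: "\<forall>(i, j)\<in>E. d i j = d j i \<and> (d i j)\<^sup>2 = (norm (x i - x j))\<^sup>2 + \<epsilon> i j"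
    "start_clique CARD('p) n E c" "lateration_run n E d c {1..n} y" and le: "?S \<le> s'\<^sup>2"
  have "?S \<le> s\<^sup>2" using le power_mono[of s' s 2] s by linarith
  with * have "\<exists>g. rigid_transformation g \<and> (\<Sum>i\<in>{1..n}. (norm (y i - g (x i)))\<^sup>2) \<le> 1 / s * ?S"
    by (intro st[unfolded stable_at_def, rule_format, of d \<epsilon> c y] conjI)
  moreover have "1 / s * ?S \<le> 1 / s' * ?S"
  proof (rule mult_right_mono)
    show "1 / s \<le> 1 / s'" using s by (simp add: frac_le)
    show "0 \<le> ?S" by (intro sum_nonneg) auto
  qed
  ultimately show "\<exists>g. rigid_transformation g \<and> (\<Sum>i\<in>{1..n}. (norm (y i - g (x i)))\<^sup>2) \<le> 1 / s' * ?S"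
    by (meson order_trans)
qed

lemma finite_edges: "simple_graph n E \<Longrightarrow> finite (edges E)"
  unfolding simple_graph_def edges_def by (rule finite_subset[of _ "{1..n} \<times> {1..n}"]) auto

lemma data_close_sqrt:
  fixes x :: "nat \<Rightarrow> real ^ 'p"
  assumes E: "simple_graph n E"
    and d: "\<forall>(i, j)\<in>E. d i j = d j i \<and> (d i j)\<^sup>2 = (norm (x i - x j))\<^sup>2 + \<epsilon> i j"
  shows "data_close E x d (sqrt (\<Sum>(i, j)\<in>edges E. (\<epsilon> i j)\<^sup>2))"
proof -
  let ?S = "\<Sum>(i, j)\<in>edges E. (\<epsilon> i j)\<^sup>2"
  have S0: "0 \<le> ?S" by (intro sum_nonneg) auto
  have fin: "finite (edges E)" by (rule finite_edges[OF E])
  have e1: "\<bar>\<epsilon> i j\<bar> \<le> sqrt ?S" if "(i, j) \<in> edges E" for i j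
  proof -
    have "(\<epsilon> i j)\<^sup>2 \<le> ?S"
      using member_le_sum[OF that, of "\<lambda>(i, j). (\<epsilon> i j)\<^sup>2"] fin by auto
    then show ?thesis using real_sqrt_le_mono[of "(\<epsilon> i j)\<^sup>2" ?S] by simp
  qed
  have "d i j = d j i \<and> \<bar>(d i j)\<^sup>2 - (norm (x i - x j))\<^sup>2\<bar> \<le> sqrt ?S" if ij: "(i, j) \<in> E" for i j
  proof -
    have ji: "(j, i) \<in> E" and ne: "i \<noteq> j" using ij E unfolding simple_graph_def sym_def irrefl_def by auto
    have dij: "d i j = d j i" "\<epsilon> i j = (d i j)\<^sup>2 - (norm (x i - x j))\<^sup>2" "\<epsilon> j i = (d j i)\<^sup>2 - (norm (x j - x i))\<^sup>2"
      using d ij ji by fastforce+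
    then have "\<epsilon> i j = \<epsilon> j i" by (simp add: norm_minus_commute)
    moreover have "(i, j) \<in> edges E \<or> (j, i) \<in> edges E" using ij ji ne by (auto simp: edges_def)
    ultimately have "\<bar>\<epsilon> i j\<bar> \<le> sqrt ?S" using e1[of i j] e1[of j i] by auto
    then show ?thesis using dij by simp
  qed
  then show ?thesis unfolding data_close_def using S0 by auto
qed

lemma nondegenerate_stable:
  assumes E: "simple_graph n E" and k: "k > 0" and D: "0 \<le> D"
  obtains s where "s > 0" "\<And>x :: nat \<Rightarrow> real ^ 'p. nondegenerate n D k x \<Longrightarrow> stable_at n E x s"
proof -
  obtain \<delta> C where \<delta>: "\<delta> > 0" and C: "C \<ge> 0" and err: "runs_within n E {x :: nat \<Rightarrow> real ^ 'p. nondegenerate n D k x} n \<delta> C"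
    using run_error[OF E k D, of n, where 'p='p] by (elim exE conjE) (rule that)
  define s where "s = min \<delta> (1 / (real n * C\<^sup>2 + 1))"
  have pos: "real n * C\<^sup>2 + 1 > 0" by (intro add_nonneg_pos mult_nonneg_nonneg) auto
  have s: "s > 0" "s \<le> \<delta>" using \<delta> pos by (auto simp: s_def)
  have ns: "real n * C\<^sup>2 \<le> 1 / s"
  proof -
    have "s \<le> 1 / (real n * C\<^sup>2 + 1)" by (simp add: s_def)
    then have "s * (real n * C\<^sup>2 + 1) \<le> 1" using pos by (simp add: le_divide_eq)
    then have "s * (real n * C\<^sup>2) \<le> 1" using s(1) by (simp add: distrib_left)
    then show ?thesis using s(1) by (simp add: le_divide_eq mult.commute)
  qed
  have "stable_at n E x s" if x: "nondegenerate n D k x" for x :: "nat \<Rightarrow> real ^ 'p"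
    unfolding stable_at_def
  proof (intro allI impI, elim conjE)
    fix d \<epsilon> :: "nat \<Rightarrow> nat \<Rightarrow> real" and c and y :: "nat \<Rightarrow> real ^ 'p"
    let ?S = "\<Sum>(i, j)\<in>edges E. (\<epsilon> i j)\<^sup>2"
    assume d: "\<forall>(i, j)\<in>E. d i j = d j i \<and> (d i j)\<^sup>2 = (norm (x i - x j))\<^sup>2 + \<epsilon> i j"
      and c: "start_clique CARD('p) n E c" and run: "lateration_run n E d c {1..n} y" and le: "?S \<le> s\<^sup>2"
    have S0: "0 \<le> ?S" by (intro sum_nonneg) auto
    have "sqrt ?S \<le> s" using real_sqrt_le_mono[OF le] s(1) by simp
    then have "sqrt ?S \<le> \<delta>" using s(2) by simp
    then obtain g where g: "rigid_transformation g"
      "\<forall>i\<in>{1..n}. norm (y i - g (x i)) \<le> C * sqrt ?S"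
      by (rule runs_withinD[OF err _ data_close_sqrt[OF E d] _ c run, rotated]) (use x in simp_all)
    have "(\<Sum>i\<in>{1..n}. (norm (y i - g (x i)))\<^sup>2) \<le> (\<Sum>i\<in>{1..n}. (C * sqrt ?S)\<^sup>2)"
      by (intro sum_mono power_mono bspec[OF g(2)]) auto
    also have "\<dots> = real n * C\<^sup>2 * ?S" using S0 by (simp add: power_mult_distrib)
    also have "\<dots> \<le> 1 / s * ?S" using ns S0 by (rule mult_right_mono)
    finally show "\<exists>g. rigid_transformation g \<and> (\<Sum>i\<in>{1..n}. (norm (y i - g (x i)))\<^sup>2) \<le> 1 / s * ?S"
      using g(1) by blast
  qed
  with s(1) show ?thesis by (rule that)
qed

lemma laterative_start_clique:
  assumes E: "simple_graph n E" and n: "p + 1 \<le> n" and vs: "laterative_ordering p n E vs"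
  shows "start_clique p n E (take (p + 1) vs)"
proof -
  have dist: "distinct vs" and set: "set vs = {1..n}" and cl: "clique_list E (take (p + 1) vs)"
    using vs by (auto simp: laterative_ordering_def)
  have "length vs = n" using distinct_card[OF dist] set by simp
  then show ?thesis using cl n set set_take_subset[of "p + 1" vs] by (auto simp: start_clique_def)
qed

text \<open>
  Quantitative rigidity of the graph, obtained by running the algorithm on the exact distances of
  \<open>x'\<close>. Seen from \<open>x'\<close> the data have no error, so the output is congruent to \<open>x'\<close>; seen from
  \<open>x\<close> they have error \<open>\<eta>\<close>, so the output is close to a congruent copy of \<open>x\<close>.
\<close>

lemma nearby_edge_lengths_imp_congruent_nearby:
  fixes x x' :: "nat \<Rightarrow> real ^ 'p"
  assumes lat: "lateration_graph CARD('p) n E"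
    and x: "nondegenerate n D k x" and x': "general_position n x'"
    and err: "runs_within n E {x :: nat \<Rightarrow> real ^ 'p. nondegenerate n D k x} n \<delta> C"
    and close: "data_close E x (\<lambda>i j. norm (x' i - x' j)) \<eta>" and \<eta>: "\<eta> \<le> \<delta>"
  obtains g where "rigid_transformation g" "\<And>i. i \<in> {1..n} \<Longrightarrow> norm (x' i - g (x i)) \<le> C * \<eta>"
proof -
  let ?d = "\<lambda>i j. norm (x' i - x' j)"
  have E: "simple_graph n E" and n: "CARD('p) + 1 \<le> n" using lat by (auto simp: lateration_graph_def)
  obtain vs where vs: "laterative_ordering CARD('p) n E vs" using lat by (auto simp: lateration_graph_def)
  let ?c = "take (CARD('p) + 1) vs"
  have c: "start_clique CARD('p) n E ?c" by (rule laterative_start_clique[OF E n vs])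
  have "\<exists>S (y :: nat \<Rightarrow> real ^ 'p). complete_run n E ?d ?c S y"
    by (rule complete_run_from_clique_exists[OF E c]) (simp add: norm_minus_commute)
  then obtain S and y :: "nat \<Rightarrow> real ^ 'p" where run: "complete_run n E ?d ?c S y" by blast
  have "S = {1..n}" by (rule laterative_clique_run_full[OF E vs refl run])
  with run have run: "lateration_run n E ?d ?c {1..n} y" by (simp add: complete_run_def)
  obtain g where g: "rigid_transformation g" "\<forall>i\<in>{1..n}. norm (y i - g (x i)) \<le> C * \<eta>"
    by (rule runs_withinD[OF err _ close \<eta> c run]) (use x in simp_all)
  obtain D' k' where D': "0 \<le> D'" "k' > 0" "nondegenerate n D' k' x'"
    using general_position_nondegenerate[OF x'] by blast
  obtain s where "s > 0" and st: "\<And>x :: nat \<Rightarrow> real ^ 'p. nondegenerate n D' k' x \<Longrightarrow> stable_at n E x s"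
    using nondegenerate_stable[OF E D'(2,1), where 'p='p] by blast
  have "\<exists>h. rigid_transformation h \<and>
      (\<Sum>i\<in>{1..n}. (norm (y i - h (x' i)))\<^sup>2) \<le> 1 / s * (\<Sum>(i, j)\<in>edges E. ((\<lambda>_ _. 0 :: real) i j)\<^sup>2)"
    by (rule st[OF D'(3), unfolded stable_at_def, rule_format, of ?d "\<lambda>_ _. 0" ?c y])
       (use c run in \<open>auto simp: norm_minus_commute case_prod_unfold\<close>)
  then obtain h where h: "rigid_transformation h" "(\<Sum>i\<in>{1..n}. (norm (y i - h (x' i)))\<^sup>2) \<le> 0"
    by (auto simp: case_prod_unfold)
  have "(\<Sum>i\<in>{1..n}. (norm (y i - h (x' i)))\<^sup>2) = 0"
    using h(2) sum_nonneg[of "{1..n}" "\<lambda>i. (norm (y i - h (x' i)))\<^sup>2"] by simp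
  then have yh: "y i = h (x' i)" if "i \<in> {1..n}" for i
    using that by (subst (asm) sum_nonneg_eq_0_iff) auto
  obtain h' where h': "rigid_transformation h'" "\<forall>q. h' (h q) = q"
    by (rule rigid_inverse[OF h(1)])
  show ?thesis
  proof (rule that[of "\<lambda>q. h' (g q)"])
    show "rigid_transformation (\<lambda>q. h' (g q))" by (rule rigid_compose[OF h'(1) g(1)])
    fix i assume i: "i \<in> {1..n}"
    have "norm (x' i - h' (g (x i))) = norm (h' (h (x' i)) - h' (g (x i)))" by (simp add: h'(2))
    also have "\<dots> = norm (y i - g (x i))" unfolding rigid_norm_diff[OF h'(1)] yh[OF i] ..
    finally show "norm (x' i - h' (g (x i))) \<le> C * \<eta>" using g(2) i by simp
  qed
qed

lemma edge_lengths_neighbourhood: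
  fixes x :: "nat \<Rightarrow> real ^ 'p"
  assumes E: "simple_graph n E" and \<tau>: "\<tau> > 0"
  obtains e where "e > 0" "\<And>x' :: nat \<Rightarrow> real ^ 'p. dist (edge_lengths E x') (edge_lengths E x) < e \<Longrightarrow>
     data_close E x (\<lambda>i j. norm (x' i - x' j)) \<tau>"
proof -
  let ?l = "edge_lengths E x"
  have "eventually (\<lambda>l. \<bar>(l e)\<^sup>2 - (?l e)\<^sup>2\<bar> < \<tau>) (nhds ?l)" for e
  proof -
    have "continuous_on UNIV (\<lambda>l :: nat \<times> nat \<Rightarrow> real. \<bar>(l e)\<^sup>2 - (?l e)\<^sup>2\<bar>)"
      by (intro continuous_intros continuous_on_product_coordinates)
    then have "open {l :: nat \<times> nat \<Rightarrow> real. \<bar>(l e)\<^sup>2 - (?l e)\<^sup>2\<bar> < \<tau>}"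
      by (intro open_Collect_less continuous_on_const)
    then show ?thesis using \<tau> by (auto simp: eventually_nhds)
  qed
  then have "eventually (\<lambda>l. \<forall>e\<in>edges E. \<bar>(l e)\<^sup>2 - (?l e)\<^sup>2\<bar> < \<tau>) (nhds ?l)"
    by (intro eventually_ball_finite finite_edges[OF E] ballI)
  then obtain e where e: "e > 0"
    "\<And>l. dist l ?l < e \<Longrightarrow> \<forall>e\<in>edges E. \<bar>(l e)\<^sup>2 - (?l e)\<^sup>2\<bar> < \<tau>"
    unfolding eventually_nhds_metric by blast
  have "data_close E x (\<lambda>i j. norm (x' i - x' j)) \<tau>"
    if d: "dist (edge_lengths E x') ?l < e" for x' :: "nat \<Rightarrow> real ^ 'p"
  proof -
    have edge: "\<bar>(norm (x' i - x' j))\<^sup>2 - (norm (x i - x j))\<^sup>2\<bar> < \<tau>" if ij: "(i, j) \<in> edges E" for i j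
      using bspec[OF e(2)[OF d] ij] ij by (simp add: edge_lengths_def)
    have "\<bar>(norm (x' i - x' j))\<^sup>2 - (norm (x i - x j))\<^sup>2\<bar> \<le> \<tau>" if ij: "(i, j) \<in> E" for i j
    proof -
      have "(j, i) \<in> E" "i \<noteq> j" using ij E unfolding simple_graph_def sym_def irrefl_def by auto
      then have "(i, j) \<in> edges E \<or> (j, i) \<in> edges E" using ij by (auto simp: edges_def)
      then show ?thesis using edge[of i j] edge[of j i] by (auto simp: norm_minus_commute)
    qed
    then show ?thesis using \<tau> by (auto simp: data_close_def norm_minus_commute)
  qed
  with e(1) show ?thesis by (rule that)
qed

text \<open>
  If the edge lengths of \<open>x'\<close> are close to those of \<open>x\<close>, then \<open>x'\<close> is close to a congruent
  copy of \<open>x\<close> and inherits its diameter and spread bounds up to constants. The constants of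
  \<open>nondegenerate_stable\<close> for these weaker bounds apply to all such \<open>x'\<close>.
\<close>

lemma stable_locally_uniform:
  fixes x :: "nat \<Rightarrow> real ^ 'p"
  assumes lat: "lateration_graph CARD('p) n E" and x: "general_position n x"
  obtains s where "s > 0" "\<And>x' :: nat \<Rightarrow> real ^ 'p. general_position n x' \<Longrightarrow>
    dist (edge_lengths E x') (edge_lengths E x) < s \<Longrightarrow> stable_at n E x' s"
proof -
  have E: "simple_graph n E" using lat by (simp add: lateration_graph_def)
  obtain D k where D: "0 \<le> D" and k: "k > 0" and nd: "nondegenerate n D k x"
    using general_position_nondegenerate[OF x] by blast
  obtain \<delta> C where \<delta>: "\<delta> > 0" and C: "C \<ge> 0" and err: "runs_within n E {x :: nat \<Rightarrow> real ^ 'p. nondegenerate n D k x} n \<delta> C"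
    using run_error[OF E k D, of n, where 'p='p] by (elim exE conjE) (rule that)
  obtain s where s: "s > 0" and st: "\<And>x :: nat \<Rightarrow> real ^ 'p. nondegenerate n (D + 2) (k / 4) x \<Longrightarrow> stable_at n E x s"
    using nondegenerate_stable[OF E, of "k / 4" "D + 2", where 'p='p] D k by auto
  define r where "r = min 1 (k / (16 * real n + 1))"
  define \<tau> where "\<tau> = min \<delta> (r / (C + 1))"
  have r: "r > 0" "r \<le> 1" using k by (auto simp: r_def)
  have \<tau>: "\<tau> > 0" "\<tau> \<le> \<delta>" using \<delta> r C by (auto simp: \<tau>_def)
  have C\<tau>: "C * \<tau> \<le> r" "0 \<le> C * \<tau>"
  proof -
    have "C * \<tau> \<le> (C + 1) * \<tau>" using \<tau> by (simp add: distrib_right)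
    also have "\<dots> \<le> (C + 1) * (r / (C + 1))" using C by (intro mult_left_mono) (auto simp: \<tau>_def)
    finally show "C * \<tau> \<le> r" using C by simp
    show "0 \<le> C * \<tau>" using C \<tau> by simp
  qed
  have small: "16 * real n * (C * \<tau>)\<^sup>2 \<le> k"
  proof -
    have "(C * \<tau>)\<^sup>2 \<le> r\<^sup>2" using C\<tau> by (intro power_mono) auto
    also have "\<dots> \<le> r" using r by (simp add: power2_eq_square mult_left_le)
    also have "\<dots> \<le> k / (16 * real n + 1)" by (simp add: r_def)
    finally have "16 * real n * (C * \<tau>)\<^sup>2 \<le> 16 * real n * (k / (16 * real n + 1))"
      by (rule mult_left_mono) simp
    also have "\<dots> \<le> k" using k by (simp add: field_simps)
    finally show ?thesis .
  qed
  obtain e where e: "e > 0" "\<And>x' :: nat \<Rightarrow> real ^ 'p. dist (edge_lengths E x') (edge_lengths E x) < e \<Longrightarrow>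
     data_close E x (\<lambda>i j. norm (x' i - x' j)) \<tau>"
    using edge_lengths_neighbourhood[OF E \<tau>(1), of x] by blast
  have "stable_at n E x' (min e s)" if x': "general_position n x'"
    and d: "dist (edge_lengths E x') (edge_lengths E x) < min e s" for x' :: "nat \<Rightarrow> real ^ 'p"
  proof -
    have "data_close E x (\<lambda>i j. norm (x' i - x' j)) \<tau>" using e(2) d by simp
    then obtain g where g: "rigid_transformation g" "\<And>i. i \<in> {1..n} \<Longrightarrow> norm (x' i - g (x i)) \<le> C * \<tau>"
      using nearby_edge_lengths_imp_congruent_nearby[OF lat nd x' err _ \<tau>(2)] by blast
    have "nondegenerate n (D + 2) (k / 4) x'"
      by (rule nondegenerate_perturb[OF nd x' g(1)]) (use g(2) C\<tau> r small in auto)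
    then have "stable_at n E x' s" by (rule st)
    then show ?thesis by (rule stable_at_mono) (use e(1) s in auto)
  qed
  then show ?thesis using e(1) s by (intro that[of "min e s"]) auto
qed

lemma output_exists:
  fixes R :: "nat list \<Rightarrow> nat set \<times> (nat \<Rightarrow> real ^ 'p)"
  assumes c: "c \<in> set cs" and full: "fst (R c) = {1..n}"
  shows "\<exists>y. sequential_lateration_output variant n E d cs R y"
proof (cases variant)
  case First
  obtain c' where "find (\<lambda>c. fst (R c) = {1..n}) cs = Some c'"
    using c full by (metis (mono_tags, lifting) find_None_iff not_None_eq)
  then show ?thesis by (auto simp: First first_output_def)
next
  case Best
  let ?S = "(snd \<circ> R) ` {c \<in> set cs. fst (R c) = {1..n}}"
  have "finite ?S" "?S \<noteq> {}" using c full by auto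
  then have "\<exists>y. is_arg_min (stress E d) (\<lambda>z. z \<in> ?S) y" by (rule ex_is_arg_min_if_finite)
  then show ?thesis by (simp add: Best best_output_def)
qed

lemma output_is_full_run:
  fixes R :: "nat list \<Rightarrow> nat set \<times> (nat \<Rightarrow> real ^ 'p)"
  assumes ex: "execution n E d cs R" and y: "sequential_lateration_output variant n E d cs R y"
  obtains c where "start_clique CARD('p) n E c" "lateration_run n E d c {1..n} y"
proof -
  have "\<exists>c\<in>set cs. fst (R c) = {1..n} \<and> y = snd (R c)"
  proof (cases variant)
    case First
    then obtain c where "find (\<lambda>c. fst (R c) = {1..n}) cs = Some c" "y = snd (R c)"
      using y by (auto simp: first_output_def)
    then show ?thesis using nth_mem by (auto simp: find_Some_iff)
  next
    case Best
    then show ?thesis using y by (auto simp: best_output_def is_arg_min_def)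
  qed
  then obtain c where c: "c \<in> set cs" "fst (R c) = {1..n}" "y = snd (R c)" by blast
  have "lateration_run n E d c {1..n} y"
    using ex c unfolding execution_def complete_run_def by metis
  moreover have "start_clique CARD('p) n E c"
    using ex c(1) unfolding execution_def clique_enumeration_def Let_def start_clique_def by blast
  ultimately show ?thesis using that by blast
qed

section \<open>Stability of sequential lateration\<close>

theorem theorem2p1:
  fixes n :: nat and E :: "(nat \<times> nat) set"
  assumes "lateration_graph CARD('p::finite) n E"
  shows "\<exists>\<sigma> A :: (nat \<times> nat \<Rightarrow> real) \<Rightarrow> real.
    continuous_on (edge_lengths E ` {x :: nat \<Rightarrow> real ^ 'p. general_position n x}) \<sigma> \<and>
    continuous_on (edge_lengths E ` {x :: nat \<Rightarrow> real ^ 'p. general_position n x}) A \<and>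
    (\<forall>x :: nat \<Rightarrow> real ^ 'p. general_position n x \<longrightarrow>
      \<sigma> (edge_lengths E x) > 0 \<and> A (edge_lengths E x) > 0 \<and>
      (\<forall>d \<epsilon> :: nat \<Rightarrow> nat \<Rightarrow> real.
        (\<forall>(i, j)\<in>E. d i j \<ge> 0 \<and> d i j = d j i \<and>
           (d i j)\<^sup>2 = (norm (x i - x j))\<^sup>2 + \<epsilon> i j) \<and>
        (\<Sum>(i, j)\<in>edges E. (\<epsilon> i j)\<^sup>2) \<le> (\<sigma> (edge_lengths E x))\<^sup>2 \<longrightarrow>
        (\<exists>cs (R :: nat list \<Rightarrow> nat set \<times> (nat \<Rightarrow> real ^ 'p)). execution n E d cs R) \<and>
        (\<forall>variant cs (R :: nat list \<Rightarrow> nat set \<times> (nat \<Rightarrow> real ^ 'p)).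
           execution n E d cs R \<longrightarrow>
           (\<exists>y. sequential_lateration_output variant n E d cs R y) \<and>
           (\<forall>y. sequential_lateration_output variant n E d cs R y \<longrightarrow>
              (\<exists>g. is_arg_min (\<lambda>g. \<Sum>i\<in>{1..n}. (norm (y i - g (x i)))\<^sup>2)
                     rigid_transformation g \<and>
                   (\<Sum>i\<in>{1..n}. (norm (y i - g (x i)))\<^sup>2)
                     \<le> A (edge_lengths E x) * (\<Sum>(i, j)\<in>edges E. (\<epsilon> i j)\<^sup>2))))))"
proof -
  have E: "simple_graph n E" and n: "CARD('p) + 1 \<le> n"
    using assms by (auto simp: lateration_graph_def)
  obtain vs where vs: "laterative_ordering CARD('p) n E vs"
    using assms by (auto simp: lateration_graph_def)
  let ?Z = "edge_lengths E ` {x :: nat \<Rightarrow> real ^ 'p. general_position n x}"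
  let ?P = "\<lambda>l s. \<forall>x :: nat \<Rightarrow> real ^ 'p. general_position n x \<and> edge_lengths E x = l \<longrightarrow> stable_at n E x s"
  have mono: "?P l s'" if "?P l s" "0 < s'" "s' \<le> s" for l s s'
    using that stable_at_mono by blast
  have local: "\<exists>s>0. \<forall>l'\<in>?Z. dist l' l < s \<longrightarrow> ?P l' s" if l: "l \<in> ?Z" for l
  proof -
    obtain x :: "nat \<Rightarrow> real ^ 'p" where x: "general_position n x" "l = edge_lengths E x" using l by blast
    obtain s where "s > 0" "\<And>x' :: nat \<Rightarrow> real ^ 'p. general_position n x' \<Longrightarrow>
      dist (edge_lengths E x') (edge_lengths E x) < s \<Longrightarrow> stable_at n E x' s"
      using stable_locally_uniform[OF assms x(1)] by blast
    then show ?thesis unfolding x(2) by blast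
  qed
  obtain \<sigma> where cont: "continuous_on ?Z \<sigma>" and \<sigma>: "\<forall>l\<in>?Z. \<sigma> l > 0 \<and> ?P l (\<sigma> l)"
  proof (rule locally_uniform_imp_continuous_bound[of ?P ?Z])
    show "?P l s'" if "?P l s" "0 < s'" "s' \<le> s" for l s s' by (rule mono[OF that])
    show "\<exists>s>0. \<forall>l'\<in>?Z. dist l' l < s \<longrightarrow> ?P l' s" if "l \<in> ?Z" for l by (rule local[OF that])
  qed
  have contA: "continuous_on ?Z (\<lambda>l. 1 / \<sigma> l)"
    using cont \<sigma> by (intro continuous_intros) auto
  show ?thesis
  proof (rule exI[of _ \<sigma>], rule exI[of _ "\<lambda>l. 1 / \<sigma> l"], intro conjI cont contA allI impI)
    fix x :: "nat \<Rightarrow> real ^ 'p" assume x: "general_position n x"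
    let ?l = "edge_lengths E x"
    have l: "?l \<in> ?Z" using x by blast
    show "\<sigma> ?l > 0" "1 / \<sigma> ?l > 0" using bspec[OF \<sigma> l] by auto
    have st: "stable_at n E x (\<sigma> ?l)" using bspec[OF \<sigma> l] x by blast
    fix d \<epsilon> :: "nat \<Rightarrow> nat \<Rightarrow> real"
    let ?S = "\<Sum>(i, j)\<in>edges E. (\<epsilon> i j)\<^sup>2"
    assume d: "(\<forall>(i, j)\<in>E. d i j \<ge> 0 \<and> d i j = d j i \<and> (d i j)\<^sup>2 = (norm (x i - x j))\<^sup>2 + \<epsilon> i j) \<and>
        ?S \<le> (\<sigma> ?l)\<^sup>2"
    then have d': "\<forall>(i, j)\<in>E. d i j = d j i \<and> (d i j)\<^sup>2 = (norm (x i - x j))\<^sup>2 + \<epsilon> i j" by fast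
    then have sym: "\<And>i j. (i, j) \<in> E \<Longrightarrow> d i j = d j i" by fast
    show "\<exists>cs (R :: nat list \<Rightarrow> nat set \<times> (nat \<Rightarrow> real ^ 'p)). execution n E d cs R"
      by (rule execution_exists[OF E sym])
    fix variant cs and R :: "nat list \<Rightarrow> nat set \<times> (nat \<Rightarrow> real ^ 'p)"
    assume ex: "execution n E d cs R"
    have "start_clique CARD('p) n E (take (CARD('p) + 1) vs)" by (rule laterative_start_clique[OF E n vs])
    then obtain c where c: "c \<in> set cs" "set c = set (take (CARD('p) + 1) vs)"
      using ex unfolding execution_def clique_enumeration_def Let_def start_clique_def by blast
    have "complete_run n E d c (fst (R c)) (snd (R c))" using ex c(1) by (simp add: execution_def)
    then have "fst (R c) = {1..n}" by (rule laterative_clique_run_full[OF E vs c(2)])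
    with c(1) show "\<exists>y. sequential_lateration_output variant n E d cs R y" by (rule output_exists)
    fix y assume "sequential_lateration_output variant n E d cs R y"
    then obtain c where c: "start_clique CARD('p) n E c" "lateration_run n E d c {1..n} y"
      by (rule output_is_full_run[OF ex])
    let ?f = "\<lambda>g. \<Sum>i\<in>{1..n}. (norm (y i - g (x i)))\<^sup>2"
    have "\<exists>g. rigid_transformation g \<and> ?f g \<le> 1 / \<sigma> ?l * ?S"
      by (rule st[unfolded stable_at_def, rule_format, of d \<epsilon> c y]) (use d d' c in simp)
    then obtain g0 where g0: "rigid_transformation g0" "?f g0 \<le> 1 / \<sigma> ?l * ?S" by blast
    have "{1..n} \<noteq> {}" using n by simp
    then obtain g where g: "is_arg_min ?f rigid_transformation g"
      using rigid_argmin_exists[of "{1..n}" y x] by blast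
    then have "?f g \<le> ?f g0" using g0(1) unfolding is_arg_min_def by (meson not_less)
    with g g0(2) show "\<exists>g. is_arg_min ?f rigid_transformation g \<and> ?f g \<le> 1 / \<sigma> ?l * ?S"
      by (meson order_trans)
  qed
qed

end
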